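(* (i) Suppose that $2\le p<\infty$ and let $(\eta)=\{\eta_n\}_{n=0}^\infty$ be a sequence of complex numbers. If $\eta_n=O\left(\frac1n\right)$ as $n\to\infty$, then $\mathcal R_{(\eta)}\in\mathcal B(H^p)$. (ii) There exists a sequence of complex numbers $(\eta)=\{\eta_n\}_{n=0}^\infty$, with $\eta_n=O\left(\frac1n\right)$ as $n\to\infty$, such that $\mathcal R_{(\eta)}\notin\mathcal B(H^p)$ for $1\le p<2$. (iii) If $1<p<\infty$ and $(\eta)=\{\eta_n\}_{n=0}^\infty$ is a decreasing sequence of non-negative real numbers, then $\mathcal R_{(\eta)}\in\mathcal B(H^p)$ if and only if $\eta_n=O\left(\frac1n\right)$ as $n\to\infty$.
   Context: $\mathbb D$ is the open unit disc in $\mathbb C$, and $\mathrm{Hol}(\mathbb D)$ is the space of analytic functions in $\mathbb D$. For $0<p<\infty$, the Hardy space $H^p$ consists of those $f\in\mathrm{Hol}(\mathbb D)$ with $\|f\|_{H^p}=\sup_{0<r<1}\left(\frac1{2\pi}\int_0^{2\pi}|f(re^{it})|^p\,dt\right)^{1/p}<\infty$. Rhaly operator: for a complex sequence $(\eta)=\{\eta_n\}_{n=0}^\infty$ and $f(z)=\sum_{n=0}^\infty a_nz^n\in\mathrm{Hol}(\mathbb D)$, formally $\mathcal R_{(\eta)}(f)(z)=\sum_{n=0}^\infty\eta_n\left(\sum_{k=0}^na_k\right)z^n$, whenever the right-hand side defines an analytic function in $\mathbb D$. $\mathcal B(H^p)$ denotes the continuous linear operators from $H^p$ into itself; $\mathcal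 R_{(\eta)}\in\mathcal B(H^p)$ means that $\mathcal R_{(\eta)}$ is well defined on $H^p$, maps $H^p$ into $H^p$, and is bounded. *)

theory Defs
  imports "HOL-Complex_Analysis.Complex_Analysis" "HOL-Library.Landau_Symbols"
begin

text \<open>
  Functions on the unit disc are represented by total functions on the complex plane of which only
  the values on the open ball around 0 of radius 1 matter. Below, \<open>0 < p\<close> is intended.
\<close>

definition hardy_mean :: "real \<Rightarrow> (complex \<Rightarrow> complex) \<Rightarrow> real \<Rightarrow> real" where
  "hardy_mean p f r =
     (1 / (2 * pi) * integral {0..2 * pi} (\<lambda>t. norm (f (of_real r * cis t)) powr p)) powr (1 / p)"

definition hardy_space :: "real \<Rightarrow> (complex \<Rightarrow> complex) set" where
  "hardy_space p =
     {f. f holomorphic_on ball 0 1 \<and> bdd_above (hardy_mean p f ` {0<..<1})}"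

text \<open>The supremum is meaningful (finite) only on \<^term>\<open>hardy_space p\<close>.\<close>

definition hardy_norm :: "real \<Rightarrow> (complex \<Rightarrow> complex) \<Rightarrow> real" where
  "hardy_norm p f = (SUP r\<in>{0<..<1}. hardy_mean p f r)"

definition rhaly_coeff :: "(nat \<Rightarrow> complex) \<Rightarrow> (complex \<Rightarrow> complex) \<Rightarrow> nat \<Rightarrow> complex" where
  "rhaly_coeff \<eta> f n = \<eta> n * (\<Sum>k\<le>n. fps_nth (fps_expansion f 0) k)"

text \<open>
  A power series defines an analytic function in the disc iff it converges at every point of it.
\<close>

definition rhaly_defined :: "(nat \<Rightarrow> complex) \<Rightarrow> (complex \<Rightarrow> complex) \<Rightarrow> bool" where
  "rhaly_defined \<eta> f \<longleftrightarrow> (\<forall>z\<in>ball 0 1. summable (\<lambda>n. rhaly_coeff \<eta> f n * z ^ n))"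

definition rhaly :: "(nat \<Rightarrow> complex) \<Rightarrow> (complex \<Rightarrow> complex) \<Rightarrow> complex \<Rightarrow> complex" where
  "rhaly \<eta> f z = (\<Sum>n. rhaly_coeff \<eta> f n * z ^ n)"

text \<open>
  Linearity is required pointwise on the disc only, since values outside it are irrelevant.
\<close>

definition hardy_bounded_linear ::
    "real \<Rightarrow> ((complex \<Rightarrow> complex) \<Rightarrow> complex \<Rightarrow> complex) \<Rightarrow> bool" where
  "hardy_bounded_linear p T \<longleftrightarrow>
     (\<forall>f\<in>hardy_space p. T f \<in> hardy_space p) \<and>
     (\<forall>f\<in>hardy_space p. \<forall>g\<in>hardy_space p. \<forall>z\<in>ball 0 1. T (\<lambda>w. f w + g w) z = T f z + T g z) \<and>
     (\<forall>c. \<forall>f\<in>hardy_space p. \<forall>z\<in>ball 0 1. T (\<lambda>w. c * f w) z = c * T f z) \<and>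
     (\<exists>C. \<forall>f\<in>hardy_space p. hardy_norm p (T f) \<le> C * hardy_norm p f)"

definition rhaly_bounded :: "real \<Rightarrow> (nat \<Rightarrow> complex) \<Rightarrow> bool" where
  "rhaly_bounded p \<eta> \<longleftrightarrow>
     (\<forall>f\<in>hardy_space p. rhaly_defined \<eta> f) \<and> hardy_bounded_linear p (rhaly \<eta>)"

end

theory Submission imports Defs "HOL-Probability.Probability_Measure" begin

text \<open>
  Write \<open>S\<^sub>n\<close> for the partial sums of the Taylor coefficients of \<open>f\<close>. For \<open>p \<ge> 2\<close>, the dual of Paley's
  inequality bounds the \<open>p\<close>-th power of the norm of the image by the sum of \<open>n ^ (p - 2) * \<bar>\<eta>\<^sub>n S\<^sub>n\<bar> ^ p\<close>,
  hence by the sum of \<open>n ^ (- 2) * \<bar>S\<^sub>n\<bar> ^ p\<close>. Now \<open>S\<^sub>n\<close> is the integral of \<open>f\<close> against a Dirichlet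
  kernel, which is dominated by a kernel that is homogeneous of degree \<open>-1\<close>, and Schur's test applies.

  For decreasing \<open>\<eta>\<close> and \<open>1 < p < 2\<close> the same two inequalities are applied with the conjugate exponent
  to the adjoint operator, whose coefficients are integrals against the tails of a trigonometric series with
  monotone coefficients; summation by parts gives the same majorant for these.

  Necessity is tested on \<open>f z = 1 / (1 - r z) ^ 2\<close>, pairing the image of \<open>f\<close> with \<open>f\<close> itself. For the
  counterexample, \<open>\<eta>\<^sub>n\<close> is a Rudin--Shapiro sign divided by \<open>n + 1\<close>, and the image of the same \<open>f\<close> is paired
  with a Rudin--Shapiro polynomial, whose sup norm is of the order of the square root of its length.
\<close>

section \<open>Fourier coefficients on the circle\<close>

text \<open>Dual functions on the circle are only bounded and measurable: their coefficients of
  nonnegative index suffice, so no projection onto analytic functions enters.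

  Paley's inequality lives at exponents at most 2 and its dual at exponents at least 2; hence the
  detour through the adjoint for \<open>1 < p < 2\<close>. There
  \<open>r ^ n = r ^ k * r ^ (n - k)\<close>: the first factor goes with the \<open>k\<close>-th
  coefficient of \<open>f\<close>, the second keeps the weights decreasing in \<open>n\<close>.

  The powers in the tests: for \<open>1 - r\<close> of order \<open>1 / m\<close>, the
  \<open>p\<close>-norm of the test function is at most of order \<open>m powr (2 - 1 / p)\<close>,
  and the partial sums of its coefficients are of order \<open>n ^ 2\<close> for
  \<open>n < m\<close>. Pairing with itself yields \<open>m ^ 4\<close> times the weight at
  \<open>m\<close> against \<open>m ^ 3\<close>; pairing with a Rudin--Shapiro polynomial yields
  \<open>m ^ 2\<close> against \<open>m powr (1 / 2) * m powr (2 - 1 / p)\<close>, a contradiction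
  when \<open>1 / p > 1 / 2\<close>.\<close>

definition circ :: "real measure" where
  "circ = uniform_measure lborel {0<..<2 * pi}"

lemma sets_circ [measurable_cong, simp]: "sets circ = sets borel"
  by (simp add: circ_def)

lemma space_circ [simp]: "space circ = UNIV"
  by (simp add: circ_def)

lemma prob_space_circ: "prob_space circ"
  unfolding circ_def by (rule prob_space_uniform_measure) auto

interpretation circ: prob_space circ
  by (rule prob_space_circ)

lemma measure_circ_UNIV [simp]: "measure circ UNIV = 1"
  using circ.prob_space by simp

lemma AE_circ: "AE t in circ. 0 < t \<and> t < 2 * pi"
  unfolding circ_def by (subst AE_uniform_measure) auto

lemma integrable_circ_bounded:
  fixes g :: "real \<Rightarrow> 'b::{banach, second_countable_topology}"
  assumes "g \<in> borel_measurable borel" "\<And>t. norm (g t) \<le> B"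
  shows "integrable circ g"
  by (rule circ.integrable_const_bound[of _ B]) (use assms in auto)

lemma nn_integral_circ:
  assumes [measurable]: "f \<in> borel_measurable borel"
  shows "(\<integral>\<^sup>+t. f t \<partial>circ) = (\<integral>\<^sup>+t. f t * indicator {0<..<2 * pi} t \<partial>lborel) / ennreal (2 * pi)"
  unfolding circ_def by (subst nn_integral_uniform_measure) auto

lemma integral_circ:
  fixes f :: "real \<Rightarrow> 'b::euclidean_space"
  assumes "continuous_on UNIV f"
  shows "integral\<^sup>L circ f = (1 / (2 * pi)) *\<^sub>R integral {0..2 * pi} f"
proof -
  have m: "f \<in> borel_measurable borel"
    using assms by (rule borel_measurable_continuous_onI)
  have circ: "circ = density lborel (\<lambda>t. ennreal (indicator {0<..<2 * pi} t / (2 * pi)))"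
    unfolding circ_def uniform_measure_def
    by (intro density_cong)
       (auto simp: divide_ennreal[symmetric] ennreal_indicator intro!: AE_I2)
  have "integral\<^sup>L circ f = (\<integral>t. (indicator {0<..<2 * pi} t / (2 * pi)) *\<^sub>R f t \<partial>lborel)"
    unfolding circ by (subst integral_density) (use m in auto)
  also have "\<dots> = (\<integral>t. (1 / (2 * pi)) *\<^sub>R (indicator {0<..<2 * pi} t *\<^sub>R f t) \<partial>lborel)"
    by (intro Bochner_Integration.integral_cong) auto
  also have "\<dots> = (1 / (2 * pi)) *\<^sub>R (LINT t:{0<..<2 * pi}|lborel. f t)"
    unfolding set_lebesgue_integral_def by (rule Bochner_Integration.integral_scaleR_right)
  also have "(LINT t:{0<..<2 * pi}|lborel. f t) = integral {0<..<2 * pi} f"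
  proof (rule set_borel_integral_eq_integral)
    have "set_integrable lborel {0..2 * pi} f"
      by (rule borel_integrable_atLeastAtMost') (use assms continuous_on_subset in blast)
    then show "set_integrable lborel {0<..<2 * pi} f"
      by (rule set_integrable_subset) auto
  qed
  also have "\<dots> = integral {0..2 * pi} f"
    by (simp add: integral_open_interval_real)
  finally show ?thesis .
qed

lemma integral_circ_cis: "(\<integral>t. cis (of_int n * t) \<partial>circ) = (if n = 0 then 1 else 0)"
proof (cases "n = 0")
  case True
  then show ?thesis by simp
next
  case False
  have "((\<lambda>t. cis (of_int n * t)) has_integral
          (cis (of_int n * (2 * pi)) / (\<i> * of_int n) - cis (of_int n * 0) / (\<i> * of_int n))) {0..2 * pi}"
  proof (rule fundamental_theorem_of_calculus)
    fix t :: real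
    have "((\<lambda>z. exp (\<i> * of_int n * z) / (\<i> * of_int n)) has_field_derivative
           exp (\<i> * of_int n * of_real t)) (at (of_real t))"
      using False by (auto intro!: derivative_eq_intros)
    from has_vector_derivative_real_field[OF this, of "{0..2 * pi}"]
    show "((\<lambda>t. cis (of_int n * t) / (\<i> * of_int n)) has_vector_derivative
           cis (of_int n * t)) (at t within {0..2 * pi})"
      by (simp add: cis_conv_exp mult.assoc)
  qed simp
  moreover have "cis (of_int n * (2 * pi)) = 1"
    by (metis cis_multiple_2pi Ints_of_int mult.commute)
  ultimately have "integral {0..2 * pi} (\<lambda>t. cis (of_int n * t)) = 0"
    by (simp add: integral_unique)
  moreover have "continuous_on UNIV (\<lambda>t. cis (of_int n * t))"
    by (intro continuous_intros)
  ultimately show ?thesis using False by (subst integral_circ) auto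
qed

definition fourier :: "(real \<Rightarrow> complex) \<Rightarrow> nat \<Rightarrow> complex" where
  "fourier g n = (\<integral>t. g t * cis (- (real n * t)) \<partial>circ)"

lemma borel_measurable_cis [measurable]: "cis \<in> borel_measurable borel"
  by (intro borel_measurable_continuous_onI continuous_intros)

lemma borel_measurable_cnj [measurable (raw)]:
  "f \<in> borel_measurable M \<Longrightarrow> (\<lambda>x. cnj (f x)) \<in> borel_measurable M"
  by (rule measurable_compose[OF _ borel_measurable_continuous_onI[of cnj]])
     (auto intro: continuous_intros)

text \<open>The series of \<open>norm (c n) * B\<close> dominates, so sum and integral may be
  exchanged. On circles inside the disc this summability is automatic.\<close>

lemma integral_fourier_series:
  assumes c: "summable (\<lambda>n. norm (c n))"
    and g [measurable]: "g \<in> borel_measurable borel" and B: "\<And>t. norm (g t) \<le> B"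
  shows "(\<lambda>n. c n * (\<integral>t. cis (real n * t) * g t \<partial>circ)) sums
           (\<integral>t. (\<Sum>n. c n * cis (real n * t)) * g t \<partial>circ)"
proof -
  have B0: "B \<ge> 0" using B[of 0] norm_ge_zero order_trans by blast
  have int: "integrable circ (\<lambda>t. c n * cis (real n * t) * g t)" for n
    by (rule integrable_circ_bounded[of _ "norm (c n) * B"])
       (auto simp: norm_mult intro!: mult_left_mono B)
  have sm: "summable (\<lambda>n. norm (c n) * B)"
    by (intro summable_mult2 c)
  have sn: "summable (\<lambda>n. norm (c n * cis (real n * t) * g t))" for t
    by (rule summable_comparison_test'[OF sm, of 0])
       (auto simp: norm_mult intro!: mult_left_mono B)
  have "(\<lambda>n. \<integral>t. c n * cis (real n * t) * g t \<partial>circ) sums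
          (\<integral>t. (\<Sum>n. c n * cis (real n * t) * g t) \<partial>circ)"
  proof (rule sums_integral)
    show "summable (\<lambda>n. \<integral>t. norm (c n * cis (real n * t) * g t) \<partial>circ)"
    proof (rule summable_comparison_test'[OF sm, of 0])
      fix n :: nat
      have "(\<integral>t. norm (c n * cis (real n * t) * g t) \<partial>circ) \<le> (\<integral>t. norm (c n) * B \<partial>circ)"
        by (intro integral_mono integrable_norm int)
           (auto simp: norm_mult intro!: mult_left_mono B)
      then show "norm (\<integral>t. norm (c n * cis (real n * t) * g t) \<partial>circ) \<le> norm (c n) * B"
        by (simp add: integral_nonneg_AE)
    qed
  qed (use int sn in auto)
  moreover have "(\<integral>t. c n * cis (real n * t) * g t \<partial>circ) = c n * (\<integral>t. cis (real n * t) * g t \<partial>circ)" for n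
    by (simp add: mult.assoc)
  moreover have "(\<Sum>n. c n * cis (real n * t) * g t) = (\<Sum>n. c n * cis (real n * t)) * g t" for t
  proof (rule suminf_mult2[symmetric])
    show "summable (\<lambda>n. c n * cis (real n * t))"
      by (rule summable_norm_cancel) (simp add: norm_mult c)
  qed
  ultimately show ?thesis by simp
qed

lemma integral_cis_cnj:
  "(\<integral>t. cis (real n * t) * cnj (g t) \<partial>circ) = cnj (fourier g n)"
proof -
  have "cnj (fourier g n) = (\<integral>t. cnj (g t * cis (- (real n * t))) \<partial>circ)"
    unfolding fourier_def by (rule Bochner_Integration.integral_cnj[symmetric])
  then show ?thesis by (simp add: cis_cnj mult.commute)
qed

text \<open>Parseval's formula with only one side analytic: the power series has no negative
  frequencies, so those of \<open>g\<close> drop out of the integral.\<close>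

lemma fourier_pairing:
  assumes "summable (\<lambda>n. norm (c n))"
    and "g \<in> borel_measurable borel" and "\<And>t. norm (g t) \<le> B"
  shows "(\<lambda>n. c n * cnj (fourier g n)) sums
           (\<integral>t. (\<Sum>n. c n * cis (real n * t)) * cnj (g t) \<partial>circ)"
  using integral_fourier_series[of c "\<lambda>t. cnj (g t)" B] assms by (simp add: integral_cis_cnj)

lemma fourier_pairing_finite:
  assumes "g \<in> borel_measurable borel" and "\<And>t. norm (g t) \<le> B"
  shows "(\<integral>t. (\<Sum>n<N. c n * cis (real n * t)) * cnj (g t) \<partial>circ) = (\<Sum>n<N. c n * cnj (fourier g n))"
proof -
  let ?c = "\<lambda>n. if n < N then c n else 0"
  have "summable (\<lambda>n. norm (?c n))"
    by (rule summable_finite[of "{..<N}"]) auto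
  then have "(\<lambda>n. ?c n * cnj (fourier g n)) sums
           (\<integral>t. (\<Sum>n. ?c n * cis (real n * t)) * cnj (g t) \<partial>circ)"
    by (rule fourier_pairing) (use assms in auto)
  moreover have "(\<Sum>n. ?c n * cis (real n * t)) = (\<Sum>n<N. c n * cis (real n * t))" for t
    by (subst suminf_finite[of "{..<N}"]) auto
  moreover have "(\<lambda>n. ?c n * cnj (fourier g n)) sums (\<Sum>n<N. c n * cnj (fourier g n))"
    using sums_finite[of "{..<N}" "\<lambda>n. ?c n * cnj (fourier g n)"] by auto
  ultimately show ?thesis by (metis (no_types, lifting) sums_unique2 Bochner_Integration.integral_cong)
qed

lemma fourier_series:
  assumes c: "summable (\<lambda>n. norm (c n))"
  shows "fourier (\<lambda>t. \<Sum>n. c n * cis (real n * t)) m = c m"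
proof -
  have "(\<lambda>n. c n * (\<integral>t. cis (real n * t) * cis (- (real m * t)) \<partial>circ)) sums
           fourier (\<lambda>t. \<Sum>n. c n * cis (real n * t)) m"
    unfolding fourier_def
    by (rule integral_fourier_series[OF c, where B = 1]) auto
  moreover have "(\<integral>t. cis (real n * t) * cis (- (real m * t)) \<partial>circ) = (if n = m then 1 else 0)" for n
    using integral_circ_cis[of "int n - int m"] by (simp add: cis_mult algebra_simps)
  ultimately have "(\<lambda>n. if n = m then c n else 0) sums fourier (\<lambda>t. \<Sum>n. c n * cis (real n * t)) m"
    by (simp add: if_distrib cong: if_cong)
  moreover have "(\<lambda>n. if n = m then c n else 0) sums c m"
    using sums_single[of m c] by simp
  ultimately show ?thesis by (rule sums_unique2)
qed

section \<open>Trigonometric polynomials and Bessel's inequality\<close>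

lemma fourier_polynomial:
  "fourier (\<lambda>t. \<Sum>n<N. c n * cis (real n * t)) m = (if m < N then c m else 0)"
proof -
  let ?c = "\<lambda>n. if n < N then c n else 0"
  have "summable (\<lambda>n. norm (?c n))"
    by (rule summable_finite[of "{..<N}"]) auto
  moreover have "(\<Sum>n. ?c n * cis (real n * t)) = (\<Sum>n<N. c n * cis (real n * t))" for t
    by (subst suminf_finite[of "{..<N}"]) auto
  ultimately show ?thesis
    using fourier_series[of ?c m] by simp
qed

lemma integral_norm_polynomial:
  "(\<integral>t. (norm (\<Sum>n<N. c n * cis (real n * t)))\<^sup>2 \<partial>circ) = (\<Sum>n<N. (norm (c n))\<^sup>2)"
proof -
  let ?P = "\<lambda>t. \<Sum>n<N. c n * cis (real n * t)"
  have B: "norm (?P t) \<le> (\<Sum>n<N. norm (c n))" for t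
    by (rule order_trans[OF norm_sum]) (simp add: norm_mult)
  have "complex_of_real (\<integral>t. (norm (?P t))\<^sup>2 \<partial>circ) = (\<integral>t. ?P t * cnj (?P t) \<partial>circ)"
    by (simp only: complex_norm_square[symmetric] integral_complex_of_real flip: of_real_power)
  also have "\<dots> = (\<Sum>n<N. c n * cnj (fourier ?P n))"
    by (rule fourier_pairing_finite[where B = "\<Sum>n<N. norm (c n)"]) (use B in auto)
  also have "\<dots> = (\<Sum>n<N. c n * cnj (c n))"
    by (simp add: fourier_polynomial)
  also have "\<dots> = complex_of_real (\<Sum>n<N. (norm (c n))\<^sup>2)"
    by (simp only: complex_norm_square of_real_sum)
  finally show ?thesis by (simp only: of_real_eq_iff)
qed

text \<open>Pairing \<open>g\<close> with its own partial sum \<open>?P\<close> gives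
  \<open>?S\<close>, and so does the mean square of \<open>?P\<close>. Bounding the pairing by half
  the sum of the two mean squares leaves \<open>?S / 2\<close> on the right, to be absorbed.\<close>

lemma bessel_inequality:
  assumes g [measurable]: "g \<in> borel_measurable borel" and B: "\<And>t. norm (g t) \<le> B"
  shows "(\<Sum>n<N. (norm (fourier g n))\<^sup>2) \<le> (\<integral>t. (norm (g t))\<^sup>2 \<partial>circ)"
proof -
  let ?b = "fourier g"
  let ?P = "\<lambda>t. \<Sum>n<N. ?b n * cis (real n * t)"
  let ?S = "\<Sum>n<N. (norm (?b n))\<^sup>2"
  define D where "D = (\<Sum>n<N. norm (?b n))"
  have B0: "B \<ge> 0" using B[of 0] norm_ge_zero order_trans by blast
  have PB: "norm (?P t) \<le> D" for t
    unfolding D_def by (rule order_trans[OF norm_sum]) (simp add: norm_mult)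
  have D0: "D \<ge> 0" unfolding D_def by (simp add: sum_nonneg)
  have i1: "integrable circ (\<lambda>t. (norm (g t))\<^sup>2)"
    by (rule integrable_circ_bounded[of _ "B\<^sup>2"]) (auto intro!: power_mono B)
  have i2: "integrable circ (\<lambda>t. (norm (?P t))\<^sup>2)"
    by (rule integrable_circ_bounded[of _ "D\<^sup>2"]) (auto intro!: power_mono PB)
  have i3: "integrable circ (\<lambda>t. ?P t * cnj (g t))"
    by (rule integrable_circ_bounded[of _ "D * B"])
       (auto simp: norm_mult intro!: mult_mono B PB D0)
  have "(\<integral>t. ?P t * cnj (g t) \<partial>circ) = (\<Sum>n<N. ?b n * cnj (?b n))"
    by (rule fourier_pairing_finite[OF g B])
  also have "\<dots> = complex_of_real ?S"
    by (simp only: complex_norm_square of_real_sum)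
  finally have S: "?S = Re (\<integral>t. ?P t * cnj (g t) \<partial>circ)" by simp
  also have "\<dots> = (\<integral>t. Re (?P t * cnj (g t)) \<partial>circ)"
    by (rule integral_Re[symmetric]) (rule i3)
  also have "\<dots> \<le> (\<integral>t. ((norm (g t))\<^sup>2 + (norm (?P t))\<^sup>2) / 2 \<partial>circ)"
  proof (intro integral_mono integrable_divide Bochner_Integration.integrable_add i1 i2)
    show "integrable circ (\<lambda>t. Re (?P t * cnj (g t)))"
      using i3 by (rule integrable_Re)
    fix t
    have "Re (?P t * cnj (g t)) \<le> norm (?P t) * norm (g t)"
      by (metis complex_Re_le_cmod complex_mod_cnj norm_mult)
    also have "\<dots> \<le> ((norm (g t))\<^sup>2 + (norm (?P t))\<^sup>2) / 2"
      using sum_squares_bound[of "norm (?P t)" "norm (g t)"] by simp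
    finally show "Re (?P t * cnj (g t)) \<le> ((norm (g t))\<^sup>2 + (norm (?P t))\<^sup>2) / 2" .
  qed
  also have "\<dots> = ((\<integral>t. (norm (g t))\<^sup>2 \<partial>circ) + ?S) / 2"
    using i1 i2 by (simp add: integral_norm_polynomial)
  finally show ?thesis by simp
qed

section \<open>Paley's inequality\<close>

text \<open>Since \<open>1 / m\<^sup>2 \<le> 2 / m - 2 / (m + 1)\<close>, the sum over
  \<open>m > x / A\<close> telescopes to at most twice the reciprocal of its first index. With
  \<open>A\<close> the mean of the modulus of a function, this is the weak type (1,1) half of
  Paley's inequality.\<close>

lemma sum_inverse_squares_above_le:
  assumes "0 \<le> A" "0 < x"
  shows "(\<Sum>n<N. if x < real (Suc n) * A then 1 / (real (Suc n))\<^sup>2 else 0) \<le> 2 * A / x"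
proof (cases "A = 0")
  case True
  then show ?thesis using assms by simp
next
  case False
  then have A: "A > 0" using assms by simp
  \<comment> \<open>Subtracting the remainder \<open>2 / real (Suc N)\<close> makes the induction go
    through; \<open>max 0\<close> covers the stage before the first index above the
    threshold.\<close>
  have "(\<Sum>n<N. if x < real (Suc n) * A then 1 / (real (Suc n))\<^sup>2 else 0)
          \<le> max 0 (2 * A / x - 2 / real (Suc N))"
  proof (induction N)
    case (Suc N)
    show ?case
    proof (cases "x < real (Suc N) * A")
      case True
      have *: "1 / (real (Suc N))\<^sup>2 \<le> 2 / real (Suc N) - 2 / real (Suc (Suc N))"
      proof -
        define x where "x = real (Suc N)"
        have "x \<ge> 1" by (simp add: x_def)
        then have "2 / x - 2 / (x + 1) - 1 / x\<^sup>2 = (x - 1) / (x\<^sup>2 * (x + 1))"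
          by (simp add: divide_simps) (simp add: algebra_simps power2_eq_square)
        moreover have "(x - 1) / (x\<^sup>2 * (x + 1)) \<ge> 0" using \<open>x \<ge> 1\<close> by simp
        ultimately have "1 / x\<^sup>2 \<le> 2 / x - 2 / (x + 1)" by linarith
        moreover have "real (Suc (Suc N)) = x + 1" by (simp add: x_def)
        ultimately show ?thesis by (simp only: x_def)
      qed
      have "2 / real (Suc N) < 2 * A / x"
        using True assms by (simp add: field_simps)
      then have "max 0 (2 * A / x - 2 / real (Suc N)) = 2 * A / x - 2 / real (Suc N)"
        by simp
      then show ?thesis using Suc True * by simp
    next
      case False
      have "2 / real (Suc (Suc N)) \<le> 2 / real (Suc N)"
        by (simp add: field_simps)
      then show ?thesis using Suc False by (simp del: of_nat_Suc)
    qed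
  qed simp
  also have "\<dots> \<le> 2 * A / x"
    using assms by simp
  finally show ?thesis .
qed

text \<open>The distribution function of \<open>n \<mapsto> (n + 1) \<bar>fourier g n\<bar>\<close> with respect to the weights
  \<open>1 / (n + 1)\<^sup>2\<close>: the part of \<open>g\<close> above the level \<open>\<alpha>\<close> is estimated in \<open>L\<^sup>1\<close>, the part
  below it in \<open>L\<^sup>2\<close>.\<close>

lemma fourier_distribution_le:
  assumes g [measurable]: "g \<in> borel_measurable borel" and B: "\<And>t. norm (g t) \<le> B"
    and \<alpha>: "0 < \<alpha>"
  shows "(\<Sum>n<N. if \<alpha> < real (Suc n) * norm (fourier g n) then 1 / (real (Suc n))\<^sup>2 else 0)
    \<le> (\<integral>t. (if \<alpha> < norm (g t) then 4 / \<alpha> * norm (g t) else 4 / \<alpha>\<^sup>2 * (norm (g t))\<^sup>2) \<partial>circ)"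
proof -
  define g1 where "g1 = (\<lambda>t. if \<alpha> < norm (g t) then g t else 0)"
  define g2 where "g2 = (\<lambda>t. if \<alpha> < norm (g t) then 0 else g t)"
  have [measurable]: "g1 \<in> borel_measurable borel" "g2 \<in> borel_measurable borel"
    unfolding g1_def g2_def by measurable
  have B0: "B \<ge> 0" using B[of 0] norm_ge_zero order_trans by blast
  have B1: "norm (g1 t) \<le> B" and B2: "norm (g2 t) \<le> B" for t
    using B[of t] B0 by (auto simp: g1_def g2_def)
  have i1: "integrable circ (\<lambda>t. norm (g1 t))"
    by (rule integrable_circ_bounded[of _ B]) (use B1 in auto)
  have i2: "integrable circ (\<lambda>t. (norm (g2 t))\<^sup>2)"
    by (rule integrable_circ_bounded[of _ "B\<^sup>2"]) (auto intro!: power_mono B2)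
  have ic: "integrable circ (\<lambda>t. h t * cis (- (real n * t)))"
    if "h \<in> borel_measurable borel" "\<And>t. norm (h t) \<le> B" for h n
    by (rule integrable_circ_bounded[of _ B]) (use that in \<open>auto simp: norm_mult\<close>)
  define A where "A = (\<integral>t. norm (g1 t) \<partial>circ)"
  have A0: "A \<ge> 0" unfolding A_def by (simp add: integral_nonneg_AE)
  have f1: "norm (fourier g1 n) \<le> A" for n
    unfolding fourier_def A_def
    by (rule order_trans[OF integral_norm_bound]) (simp add: norm_mult)
  have fadd: "fourier g n = fourier g1 n + fourier g2 n" for n
  proof -
    have "fourier g n = (\<integral>t. g1 t * cis (- (real n * t)) + g2 t * cis (- (real n * t)) \<partial>circ)"
      unfolding fourier_def by (intro Bochner_Integration.integral_cong) (auto simp: g1_def g2_def)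
    also have "\<dots> = fourier g1 n + fourier g2 n"
      unfolding fourier_def by (intro Bochner_Integration.integral_add ic B1 B2) auto
    finally show ?thesis .
  qed
  \<comment> \<open>When the left-hand condition holds, \<open>g1\<close> or \<open>g2\<close>
    contributes at least half of \<open>\<alpha>\<close>. For \<open>g2\<close> the weight
    \<open>1 / (n + 1)\<^sup>2\<close> is then traded for the squared coefficient, as in Chebyshev's
    inequality, which prepares for Bessel.\<close>
  have "(if \<alpha> < real (Suc n) * norm (fourier g n) then 1 / (real (Suc n))\<^sup>2 else 0)
      \<le> (if \<alpha> / 2 < real (Suc n) * A then 1 / (real (Suc n))\<^sup>2 else 0) + 4 / \<alpha>\<^sup>2 * (norm (fourier g2 n))\<^sup>2"
    (is "?l \<le> ?r1 + ?r2") for n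
  proof (cases "\<alpha> < real (Suc n) * norm (fourier g n) \<and> \<not> \<alpha> / 2 < real (Suc n) * A")
    case True
    have "\<alpha> < real (Suc n) * norm (fourier g n)" using True by simp
    also have "\<dots> \<le> real (Suc n) * (norm (fourier g1 n) + norm (fourier g2 n))"
      unfolding fadd by (intro mult_left_mono norm_triangle_ineq) auto
    also have "\<dots> \<le> real (Suc n) * A + real (Suc n) * norm (fourier g2 n)"
      unfolding distrib_left by (intro add_mono mult_left_mono f1) auto
    finally have "\<alpha> \<le> 2 * (real (Suc n) * norm (fourier g2 n))" using True by simp
    then have "\<alpha>\<^sup>2 \<le> (2 * (real (Suc n) * norm (fourier g2 n)))\<^sup>2"
      using \<alpha> by (intro power_mono) auto
    then have "1 / (real (Suc n))\<^sup>2 \<le> 4 / \<alpha>\<^sup>2 * (norm (fourier g2 n))\<^sup>2"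
      using \<alpha> by (simp add: field_simps power_mult_distrib del: of_nat_Suc)
    then show ?thesis using True by simp
  qed auto
  then have "(\<Sum>n<N. if \<alpha> < real (Suc n) * norm (fourier g n) then 1 / (real (Suc n))\<^sup>2 else 0)
      \<le> (\<Sum>n<N. (if \<alpha> / 2 < real (Suc n) * A then 1 / (real (Suc n))\<^sup>2 else 0))
          + 4 / \<alpha>\<^sup>2 * (\<Sum>n<N. (norm (fourier g2 n))\<^sup>2)"
    unfolding sum_distrib_left sum.distrib[symmetric] by (rule sum_mono)
  also have "\<dots> \<le> 2 * A / (\<alpha> / 2) + 4 / \<alpha>\<^sup>2 * (\<integral>t. (norm (g2 t))\<^sup>2 \<partial>circ)"
    by (intro add_mono mult_left_mono sum_inverse_squares_above_le bessel_inequality[of _ B] A0 B2)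
       (use \<alpha> in auto)
  also have "\<dots> = (\<integral>t. 4 / \<alpha> * norm (g1 t) + 4 / \<alpha>\<^sup>2 * (norm (g2 t))\<^sup>2 \<partial>circ)"
    using i1 i2 by (simp add: A_def)
  also have "\<dots> = (\<integral>t. (if \<alpha> < norm (g t) then 4 / \<alpha> * norm (g t) else 4 / \<alpha>\<^sup>2 * (norm (g t))\<^sup>2) \<partial>circ)"
    by (intro Bochner_Integration.integral_cong) (auto simp: g1_def g2_def)
  finally show ?thesis .
qed

section \<open>Integration over the levels\<close>

lemma nn_integral_powr_0_to:
  assumes "a > -1" "c \<ge> 0"
  shows "(\<integral>\<^sup>+x. ennreal (x powr a) * indicator {0<..<c} x \<partial>lborel) = ennreal (c powr (a + 1) / (a + 1))"
proof -
  have "(\<integral>\<^sup>+x. ennreal (x powr a) * indicator {0<..<c} x \<partial>lborel)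
      = (\<integral>\<^sup>+x. ennreal (x powr a) * indicator {0..c} x \<partial>lborel)"
    using AE_lborel_singleton[of 0] AE_lborel_singleton[of c]
    by (intro nn_integral_cong_AE) (auto simp: indicator_def)
  also have "\<dots> = ennreal (c powr (a + 1) / (a + 1))"
    by (rule nn_integral_has_integral_lebesgue'[OF _ has_integral_powr_from_0]) (use assms in auto)
  finally show ?thesis .
qed

lemma nn_integral_powr_to_inf:
  assumes "a < -1" "c > 0"
  shows "(\<integral>\<^sup>+x. ennreal (x powr a) * indicator {c..} x \<partial>lborel) = ennreal (- (c powr (a + 1)) / (a + 1))"
  by (rule nn_integral_has_integral_lebesgue'[OF _ has_integral_powr_to_inf]) (use assms in auto)

text \<open>The integrand behaves like \<open>\<alpha> powr (s - 2)\<close> below the level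
  \<open>y\<close> and like \<open>\<alpha> powr (s - 3)\<close> above it. The first is integrable
  at 0 because \<open>s > 1\<close>, the second at infinity because \<open>s < 2\<close>.\<close>

lemma nn_integral_powr_truncation:
  assumes s: "1 < s" "s < 2" and y: "0 \<le> (y::real)"
  shows "(\<integral>\<^sup>+\<alpha>. ennreal (s * \<alpha> powr (s - 1) * (if \<alpha> < y then 4 / \<alpha> * y else 4 / \<alpha>\<^sup>2 * y\<^sup>2))
            * indicator {0<..} \<alpha> \<partial>lborel)
          = ennreal ((4 * s / (s - 1) + 4 * s / (2 - s)) * y powr s)" (is "?l = _")
proof (cases "y = 0")
  case True
  have "?l = (\<integral>\<^sup>+\<alpha>. 0 \<partial>(lborel :: real measure))"
    using True by (intro nn_integral_cong) (auto simp: indicator_def)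
  then show ?thesis using True s by simp
next
  case False
  then have y: "y > 0" using y by simp
  have "?l = (\<integral>\<^sup>+\<alpha>. ennreal (4 * s * y) * (ennreal (\<alpha> powr (s - 2)) * indicator {0<..<y} \<alpha>) +
               ennreal (4 * s * y\<^sup>2) * (ennreal (\<alpha> powr (s - 3)) * indicator {y..} \<alpha>) \<partial>lborel)"
  proof (intro nn_integral_cong)
    fix \<alpha> :: real
    have "\<alpha> powr (s - 1) / \<alpha> = \<alpha> powr (s - 2)" "\<alpha> powr (s - 1) / \<alpha>\<^sup>2 = \<alpha> powr (s - 3)" if "\<alpha> > 0"
    proof -
      have "\<alpha> powr (s - 1) = \<alpha> powr (s - 2) * \<alpha>"
        using powr_add[of \<alpha> "s - 2" 1] that by simp
      then show "\<alpha> powr (s - 1) / \<alpha> = \<alpha> powr (s - 2)"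
        using that by simp
      have "\<alpha> powr (s - 1) = \<alpha> powr (s - 3) * \<alpha>\<^sup>2"
        using powr_add[of \<alpha> "s - 3" 2] that by (simp add: powr_numeral)
      then show "\<alpha> powr (s - 1) / \<alpha>\<^sup>2 = \<alpha> powr (s - 3)"
        using that by simp
    qed
    moreover have "s * \<alpha> powr (s - 1) * (4 / \<alpha> * y) = (4 * s * y) * (\<alpha> powr (s - 1) / \<alpha>)"
      "s * \<alpha> powr (s - 1) * (4 / \<alpha>\<^sup>2 * y\<^sup>2) = (4 * s * y\<^sup>2) * (\<alpha> powr (s - 1) / \<alpha>\<^sup>2)"
      by simp_all
    ultimately have "s * \<alpha> powr (s - 1) * (4 / \<alpha> * y) = (4 * s * y) * \<alpha> powr (s - 2)"
      "s * \<alpha> powr (s - 1) * (4 / \<alpha>\<^sup>2 * y\<^sup>2) = (4 * s * y\<^sup>2) * \<alpha> powr (s - 3)" if "\<alpha> > 0"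
      using that by simp_all
    then show "ennreal (s * \<alpha> powr (s - 1) * (if \<alpha> < y then 4 / \<alpha> * y else 4 / \<alpha>\<^sup>2 * y\<^sup>2)) * indicator {0<..} \<alpha>
      = ennreal (4 * s * y) * (ennreal (\<alpha> powr (s - 2)) * indicator {0<..<y} \<alpha>) +
               ennreal (4 * s * y\<^sup>2) * (ennreal (\<alpha> powr (s - 3)) * indicator {y..} \<alpha>)"
      using s y by (auto simp: indicator_def ennreal_mult[symmetric])
  qed
  also have "\<dots> = ennreal (4 * s * y) * ennreal (y powr (s - 1) / (s - 1))
       + ennreal (4 * s * y\<^sup>2) * ennreal (y powr (s - 2) / (2 - s))"
  proof -
    have "(\<integral>\<^sup>+x. ennreal (x powr (s - 2)) * indicator {0<..<y} x \<partial>lborel) = ennreal (y powr (s - 1) / (s - 1))"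
      using nn_integral_powr_0_to[of "s - 2" y] s y by (simp add: algebra_simps)
    moreover have "(\<integral>\<^sup>+x. ennreal (x powr (s - 3)) * indicator {y..} x \<partial>lborel) = ennreal (y powr (s - 2) / (2 - s))"
      using nn_integral_powr_to_inf[of "s - 3" y] s y by (simp add: field_simps minus_divide_right)
    ultimately show ?thesis
      by (subst nn_integral_add) (auto simp: nn_integral_cmult)
  qed
  also have "\<dots> = ennreal (4 * s * y * (y powr (s - 1) / (s - 1)) + 4 * s * y\<^sup>2 * (y powr (s - 2) / (2 - s)))"
    using s y by (simp add: ennreal_mult[symmetric] ennreal_plus[symmetric] del: ennreal_plus)
  also have "4 * s * y * (y powr (s - 1) / (s - 1)) + 4 * s * y\<^sup>2 * (y powr (s - 2) / (2 - s))
     = (4 * s / (s - 1) + 4 * s / (2 - s)) * y powr s"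
  proof -
    have "y * y powr (s - 1) = y powr s"
      using powr_add[of y "s - 1" 1] y by (simp add: mult.commute)
    moreover have "y\<^sup>2 * y powr (s - 2) = y powr s"
      using powr_add[of y "s - 2" 2] y by (simp add: powr_numeral mult.commute)
    ultimately
    show ?thesis
      by (simp add: distrib_right mult.assoc)
  qed
  finally show ?thesis .
qed

text \<open>Marcinkiewicz interpolation carried out by hand: each \<open>s\<close>-th power is an
  integral over levels, the distribution bound is applied level by level, and the integrals are
  exchanged. The resulting constant blows up at \<open>s = 2\<close>, where the claim is Bessel's
  inequality itself. \<open>C\<close> is fixed before \<open>g\<close>, \<open>B\<close> and
  \<open>N\<close>.\<close>

lemma paley_inequality:
  assumes s: "1 < s" "s \<le> 2"
  shows "\<exists>C>0. \<forall>g B N. g \<in> borel_measurable borel \<longrightarrow> (\<forall>t. norm (g t) \<le> B) \<longrightarrow>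
    (\<Sum>n<N. real (Suc n) powr (s - 2) * norm (fourier g n) powr s) \<le> C * (\<integral>t. norm (g t) powr s \<partial>circ)"
proof (cases "s = 2")
  case True
  show ?thesis
    by (rule exI[of _ 1]) (use True bessel_inequality in \<open>auto simp: powr_numeral\<close>)
next
  case False
  then have s: "1 < s" "s < 2" using s by auto
  define C where "C = 4 * s / (s - 1) + 4 * s / (2 - s)"
  have C: "C > 0" unfolding C_def using s by (intro add_pos_pos divide_pos_pos) auto
  show ?thesis
  proof (intro exI[of _ C] conjI C allI impI)
    fix g :: "real \<Rightarrow> complex" and B :: real and N :: nat
    assume g [measurable]: "g \<in> borel_measurable borel" and "\<forall>t. norm (g t) \<le> B"
    then have B: "norm (g t) \<le> B" for t by simp
    have B0: "B \<ge> 0" using B[of 0] norm_ge_zero order_trans by blast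
    \<comment> \<open>In terms of \<open>h\<close> the weight is \<open>1 / (n + 1)\<^sup>2\<close>
      for every \<open>s\<close>, so a single measure on the indices serves all exponents.\<close>
    define h where "h n = real (Suc n) * norm (fourier g n)" for n
    have h0: "h n \<ge> 0" for n by (simp add: h_def)
    have hp: "real (Suc n) powr (s - 2) * norm (fourier g n) powr s = h n powr s * (1 / (real (Suc n))\<^sup>2)" for n
      unfolding h_def by (simp add: powr_mult powr_diff powr_numeral del: of_nat_Suc)
    have lc: "ennreal (h n powr s) = (\<integral>\<^sup>+\<alpha>. ennreal (s * \<alpha> powr (s - 1)) * indicator {0<..<h n} \<alpha> \<partial>lborel)" for n
    proof -
      have "(\<integral>\<^sup>+\<alpha>. ennreal (s * \<alpha> powr (s - 1)) * indicator {0<..<h n} \<alpha> \<partial>lborel)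
        = ennreal s * (\<integral>\<^sup>+\<alpha>. ennreal (\<alpha> powr (s - 1)) * indicator {0<..<h n} \<alpha> \<partial>lborel)"
        using s by (subst nn_integral_cmult[symmetric]) (auto simp: ennreal_mult mult.assoc)
      also have "\<dots> = ennreal (h n powr s)"
        using s h0 by (simp add: nn_integral_powr_0_to ennreal_mult[symmetric])
      finally show ?thesis ..
    qed
    define \<Phi> where "\<Phi> \<alpha> t = (if \<alpha> < norm (g t) then 4 / \<alpha> * norm (g t) else 4 / \<alpha>\<^sup>2 * (norm (g t))\<^sup>2)" for \<alpha> t :: real
    have \<Phi>B: "norm (\<Phi> \<alpha> t) \<le> 4 / \<alpha> * B + 4 / \<alpha>\<^sup>2 * B\<^sup>2" if "\<alpha> > 0" for \<alpha> t
    proof -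
      have "4 / \<alpha> * norm (g t) \<le> 4 / \<alpha> * B" "4 / \<alpha>\<^sup>2 * (norm (g t))\<^sup>2 \<le> 4 / \<alpha>\<^sup>2 * B\<^sup>2"
        using that by (auto intro!: mult_left_mono divide_right_mono power_mono B)
      moreover have "0 \<le> 4 / \<alpha> * norm (g t)" "0 \<le> 4 / \<alpha>\<^sup>2 * (norm (g t))\<^sup>2"
        using that by auto
      moreover have "0 \<le> 4 / \<alpha> * B" "0 \<le> 4 / \<alpha>\<^sup>2 * B\<^sup>2"
        using that B0 by auto
      ultimately have "0 \<le> \<Phi> \<alpha> t" "\<Phi> \<alpha> t \<le> 4 / \<alpha> * B + 4 / \<alpha>\<^sup>2 * B\<^sup>2"
        unfolding \<Phi>_def by (cases "\<alpha> < norm (g t)"; simp only: if_True if_False; linarith)+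
      then show ?thesis by simp
    qed
    have \<Phi>0: "\<Phi> \<alpha> t \<ge> 0" if "\<alpha> > 0" for \<alpha> t using that by (auto simp: \<Phi>_def)
    have m1 [measurable]: "\<Phi> \<alpha> \<in> borel_measurable borel" for \<alpha>
      unfolding \<Phi>_def by measurable
    have m2 [measurable]: "(\<lambda>x. \<Phi> (fst x) (snd x)) \<in> borel_measurable (lborel \<Otimes>\<^sub>M circ)"
      unfolding \<Phi>_def by measurable
    have dist: "(\<Sum>n<N. ennreal (1 / (real (Suc n))\<^sup>2) * indicator {0<..<h n} \<alpha>) * indicator {0<..} \<alpha>
        \<le> (\<integral>\<^sup>+t. ennreal (\<Phi> \<alpha> t) \<partial>circ) * indicator {0<..} \<alpha>" for \<alpha>
    proof (cases "\<alpha> > 0")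
      case True
      have "(\<Sum>n<N. ennreal (1 / (real (Suc n))\<^sup>2) * indicator {0<..<h n} \<alpha>)
          = (\<Sum>n<N. ennreal (if \<alpha> < h n then 1 / (real (Suc n))\<^sup>2 else 0))"
        using True by (intro sum.cong) (auto simp: indicator_def)
      also have "\<dots> = ennreal (\<Sum>n<N. if \<alpha> < h n then 1 / (real (Suc n))\<^sup>2 else 0)"
        by (rule sum_ennreal) auto
      also have "\<dots> \<le> ennreal (\<integral>t. \<Phi> \<alpha> t \<partial>circ)"
        unfolding h_def \<Phi>_def by (intro ennreal_leI fourier_distribution_le[OF g B True])
      also have "\<dots> = (\<integral>\<^sup>+t. ennreal (\<Phi> \<alpha> t) \<partial>circ)"
        by (rule nn_integral_eq_integral[symmetric])
           (use True in \<open>auto intro!: integrable_circ_bounded[OF _ \<Phi>B[OF True]] \<Phi>0\<close>)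
      finally show ?thesis using True by simp
    qed auto
    have "ennreal (\<Sum>n<N. real (Suc n) powr (s - 2) * norm (fourier g n) powr s)
        = (\<Sum>n<N. ennreal (h n powr s) * ennreal (1 / (real (Suc n))\<^sup>2))"
      unfolding hp by (subst sum_ennreal[symmetric]) (auto simp: ennreal_mult[symmetric])
    also have "\<dots> = (\<integral>\<^sup>+\<alpha>. (\<Sum>n<N. ennreal (s * \<alpha> powr (s - 1)) * indicator {0<..<h n} \<alpha> * ennreal (1 / (real (Suc n))\<^sup>2)) \<partial>lborel)"
      unfolding lc by (subst nn_integral_sum) (auto simp: nn_integral_multc)
    also have "\<dots> = (\<integral>\<^sup>+\<alpha>. ennreal (s * \<alpha> powr (s - 1)) *
         ((\<Sum>n<N. ennreal (1 / (real (Suc n))\<^sup>2) * indicator {0<..<h n} \<alpha>) * indicator {0<..} \<alpha>) \<partial>lborel)"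
      unfolding sum_distrib_right sum_distrib_left
      by (intro nn_integral_cong sum.cong refl) (simp add: indicator_def mult.commute)
    also have "\<dots> \<le> (\<integral>\<^sup>+\<alpha>. ennreal (s * \<alpha> powr (s - 1)) * ((\<integral>\<^sup>+t. ennreal (\<Phi> \<alpha> t) \<partial>circ) * indicator {0<..} \<alpha>) \<partial>lborel)"
      by (intro nn_integral_mono mult_left_mono dist) auto
    also have "\<dots> = (\<integral>\<^sup>+\<alpha>. (\<integral>\<^sup>+t. ennreal (s * \<alpha> powr (s - 1) * \<Phi> \<alpha> t) * indicator {0<..} \<alpha> \<partial>circ) \<partial>lborel)"
    proof (intro nn_integral_cong)
      fix \<alpha> :: real
      show "ennreal (s * \<alpha> powr (s - 1)) * ((\<integral>\<^sup>+t. ennreal (\<Phi> \<alpha> t) \<partial>circ) * indicator {0<..} \<alpha>)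
        = (\<integral>\<^sup>+t. ennreal (s * \<alpha> powr (s - 1) * \<Phi> \<alpha> t) * indicator {0<..} \<alpha> \<partial>circ)"
      proof (cases "\<alpha> > 0")
        case True
        then have "(\<integral>\<^sup>+t. ennreal (s * \<alpha> powr (s - 1) * \<Phi> \<alpha> t) \<partial>circ)
            = (\<integral>\<^sup>+t. ennreal (s * \<alpha> powr (s - 1)) * ennreal (\<Phi> \<alpha> t) \<partial>circ)"
          using s \<Phi>0 by (intro nn_integral_cong) (simp add: ennreal_mult)
        also have "\<dots> = ennreal (s * \<alpha> powr (s - 1)) * (\<integral>\<^sup>+t. ennreal (\<Phi> \<alpha> t) \<partial>circ)"
          by (rule nn_integral_cmult) simp
        finally show ?thesis using True by simp
      qed auto
    qed
    also have "\<dots> = (\<integral>\<^sup>+t. (\<integral>\<^sup>+\<alpha>. ennreal (s * \<alpha> powr (s - 1) * \<Phi> \<alpha> t) * indicator {0<..} \<alpha> \<partial>lborel) \<partial>circ)"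
    proof -
      interpret pair_sigma_finite lborel circ ..
      show ?thesis
        by (rule Fubini'[symmetric]) (simp add: case_prod_beta)
    qed
    also have "\<dots> = (\<integral>\<^sup>+t. ennreal (C * norm (g t) powr s) \<partial>circ)"
      unfolding \<Phi>_def C_def
      by (intro nn_integral_cong nn_integral_powr_truncation s norm_ge_zero)
    also have "\<dots> = ennreal (\<integral>t. C * norm (g t) powr s \<partial>circ)"
    proof (rule nn_integral_eq_integral)
      show "integrable circ (\<lambda>t. C * norm (g t) powr s)"
        using s C by (intro integrable_mult_right integrable_circ_bounded[of _ "B powr s"])
          (auto intro!: powr_mono2 B)
    qed (use C in auto)
    finally show "(\<Sum>n<N. real (Suc n) powr (s - 2) * norm (fourier g n) powr s) \<le> C * (\<integral>t. norm (g t) powr s \<partial>circ)"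
      using C by (subst (asm) ennreal_le_iff) (auto intro!: mult_nonneg_nonneg integral_nonneg_AE)
  qed
qed

text \<open>Young's inequality for \<open>L * u\<close> and \<open>v / L\<close>. The free scale
  stands in for Hoelder's inequality: \<open>L\<close> is either chosen to cancel a constant or to
  balance the two terms.\<close>

lemma young_scaled:
  fixes p q u v L :: real
  assumes pq: "1 < p" "1 < q" "1 / p + 1 / q = 1" and "0 \<le> u" "0 \<le> v" "0 < L"
  shows "u * v \<le> L powr p * u powr p / p + L powr (- q) * v powr q / q"
proof -
  have "(L * u) * (v / L) \<le> (L * u) powr p / p + (v / L) powr q / q"
    by (rule Youngs_inequality) (use assms in auto)
  then show ?thesis
    using assms by (simp add: powr_mult powr_divide powr_minus_divide)
qed

lemma conjugate_exponent:
  fixes p q :: real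
  assumes "1 < p" "1 < q" "1 / p + 1 / q = 1"
  shows "(p - 1) * q = p" "(q - 1) * p = q"
  using assms by (auto simp: field_simps)

text \<open>Dual to Paley's inequality: test \<open>P\<close> against \<open>\<bar>P\<bar> powr (p - 2) * P\<close>.\<close>

lemma hardy_littlewood_polynomial:
  assumes p: "2 \<le> p"
  shows "\<exists>C>0. \<forall>c N. (\<integral>t. norm (\<Sum>n<N. c n * cis (real n * t)) powr p \<partial>circ)
       \<le> C * (\<Sum>n<N. real (Suc n) powr (p - 2) * norm (c n) powr p)"
proof -
  define q where "q = p / (p - 1)"
  have q: "1 < q" "q \<le> 2" and pq: "1 / p + 1 / q = 1"
    using p by (auto simp: q_def field_simps)
  have p1: "1 < p" using p by simp
  note ce = conjugate_exponent[OF p1 q(1) pq]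
  obtain C where C: "C > 0" and paley':
    "\<forall>g B N. g \<in> borel_measurable borel \<longrightarrow> (\<forall>t. norm (g t) \<le> B) \<longrightarrow>
       (\<Sum>n<N. real (Suc n) powr (q - 2) * norm (fourier g n) powr q) \<le> C * (\<integral>t. norm (g t) powr q \<partial>circ)"
    using paley_inequality[OF q] by blast
  have paley: "(\<Sum>n<N. real (Suc n) powr (q - 2) * norm (fourier g n) powr q) \<le> C * (\<integral>t. norm (g t) powr q \<partial>circ)"
    if "g \<in> borel_measurable borel" "\<And>t. norm (g t) \<le> B" for g B N
    using paley' that by blast
  \<comment> \<open>Chosen so that \<open>L powr (- q) * C = 1\<close>: Paley's constant cancels,
    the dual term becomes \<open>X / q\<close>, and subtracting it from \<open>X\<close> leaves
    \<open>X / p\<close>.\<close>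
  define L where "L = C powr (1 / q)"
  have L: "L > 0" using C by (simp add: L_def)
  have Lq: "L powr (- q) = 1 / C" using C q by (simp add: L_def powr_powr powr_minus_divide)
  show ?thesis
  proof (intro exI[of _ "L powr p"] conjI allI)
    show "L powr p > 0" using L by simp
    fix c :: "nat \<Rightarrow> complex" and N
    define P where "P t = (\<Sum>n<N. c n * cis (real n * t))" for t
    define D where "D = (\<Sum>n<N. norm (c n))"
    have [measurable]: "P \<in> borel_measurable borel" unfolding P_def by measurable
    have PD: "norm (P t) \<le> D" for t
      unfolding P_def D_def by (rule order_trans[OF norm_sum]) (simp add: norm_mult)
    define g where "g t = of_real (norm (P t) powr (p - 2)) * P t" for t
    have [measurable]: "g \<in> borel_measurable borel" unfolding g_def by measurable
    have normg: "norm (g t) = norm (P t) powr (p - 1)" for t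
      using powr_add[of "norm (P t)" "p - 2" 1] by (simp add: g_def norm_mult)
    have gD: "norm (g t) \<le> D powr (p - 1)" for t
      unfolding normg using p by (intro powr_mono2 PD) auto
    have Pg: "P t * cnj (g t) = of_real (norm (P t) powr p)" for t
    proof -
      have "P t * cnj (g t) = of_real (norm (P t) powr (p - 2) * (norm (P t))\<^sup>2)"
        by (simp add: g_def complex_norm_square mult_ac del: of_real_power)
      also have "norm (P t) powr (p - 2) * (norm (P t))\<^sup>2 = norm (P t) powr p"
        using powr_add[of "norm (P t)" "p - 2" 2] by (cases "P t = 0") (auto simp: powr_numeral)
      finally show ?thesis .
    qed
    define X where "X = (\<integral>t. norm (P t) powr p \<partial>circ)"
    have Xg: "(\<integral>t. norm (g t) powr q \<partial>circ) = X"
      unfolding X_def normg using ce by (simp add: powr_powr)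
    have "complex_of_real X = (\<integral>t. P t * cnj (g t) \<partial>circ)"
      unfolding X_def Pg by simp
    also have "\<dots> = (\<Sum>n<N. c n * cnj (fourier g n))"
      unfolding P_def by (rule fourier_pairing_finite[OF _ gD]) simp
    finally have "X \<le> norm (\<Sum>n<N. c n * cnj (fourier g n))"
      by (metis norm_of_real abs_ge_self)
    also have "\<dots> \<le> (\<Sum>n<N. norm (c n) * norm (fourier g n))"
      by (rule order_trans[OF norm_sum]) (simp add: norm_mult)
    also have "\<dots> \<le> (\<Sum>n<N. L powr p * (real (Suc n) powr (p - 2) * norm (c n) powr p) / p
                + L powr (- q) * (real (Suc n) powr (q - 2) * norm (fourier g n) powr q) / q)"
    proof (rule sum_mono)
      fix n
      \<comment> \<open>Splits the weight between the two factors: \<open>w powr p\<close> is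
        \<open>(n + 1) powr (p - 2)\<close> and \<open>w powr (- q)\<close> is
        \<open>(n + 1) powr (q - 2)\<close>, the weight in Paley's inequality.\<close>
      define w where "w = real (Suc n) powr (1 - 2 / p)"
      have w: "w > 0" by (simp add: w_def)
      have e1: "(1 - 2 / p) * p = p - 2" using p by (simp add: field_simps)
      have e2: "(1 - 2 / p) * q = 2 - q"
      proof -
        have "q / p = q - 1" using p1 ce(2) by (simp add: field_simps)
        then show ?thesis by (simp add: left_diff_distrib)
      qed
      have "norm (c n) * norm (fourier g n) = (w * norm (c n)) * (norm (fourier g n) / w)"
        using w by simp
      also have "\<dots> \<le> L powr p * (w * norm (c n)) powr p / p + L powr (- q) * (norm (fourier g n) / w) powr q / q"
        by (rule young_scaled) (use p1 q pq L w in auto)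
      also have "(w * norm (c n)) powr p = real (Suc n) powr (p - 2) * norm (c n) powr p"
        by (simp add: w_def powr_mult powr_powr e1 del: of_nat_Suc)
      also have "(norm (fourier g n) / w) powr q = real (Suc n) powr (q - 2) * norm (fourier g n) powr q"
      proof -
        have "real (Suc n) powr (q - 2) = 1 / real (Suc n) powr (2 - q)"
          using powr_minus_divide[of "real (Suc n)" "2 - q"] by simp
        then show ?thesis by (simp add: w_def powr_divide powr_powr e2 del: of_nat_Suc)
      qed
      finally show "norm (c n) * norm (fourier g n)
         \<le> L powr p * (real (Suc n) powr (p - 2) * norm (c n) powr p) / p
                + L powr (- q) * (real (Suc n) powr (q - 2) * norm (fourier g n) powr q) / q" .
    qed
    also have "\<dots> = L powr p * (\<Sum>n<N. real (Suc n) powr (p - 2) * norm (c n) powr p) / p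
       + L powr (- q) * (\<Sum>n<N. real (Suc n) powr (q - 2) * norm (fourier g n) powr q) / q"
      by (simp add: sum.distrib sum_distrib_left sum_divide_distrib)
    also have "\<dots> \<le> L powr p * (\<Sum>n<N. real (Suc n) powr (p - 2) * norm (c n) powr p) / p
       + L powr (- q) * (C * X) / q"
      unfolding Xg[symmetric] using q
      by (intro add_left_mono divide_right_mono mult_left_mono paley[OF _ gD]) auto
    also have "L powr (- q) * (C * X) / q = X / q" using C Lq by simp
    finally have "X - X / q \<le> L powr p * (\<Sum>n<N. real (Suc n) powr (p - 2) * norm (c n) powr p) / p"
      by simp
    moreover have "X - X / q = X / p"
    proof -
      have "X / p + X / q = X" using arg_cong[OF pq, of "(*) X"] by (simp add: distrib_left)
      then show ?thesis by simp
    qed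
    ultimately have "X \<le> L powr p * (\<Sum>n<N. real (Suc n) powr (p - 2) * norm (c n) powr p)"
      using p by (simp add: divide_le_cancel)
    then show "(\<integral>t. norm (\<Sum>n<N. c n * cis (real n * t)) powr p \<partial>circ)
       \<le> L powr p * (\<Sum>n<N. real (Suc n) powr (p - 2) * norm (c n) powr p)"
      unfolding X_def P_def .
  qed
qed

section \<open>Schur's test\<close>

text \<open>For \<open>t\<close> between 0 and \<open>2 * pi\<close>, the arc length from
  \<open>cis t\<close> to 1.\<close>

definition cdist :: "real \<Rightarrow> real" where
  "cdist t = min t (2 * pi - t)"

text \<open>Up to constants, a majorant of the Dirichlet kernel of order \<open>m\<close> at distance \<open>x\<close> from 0. Any
  exponent in \<open>{0<..<1/2}\<close> instead of \<open>1 / 4\<close> would do: it absorbs the logarithm in the tails of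
  monotone trigonometric series.\<close>

definition kern :: "nat \<Rightarrow> real \<Rightarrow> real" where
  "kern m x = (if real m * x < 1 then real m powr (3 / 4) * x powr (- 1 / 4) else 1 / x)"

section \<open>Sums and integrals of the majorant kernel\<close>

lemma measurable_cdist [measurable]: "cdist \<in> borel_measurable borel"
  unfolding cdist_def by measurable

lemma measurable_kern [measurable]: "kern m \<in> borel_measurable borel"
  unfolding kern_def by measurable

lemma kern_nonneg: "0 \<le> x \<Longrightarrow> 0 \<le> kern m x"
  by (auto simp: kern_def)

text \<open>With fourth roots \<open>a\<close> and \<open>b\<close>, the number
  \<open>1 = a ^ 4 - b ^ 4\<close> is \<open>a - b\<close> times four products, each at most
  \<open>a ^ 3\<close>. Sums of \<open>m powr (- 3 / 4)\<close> are thereby compared with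
  telescoping ones.\<close>

lemma powr_quarter_diff:
  fixes m :: real
  assumes "m \<ge> 1"
  shows "m powr (- 3 / 4) \<le> 4 * (m powr (1 / 4) - (m - 1) powr (1 / 4))"
proof -
  define a where "a = m powr (1 / 4)"
  define b where "b = (m - 1) powr (1 / 4)"
  have a: "a > 0" and b: "b \<ge> 0" and ba: "b \<le> a"
    using assms by (auto simp: a_def b_def intro!: powr_mono2)
  have a4: "a ^ 4 = m"
    using assms by (simp add: a_def powr_power)
  have b4: "b ^ 4 = m - 1"
    using assms by (cases "m = 1") (simp_all add: b_def powr_power)
  have am: "m powr (- 3 / 4) = 1 / a ^ 3"
    using assms by (simp add: a_def powr_power powr_minus_divide)
  have "1 \<le> (a - b) * (4 * a ^ 3)"
  proof -
    have "1 = (a - b) * (a ^ 3 + a\<^sup>2 * b + a * b\<^sup>2 + b ^ 3)"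
      using a4 b4 by (simp add: algebra_simps power_numeral_reduce)
    also have "\<dots> \<le> (a - b) * (a ^ 3 + a\<^sup>2 * a + a * a\<^sup>2 + a ^ 3)"
      using a b ba by (intro mult_left_mono add_mono power_mono) auto
    also have "\<dots> = (a - b) * (4 * a ^ 3)" by (simp add: power_numeral_reduce)
    finally show ?thesis .
  qed
  then have "1 \<le> 4 * (a - b) * a ^ 3" by (simp add: algebra_simps)
  then have "1 / a ^ 3 \<le> 4 * (a - b)" using a by (subst pos_divide_le_eq) auto
  then show ?thesis unfolding am by (simp add: a_def b_def)
qed

text \<open>Rationalising gives \<open>1 / a - 1 / b = 1 / (a * b * (a + b))\<close>. As
  \<open>m \<ge> 1\<close>, \<open>b\<close> is at most \<open>3 / 2 * a\<close>, so
  \<open>b * (a + b)\<close> is at most \<open>15 / 4\<close> times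
  \<open>a\<^sup>2\<close>.\<close>

lemma powr_half_diff:
  fixes m :: real
  assumes "m \<ge> 1"
  shows "m powr (- 3 / 2) \<le> 4 * (1 / sqrt m - 1 / sqrt (m + 1))"
proof -
  define a where "a = sqrt m"
  define b where "b = sqrt (m + 1)"
  have a: "a \<ge> 1" and b: "b > 0" and ab: "a \<le> b"
    using assms by (auto simp: a_def b_def)
  have a2: "a\<^sup>2 = m" and b2: "b\<^sup>2 = m + 1"
    using assms by (auto simp: a_def b_def)
  have b2': "b \<le> 3 / 2 * a"
  proof (rule power2_le_imp_le)
    show "b\<^sup>2 \<le> (3 / 2 * a)\<^sup>2" unfolding power_mult_distrib a2 b2 using assms by (simp add: power_divide)
  qed (use a in simp)
  have "m powr (- 3 / 2) = 1 / a ^ 3"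
    using assms by (simp add: a_def powr_power powr_minus_divide flip: powr_half_sqrt)
  also have "\<dots> \<le> 4 * (1 / a - 1 / b)"
  proof -
    have "b * (b + a) \<le> (3 / 2 * a) * (3 / 2 * a + a)"
      using a b b2' by (intro mult_mono add_mono) auto
    also have "\<dots> \<le> 4 * a\<^sup>2" by (simp add: power2_eq_square)
    finally have *: "b * (b + a) \<le> 4 * a\<^sup>2" .
    have "1 / a - 1 / b = (b - a) / (a * b)" using a b by (simp add: field_simps)
    also have "b - a = 1 / (b + a)"
      using a b a2 b2 by (simp add: field_simps power2_eq_square)
    finally have "4 * (1 / a - 1 / b) = 4 / (a * (b * (b + a)))" by simp
    also have "\<dots> \<ge> 4 / (a * (4 * a\<^sup>2))"
      using a b * by (intro divide_left_mono mult_left_mono mult_pos_pos) auto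
    finally show ?thesis by (simp add: power_numeral_reduce)
  qed
  finally show ?thesis by (simp add: a_def b_def)
qed

lemma sum_powr_quarter_below_le:
  assumes "0 < x"
  shows "(\<Sum>n<N. if real (Suc n) * x < 1 then real (Suc n) powr (- 3 / 4) else 0) \<le> 4 * x powr (- 1 / 4)"
proof -
  \<comment> \<open>The minimum bounds the indices that can contribute so far; it stops growing once
    the condition fails.\<close>
  have "(\<Sum>n<N. if real (Suc n) * x < 1 then real (Suc n) powr (- 3 / 4) else 0)
      \<le> 4 * (min (real N) (1 / x)) powr (1 / 4)"
  proof (induction N)
    case (Suc N)
    show ?case
    proof (cases "real (Suc N) * x < 1")
      case True
      then have "real (Suc N) < 1 / x" using assms by (simp add: field_simps)
      then have m: "min (real (Suc N)) (1 / x) = real (Suc N)" "min (real N) (1 / x) = real N" by auto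
      have "real (Suc N) powr (- 3 / 4) \<le> 4 * (real (Suc N) powr (1 / 4) - real N powr (1 / 4))"
        using powr_quarter_diff[of "real (Suc N)"] by simp
      then show ?thesis using Suc True m by simp
    next
      case False
      have "min (real N) (1 / x) powr (1 / 4) \<le> min (real (Suc N)) (1 / x) powr (1 / 4)"
        using assms by (intro powr_mono2) auto
      then show ?thesis using Suc False by (simp del: of_nat_Suc)
    qed
  qed simp
  also have "\<dots> \<le> 4 * (1 / x) powr (1 / 4)"
    using assms by (intro mult_left_mono powr_mono2) auto
  also have "(1 / x) powr (1 / 4) = x powr (- 1 / 4)"
    using assms by (simp add: powr_divide powr_minus_divide)
  finally show ?thesis .
qed

lemma sum_powr_half_above_le:
  assumes "0 < x"
  shows "(\<Sum>n<N. if real (Suc n) * x < 1 then 0 else real (Suc n) powr (- 3 / 2)) \<le> 4 * sqrt x"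
proof -
  have "(\<Sum>n<N. if real (Suc n) * x < 1 then 0 else real (Suc n) powr (- 3 / 2))
      \<le> max 0 (4 * sqrt x - 4 / sqrt (real (Suc N)))"
  proof (induction N)
    case (Suc N)
    have le: "4 / sqrt (real (Suc (Suc N))) \<le> 4 / sqrt (real (Suc N))"
      by (intro divide_left_mono) auto
    show ?case
    proof (cases "real (Suc N) * x < 1")
      case False
      have "1 / real (Suc N) \<le> x" using False by (simp add: field_simps)
      then have "sqrt (1 / real (Suc N)) \<le> sqrt x" by (rule real_sqrt_le_mono)
      then have *: "4 / sqrt (real (Suc N)) \<le> 4 * sqrt x" by (simp add: real_sqrt_divide)
      have "real (Suc N) powr (- 3 / 2) \<le> 4 * (1 / sqrt (real (Suc N)) - 1 / sqrt (real (Suc (Suc N))))"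
        using powr_half_diff[of "real (Suc N)"] by (simp add: add.commute)
      then show ?thesis using Suc False * by (simp del: of_nat_Suc)
    next
      case True
      then show ?thesis using Suc le by (simp del: of_nat_Suc)
    qed
  qed (use assms in simp)
  also have "\<dots> \<le> 4 * sqrt x" using assms by simp
  finally show ?thesis .
qed

text \<open>One of the two estimates for Schur's test. \<open>kern m x\<close> is
  \<open>1 / x\<close> times a function of \<open>m * x\<close>, so the weight
  \<open>m powr (- 3 / 2)\<close> must come back as a multiple of \<open>x powr (- 1 / 2)\<close>;
  the ranges \<open>m * x < 1\<close> and \<open>m * x \<ge> 1\<close> contribute a factor 4
  each.\<close>

lemma sum_kern_le:
  assumes x: "0 < x"
  shows "(\<Sum>n<N. real (Suc n) powr (- 3 / 2) * kern (Suc n) x) \<le> 8 * x powr (- 1 / 2)"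
proof -
  have "(\<Sum>n<N. real (Suc n) powr (- 3 / 2) * kern (Suc n) x)
     = x powr (- 1 / 4) * (\<Sum>n<N. if real (Suc n) * x < 1 then real (Suc n) powr (- 3 / 4) else 0)
      + (1 / x) * (\<Sum>n<N. if real (Suc n) * x < 1 then 0 else real (Suc n) powr (- 3 / 2))"
    unfolding sum_distrib_left sum.distrib[symmetric]
    by (intro sum.cong) (auto simp: kern_def powr_add[symmetric])
  also have "\<dots> \<le> x powr (- 1 / 4) * (4 * x powr (- 1 / 4)) + (1 / x) * (4 * sqrt x)"
    using x by (intro add_mono mult_left_mono sum_powr_quarter_below_le sum_powr_half_above_le) auto
  also have "x powr (- 1 / 4) * (4 * x powr (- 1 / 4)) = 4 * x powr (- 1 / 2)"
    by (simp add: powr_add[symmetric])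
  also have "(1 / x) * (4 * sqrt x) = 4 * x powr (- 1 / 2)"
  proof -
    have "(1 / x) * (4 * sqrt x) = 4 * (sqrt x / x)" by simp
    also have "sqrt x / x = inverse (sqrt x)" using x by (intro sqrt_divide_self_eq) simp
    also have "\<dots> = x powr (- 1 / 2)" using x powr_minus[of x "1 / 2"] powr_half_sqrt[of x] by simp
    finally show ?thesis .
  qed
  finally show ?thesis by simp
qed

text \<open>The other estimate for Schur's test. Splitting at \<open>x = 1 / m\<close>, the integral
  converges at 0 because \<open>b < 3 / 4\<close> and at infinity because
  \<open>b > 0\<close>.\<close>

lemma nn_integral_kern_le:
  assumes b: "0 < b" "b \<le> 1 / 2" and m: "0 < m"
  shows "(\<integral>\<^sup>+t. ennreal (kern m (cdist t) * cdist t powr (- b)) \<partial>circ)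
           \<le> ennreal ((1 / (3 / 4 - b) + 1 / b) * real m powr b)"
proof -
  define \<phi> where "\<phi> x = ennreal (kern m x * x powr (- b)) * indicator {0<..} x" for x
  have [measurable]: "\<phi> \<in> borel_measurable borel" unfolding \<phi>_def by measurable
  have I: "(\<integral>\<^sup>+x. \<phi> x \<partial>lborel) \<le> ennreal ((1 / (3 / 4 - b) + 1 / b) * real m powr b)"
  proof -
    have "(\<integral>\<^sup>+x. \<phi> x \<partial>lborel) = (\<integral>\<^sup>+x. ennreal (real m powr (3 / 4)) * (ennreal (x powr (- 1 / 4 - b)) * indicator {0<..<1 / real m} x)
           + ennreal (x powr (- 1 - b)) * indicator {1 / real m..} x \<partial>lborel)"
    proof (intro nn_integral_cong)
      fix x :: real
      have e1: "1 / x * x powr (- b) = x powr (- 1 - b)" if "x > 0"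
        using that powr_add[of x "- 1" "- b"] by (simp add: powr_minus_divide)
      have e2: "x powr (- 1 / 4) * x powr (- b) = x powr (- 1 / 4 - b)"
        using powr_add[of x "- 1 / 4" "- b"] by simp
      have iff: "real m * x < 1 \<longleftrightarrow> x < 1 / real m" using m by (simp add: field_simps)
      have "0 < 1 / real m" using m by simp
      then consider "x \<le> 0" "x < 1 / real m" | "0 < x" "x < 1 / real m" | "0 < x" "1 / real m \<le> x" by linarith
      then show "\<phi> x = ennreal (real m powr (3 / 4)) * (ennreal (x powr (- 1 / 4 - b)) * indicator {0<..<1 / real m} x)
           + ennreal (x powr (- 1 - b)) * indicator {1 / real m..} x"
      proof cases
        case 1
        then show ?thesis by (simp add: \<phi>_def)
      next
        case 2
        then show ?thesis
          unfolding \<phi>_def kern_def iff e2[symmetric] by (simp add: ennreal_mult mult.assoc)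
      next
        case 3
        then show ?thesis
          unfolding \<phi>_def kern_def iff e1[OF 3(1), symmetric] by simp
      qed
    qed
    also have "\<dots> = ennreal (real m powr (3 / 4)) * ennreal ((1 / real m) powr (3 / 4 - b) / (3 / 4 - b))
         + ennreal ((1 / real m) powr (- b) / b)"
    proof -
      have "(\<integral>\<^sup>+x. ennreal (x powr (- 1 / 4 - b)) * indicator {0<..<1 / real m} x \<partial>lborel)
          = ennreal ((1 / real m) powr (3 / 4 - b) / (3 / 4 - b))"
        using nn_integral_powr_0_to[of "- 1 / 4 - b" "1 / real m"] b m by (simp add: algebra_simps)
      moreover have "(\<integral>\<^sup>+x. ennreal (x powr (- 1 - b)) * indicator {1 / real m..} x \<partial>lborel)
          = ennreal ((1 / real m) powr (- b) / b)"
        using nn_integral_powr_to_inf[of "- 1 - b" "1 / real m"] b m by simp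
      ultimately show ?thesis by (subst nn_integral_add) (auto simp: nn_integral_cmult)
    qed
    also have "\<dots> = ennreal (real m powr (3 / 4) * ((1 / real m) powr (3 / 4 - b) / (3 / 4 - b))
         + (1 / real m) powr (- b) / b)"
      using b by (simp add: ennreal_mult[symmetric] ennreal_plus[symmetric] del: ennreal_plus)
    also have "real m powr (3 / 4) * ((1 / real m) powr (3 / 4 - b) / (3 / 4 - b)) + (1 / real m) powr (- b) / b
        = (1 / (3 / 4 - b) + 1 / b) * real m powr b"
    proof -
      have "(1 / real m) powr (- b) = real m powr b"
        using m by (simp add: powr_divide powr_minus_divide)
      moreover have "real m powr (3 / 4) * (1 / real m) powr (3 / 4 - b) = real m powr b"
      proof -
        have "(1 / real m) powr (3 / 4 - b) = real m powr (- (3 / 4 - b))"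
          using powr_minus_divide[of "real m" "3 / 4 - b"] m by (simp add: powr_divide)
        then show ?thesis using powr_add[of "real m" "3 / 4" "- (3 / 4 - b)"] by simp
      qed
      ultimately show ?thesis by (simp add: distrib_right)
    qed
    finally show ?thesis by simp
  qed
  define K where "K = (1 / (3 / 4 - b) + 1 / b) * real m powr b"
  have K0: "K \<ge> 0" using b by (simp add: K_def)
  have "(\<integral>\<^sup>+t. ennreal (kern m (cdist t) * cdist t powr (- b)) \<partial>circ)
     = (\<integral>\<^sup>+t. ennreal (kern m (cdist t) * cdist t powr (- b)) * indicator {0<..<2 * pi} t \<partial>lborel) / ennreal (2 * pi)"
    by (rule nn_integral_circ) measurable
  \<comment> \<open>On either half of the circle \<open>cdist t\<close> is \<open>t\<close> or its
    reflection, so the sum of both values dominates. The doubling is outweighed by the normalisation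
    \<open>1 / (2 * pi)\<close>.\<close>
  also have "\<dots> \<le> (\<integral>\<^sup>+t. \<phi> t + \<phi> (2 * pi + (- 1) * t) \<partial>lborel) / ennreal (2 * pi)"
    by (intro divide_right_mono_ennreal nn_integral_mono)
       (auto simp: cdist_def \<phi>_def indicator_def min_def intro: order_trans[OF _ add_increasing] order_trans[OF _ add_increasing2])
  also have "(\<integral>\<^sup>+t. \<phi> t + \<phi> (2 * pi + (- 1) * t) \<partial>lborel) = (\<integral>\<^sup>+t. \<phi> t \<partial>lborel) + (\<integral>\<^sup>+t. \<phi> (2 * pi + (- 1) * t) \<partial>lborel)"
    by (rule nn_integral_add) measurable
  also have "(\<integral>\<^sup>+t. \<phi> (2 * pi + (- 1) * t) \<partial>lborel) = (\<integral>\<^sup>+t. \<phi> t \<partial>lborel)"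
    using nn_integral_real_affine[of \<phi> "- 1" "2 * pi"] by simp
  also have "((\<integral>\<^sup>+t. \<phi> t \<partial>lborel) + (\<integral>\<^sup>+t. \<phi> t \<partial>lborel)) / ennreal (2 * pi)
       \<le> (ennreal K + ennreal K) / ennreal (2 * pi)"
    unfolding K_def by (intro divide_right_mono_ennreal add_mono I)
  also have "\<dots> = ennreal ((K + K) / (2 * pi))"
    using K0 by (simp add: divide_ennreal ennreal_plus[symmetric] del: ennreal_plus)
  also have "\<dots> \<le> ennreal K"
    using K0 pi_ge_two mult_left_mono[of 1 pi K] by (intro ennreal_leI) (simp add: field_simps)
  finally show ?thesis unfolding K_def .
qed

text \<open>The family of Young bounds is optimised over \<open>L\<close>: for the chosen
  \<open>L\<close> the second term equals \<open>u - u / q\<close>, and what remains is Hoelder's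
  inequality for \<open>u\<close>, with \<open>q / (q - 1)\<close> as the conjugate
  exponent.\<close>

lemma holder_from_young:
  fixes u U V q :: real
  assumes q: "1 < q" and u: "0 \<le> u" and V: "0 < V" and U: "0 \<le> U"
    and young: "\<And>L. L > 0 \<Longrightarrow> u \<le> L powr q / q * U + L powr (- (q / (q - 1))) / (q / (q - 1)) * V"
  shows "u powr q \<le> V powr (q - 1) * U"
proof (cases "u = 0")
  case True
  then show ?thesis using U V q by simp
next
  case False
  then have u: "u > 0" using u by simp
  define L where "L = (V / u) powr ((q - 1) / q)"
  have L: "L > 0" using V u by (simp add: L_def)
  have "(q - 1) / q * (- (q / (q - 1))) = - 1" using q by (simp add: field_simps)
  then have L1: "L powr (- (q / (q - 1))) = u / V"
    unfolding L_def powr_powr using V u by (simp add: powr_minus)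
  have L2: "L powr q = (V / u) powr (q - 1)"
    using q by (simp add: L_def powr_powr)
  have "u \<le> L powr q / q * U + u / V / (q / (q - 1)) * V"
    using young[OF L] unfolding L1 .
  also have "u / V / (q / (q - 1)) * V = u - u / q"
    using V q by (simp add: field_simps)
  finally have "u / q \<le> L powr q * U / q" by simp
  then have "u \<le> L powr q * U" using q by (simp add: divide_le_cancel)
  then have "u * u powr (q - 1) \<le> (L powr q * U) * u powr (q - 1)"
    by (intro mult_right_mono) auto
  also have "\<dots> = V powr (q - 1) * U"
    unfolding L2 using u V by (simp add: powr_divide)
  also have "u * u powr (q - 1) = u powr q"
    using u powr_add[of u 1 "q - 1"] by simp
  finally show ?thesis .
qed

text \<open>Schur's test with the weight \<open>cdist t powr b\<close>.\<close>

lemma schur_kern: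
  assumes q: "2 \<le> q"
  shows "\<exists>C>0. \<forall>g B u N. g \<in> borel_measurable borel \<longrightarrow> (\<forall>t. 0 \<le> g t \<and> g t \<le> B) \<longrightarrow>
    (\<forall>n. 0 \<le> u n \<and> ennreal (u n) \<le> (\<integral>\<^sup>+t. ennreal (g t * kern (Suc n) (cdist t)) \<partial>circ)) \<longrightarrow>
    (\<Sum>n<N. u n powr q / (real (Suc n))\<^sup>2) \<le> C * (\<integral>t. g t powr q \<partial>circ)"
proof -
  \<comment> \<open>For this \<open>b\<close> the power \<open>V n powr (q - 1)\<close> grows like
    \<open>(n + 1) powr (1 / 2)\<close> whatever \<open>q\<close> is; \<open>q \<ge> 2\<close> keeps
    \<open>b\<close> at most \<open>1 / 2\<close>, within the range of integrability of the
    kernel.\<close>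
  define b where "b = 1 / (2 * (q - 1))"
  have b: "0 < b" "b \<le> 1 / 2" using q by (auto simp: b_def field_simps)
  define A where "A = 1 / (3 / 4 - b) + 1 / b"
  have A: "A > 0" unfolding A_def using b by (intro add_pos_pos divide_pos_pos) auto
  define C where "C = A powr (q - 1) * 8"
  have C: "C > 0" using A by (simp add: C_def)
  define q' where "q' = q / (q - 1)"
  have q': "1 < q'" "1 / q + 1 / q' = 1" and q1: "1 < q"
    using q by (auto simp: q'_def field_simps)
  show ?thesis
  proof (intro exI[of _ C] conjI C allI impI)
    fix g :: "real \<Rightarrow> real" and B :: real and u :: "nat \<Rightarrow> real" and N :: nat
    assume [measurable]: "g \<in> borel_measurable borel" and g: "\<forall>t. 0 \<le> g t \<and> g t \<le> B"
      and u: "\<forall>n. 0 \<le> u n \<and> ennreal (u n) \<le> (\<integral>\<^sup>+t. ennreal (g t * kern (Suc n) (cdist t)) \<partial>circ)"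
    have g0: "0 \<le> g t" and gB: "g t \<le> B" for t using g by auto
    define h where "h n t = g t powr q * (kern (Suc n) (cdist t) * cdist t powr (1 / 2))" for n t
    have [measurable]: "h n \<in> borel_measurable borel" for n unfolding h_def by measurable
    define U where "U n = (\<integral>\<^sup>+t. ennreal (h n t) \<partial>circ)" for n
    have AEd: "AE t in circ. 0 < cdist t"
      using AE_circ by eventually_elim (auto simp: cdist_def)
    define V where "V n = A * real (Suc n) powr b" for n
    have V: "V n > 0" for n using A by (simp add: V_def)
    have step1: "ennreal (u n powr q) \<le> ennreal (V n powr (q - 1)) * U n" for n
    proof (cases "U n = top")
      case True
      then show ?thesis using V[of n] by (simp add: ennreal_mult_top)
    next
      case False
      then obtain U' where U': "U n = ennreal U'" "U' \<ge> 0" by (cases "U n") auto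
      have "u n powr q \<le> V n powr (q - 1) * U'"
      proof (rule holder_from_young[OF q1 _ V U'(2)])
        fix L :: real assume L: "L > 0"
        have "ennreal (u n) \<le> (\<integral>\<^sup>+t. ennreal (g t * kern (Suc n) (cdist t)) \<partial>circ)"
          using u by simp
        also have "\<dots> \<le> (\<integral>\<^sup>+t. ennreal (L powr q / q) * ennreal (h n t) +
            ennreal (L powr (- q') / q') * ennreal (kern (Suc n) (cdist t) * cdist t powr (- b)) \<partial>circ)"
          using AEd
        proof (intro nn_integral_mono_AE, eventually_elim)
          fix t assume d: "0 < cdist t"
          \<comment> \<open>The \<open>q\<close>-th power of \<open>w\<close> is the factor in
            \<open>h\<close>, and its negative conjugate power is \<open>cdist t powr (- b)\<close>,
            whose integral against the kernel is bounded by \<open>V n\<close>.\<close>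
          define w where "w = cdist t powr (1 / (2 * q))"
          have w: "w > 0" using d by (simp add: w_def)
          have wq: "w powr q = cdist t powr (1 / 2)"
            using q by (simp add: w_def powr_powr)
          have "1 / (2 * q) * (- q') = - b" using q by (simp add: q'_def b_def)
          then have wq': "(1 / w) powr q' = cdist t powr (- b)"
            using w by (simp add: w_def powr_powr powr_divide powr_minus_divide[symmetric])
          have k: "0 \<le> kern (Suc n) (cdist t)" using d by (intro kern_nonneg) simp
          have "g t = (g t * w) * (1 / w)" using w by simp
          also have "\<dots> \<le> L powr q * (g t * w) powr q / q + L powr (- q') * (1 / w) powr q' / q'"
            by (rule young_scaled) (use q1 q' g0 w L in auto)
          also have "\<dots> = L powr q / q * (g t powr q * cdist t powr (1 / 2)) + L powr (- q') / q' * cdist t powr (- b)"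
            unfolding wq' powr_mult wq by simp
          finally have "g t * kern (Suc n) (cdist t) \<le>
            (L powr q / q * (g t powr q * cdist t powr (1 / 2)) + L powr (- q') / q' * cdist t powr (- b)) * kern (Suc n) (cdist t)"
            using k by (rule mult_right_mono)
          also have "\<dots> = L powr q / q * h n t + L powr (- q') / q' * (kern (Suc n) (cdist t) * cdist t powr (- b))"
            by (simp add: h_def algebra_simps)
          finally have le: "ennreal (g t * kern (Suc n) (cdist t)) \<le> ennreal \<dots>" by (rule ennreal_leI)
          have "0 \<le> h n t" using k by (simp add: h_def)
          with le k show "ennreal (g t * kern (Suc n) (cdist t)) \<le> ennreal (L powr q / q) * ennreal (h n t) +
            ennreal (L powr (- q') / q') * ennreal (kern (Suc n) (cdist t) * cdist t powr (- b))"
            using q1 q' by (simp add: ennreal_mult[symmetric] ennreal_plus[symmetric] del: ennreal_plus)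
        qed
        also have "\<dots> = ennreal (L powr q / q) * U n +
            ennreal (L powr (- q') / q') * (\<integral>\<^sup>+t. ennreal (kern (Suc n) (cdist t) * cdist t powr (- b)) \<partial>circ)"
          unfolding U_def by (subst nn_integral_add) (auto simp: nn_integral_cmult)
        also have "\<dots> \<le> ennreal (L powr q / q) * ennreal U' + ennreal (L powr (- q') / q') * ennreal (V n)"
          unfolding U' V_def A_def by (intro add_mono mult_left_mono nn_integral_kern_le b) auto
        also have "\<dots> = ennreal (L powr q / q * U' + L powr (- q') / q' * V n)"
          using U' V[of n] q1 q' by (simp add: ennreal_mult[symmetric] ennreal_plus[symmetric] del: ennreal_plus)
        finally show "u n \<le> L powr q / q * U' + L powr (- (q / (q - 1))) / (q / (q - 1)) * V n"
          using U' V[of n] q1 q' by (subst (asm) ennreal_le_iff) (auto simp: q'_def intro!: add_nonneg_nonneg mult_nonneg_nonneg)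
      qed (use u in simp)
      then have "ennreal (u n powr q) \<le> ennreal (V n powr (q - 1) * U')" by (rule ennreal_leI)
      then show ?thesis using U' by (simp add: ennreal_mult)
    qed
    \<comment> \<open>The exponents \<open>1 / 2\<close> and \<open>- 2\<close> combine to the
      weight of \<open>sum_kern_le\<close>. The power \<open>cdist t powr (- 1 / 2)\<close> which
      that lemma returns cancels the one in \<open>h\<close>.\<close>
    have Vq: "V n powr (q - 1) / (real (Suc n))\<^sup>2 = A powr (q - 1) * real (Suc n) powr (- 3 / 2)" for n
    proof -
      have "b * (q - 1) = 1 / 2" using q by (simp add: b_def)
      then have "V n powr (q - 1) = A powr (q - 1) * real (Suc n) powr (1 / 2)"
        by (simp only: V_def powr_mult powr_powr)
      moreover have "real (Suc n) powr (1 / 2) / (real (Suc n))\<^sup>2 = real (Suc n) powr (- 3 / 2)"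
        using powr_diff[of "real (Suc n)" "1 / 2" 2] by (simp add: powr_numeral)
      ultimately show ?thesis by (metis times_divide_eq_right)
    qed
    have "ennreal (\<Sum>n<N. u n powr q / (real (Suc n))\<^sup>2) = (\<Sum>n<N. ennreal (u n powr q) * ennreal (1 / (real (Suc n))\<^sup>2))"
      by (subst sum_ennreal[symmetric]) (auto simp: ennreal_mult[symmetric])
    also have "\<dots> \<le> (\<Sum>n<N. ennreal (V n powr (q - 1)) * U n * ennreal (1 / (real (Suc n))\<^sup>2))"
      by (intro sum_mono mult_right_mono step1) auto
    also have "\<dots> = (\<Sum>n<N. ennreal (A powr (q - 1) * real (Suc n) powr (- 3 / 2)) * U n)"
    proof (intro sum.cong refl)
      fix n
      have "ennreal (A powr (q - 1) * real (Suc n) powr (- 3 / 2)) = ennreal (V n powr (q - 1)) * ennreal (1 / (real (Suc n))\<^sup>2)"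
        unfolding Vq[symmetric] by (simp add: ennreal_mult[symmetric])
      then show "ennreal (V n powr (q - 1)) * U n * ennreal (1 / (real (Suc n))\<^sup>2)
        = ennreal (A powr (q - 1) * real (Suc n) powr (- 3 / 2)) * U n"
        by (simp only: mult_ac)
    qed
    also have "\<dots> = (\<integral>\<^sup>+t. (\<Sum>n<N. ennreal (A powr (q - 1) * real (Suc n) powr (- 3 / 2)) * ennreal (h n t)) \<partial>circ)"
      unfolding U_def by (subst nn_integral_sum) (auto simp: nn_integral_cmult)
    also have "\<dots> \<le> (\<integral>\<^sup>+t. ennreal (C * g t powr q) \<partial>circ)"
      using AEd
    proof (intro nn_integral_mono_AE, eventually_elim)
      fix t assume d: "0 < cdist t"
      have k: "0 \<le> kern (Suc n) (cdist t)" for n using d by (intro kern_nonneg) simp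
      have h0: "0 \<le> h n t" for n using k by (simp add: h_def)
      have "(\<Sum>n<N. A powr (q - 1) * real (Suc n) powr (- 3 / 2) * h n t)
         = A powr (q - 1) * g t powr q * cdist t powr (1 / 2) * (\<Sum>n<N. real (Suc n) powr (- 3 / 2) * kern (Suc n) (cdist t))"
        unfolding sum_distrib_left h_def by (intro sum.cong) auto
      also have "\<dots> \<le> A powr (q - 1) * g t powr q * cdist t powr (1 / 2) * (8 * cdist t powr (- 1 / 2))"
        by (intro mult_left_mono sum_kern_le d) auto
      also have "\<dots> = C * g t powr q * (cdist t powr (1 / 2) * cdist t powr (- 1 / 2))"
        by (simp add: C_def)
      also have "cdist t powr (1 / 2) * cdist t powr (- 1 / 2) = 1"
        using d by (simp flip: powr_add)
      finally have "ennreal (\<Sum>n<N. A powr (q - 1) * real (Suc n) powr (- 3 / 2) * h n t) \<le> ennreal (C * g t powr q)"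
        by (simp add: ennreal_leI)
      then show "(\<Sum>n<N. ennreal (A powr (q - 1) * real (Suc n) powr (- 3 / 2)) * ennreal (h n t)) \<le> ennreal (C * g t powr q)"
        using h0 by (subst (asm) sum_ennreal[symmetric]) (auto simp: ennreal_mult)
    qed
    also have "\<dots> = ennreal (\<integral>t. C * g t powr q \<partial>circ)"
    proof (rule nn_integral_eq_integral)
      show "integrable circ (\<lambda>t. C * g t powr q)"
        using q g0 gB C by (intro integrable_mult_right integrable_circ_bounded[of _ "B powr q"])
          (auto intro!: powr_mono2)
    qed (use C in auto)
    finally show "(\<Sum>n<N. u n powr q / (real (Suc n))\<^sup>2) \<le> C * (\<integral>t. g t powr q \<partial>circ)"
      using C by (subst (asm) ennreal_le_iff) (auto intro!: mult_nonneg_nonneg integral_nonneg_AE)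
  qed
qed

section \<open>Exponential sums under the majorant kernel\<close>

lemma sin_ge_third:
  fixes x :: real
  assumes "0 \<le> x" "x \<le> pi / 2"
  shows "x / 3 \<le> sin x"
proof -
  have "\<bar>sin x - (\<Sum>m<3. sin_coeff m * x ^ m)\<bar> \<le> inverse (fact 3) * \<bar>x\<bar> ^ 3"
    by (rule Maclaurin_sin_bound)
  moreover have "(\<Sum>m<3. sin_coeff m * x ^ m) = x"
    by (simp add: eval_nat_numeral sin_coeff_def)
  moreover have "inverse (fact 3) * \<bar>x\<bar> ^ 3 = x ^ 3 / 6"
    using assms by (simp add: fact_numeral)
  ultimately have *: "x - x ^ 3 / 6 \<le> sin x"
    by linarith
  \<comment> \<open>For \<open>x \<le> 2\<close> the cubic term \<open>x ^ 3 / 6\<close> is at most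
    \<open>2 * x / 3\<close>, which leaves \<open>x / 3\<close>.\<close>
  have "x \<le> 2" using assms pi_less_4 by simp
  then have "x\<^sup>2 \<le> 2\<^sup>2" using assms by (intro power_mono) auto
  then have "x * x\<^sup>2 \<le> x * 4" using assms by (intro mult_left_mono) auto
  then have "x ^ 3 \<le> x * 4" by (simp add: power_numeral_reduce)
  with * show ?thesis by simp
qed

lemma norm_one_minus_cis_ge:
  assumes "0 < t" "t < 2 * pi"
  shows "cdist t / 3 \<le> norm (1 - cis (- t))"
proof -
  have "norm (1 - cis (- t)) = norm (exp (\<i> * of_real (- t)) - 1)"
    by (metis cis_conv_exp norm_minus_commute)
  also have "\<dots> = 2 * \<bar>sin (t / 2)\<bar>"
    by (subst dist_exp_i_1) simp
  also have "\<bar>sin (t / 2)\<bar> = sin (t / 2)"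
    using assms by (intro abs_of_nonneg sin_ge_zero) auto
  also have "sin (t / 2) = sin (cdist t / 2)"
  proof (cases "t \<le> 2 * pi - t")
    case False
    then have "cdist t / 2 = pi - t / 2" by (simp add: cdist_def field_simps)
    then show ?thesis by (simp only: sin_pi_minus)
  qed (simp add: cdist_def)
  also have "2 * sin (cdist t / 2) \<ge> cdist t / 3"
  proof -
    have "0 \<le> cdist t" "cdist t \<le> pi" using assms by (auto simp: cdist_def min_def)
    then show ?thesis using sin_ge_third[of "cdist t / 2"] by simp
  qed
  finally show ?thesis .
qed

text \<open>Mirrors the two branches of \<open>kern\<close>. In the far branch a bound on
  \<open>W\<close> times \<open>1 - cis (- t)\<close>, as geometric sums and summation by parts
  provide it, is divided by \<open>cdist t / 3\<close>; this is the origin of the factor 6.\<close>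

lemma norm_le_kern:
  assumes t: "0 < t" "t < 2 * pi"
    and small: "real (Suc n) * cdist t < 1 \<Longrightarrow> norm W \<le> K * (real (Suc n) powr (3 / 4) * cdist t powr (- 1 / 4))"
    and large: "norm W * norm (1 - cis (- t)) \<le> 2 * L" and K: "6 * L \<le> K"
  shows "norm W \<le> K * kern (Suc n) (cdist t)"
proof (cases "real (Suc n) * cdist t < 1")
  case True
  then show ?thesis using small by (simp add: kern_def)
next
  case False
  have d: "0 < cdist t" using t by (simp add: cdist_def)
  have "norm W * (cdist t / 3) \<le> norm W * norm (1 - cis (- t))"
    by (intro mult_left_mono norm_one_minus_cis_ge t) auto
  then have "norm W * cdist t \<le> K" using large K by simp
  then show ?thesis using False d by (simp add: kern_def field_simps)
qed

text \<open>Far from 0 the geometric sum is used, near 0 the number of terms. There a quarter power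
  of \<open>n + 1\<close> is given up for \<open>1 / cdist t\<close>, which is larger.\<close>

lemma norm_dirichlet_le_kern:
  assumes t: "0 < t" "t < 2 * pi"
  shows "norm (\<Sum>k\<le>n. cis (- (real k * t))) \<le> 6 * kern (Suc n) (cdist t)"
proof (rule norm_le_kern[OF t, where L = 1])
  have d: "0 < cdist t" using t by (simp add: cdist_def)
  have "(\<Sum>k\<le>n. cis (- (real k * t))) = (\<Sum>k\<le>n. cis (- t) ^ k)"
    by (rule sum.cong) (simp_all only: Complex.DeMoivre mult_minus_right)
  then have "(1 - cis (- t)) * (\<Sum>k\<le>n. cis (- (real k * t))) = 1 - cis (- t) ^ Suc n"
    by (simp only: sum_gp_basic)
  then have "norm (\<Sum>k\<le>n. cis (- (real k * t))) * norm (1 - cis (- t)) = norm (1 - cis (- t) ^ Suc n)"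
    by (metis mult.commute norm_mult)
  also have "\<dots> \<le> norm (1 :: complex) + norm (cis (- t) ^ Suc n)"
    by (rule norm_triangle_ineq4)
  also have "\<dots> = 2" by (simp add: norm_power del: power_Suc)
  finally show "norm (\<Sum>k\<le>n. cis (- (real k * t))) * norm (1 - cis (- t)) \<le> 2 * 1" by simp
  assume *: "real (Suc n) * cdist t < 1"
  have "norm (\<Sum>k\<le>n. cis (- (real k * t))) \<le> (\<Sum>k\<le>n. norm (cis (- (real k * t))))"
    by (rule norm_sum)
  also have "\<dots> = real (Suc n)" by simp
  also have "\<dots> = real (Suc n) powr (3 / 4) * real (Suc n) powr (1 / 4)"
    by (simp flip: powr_add)
  also have "\<dots> \<le> real (Suc n) powr (3 / 4) * (1 / cdist t) powr (1 / 4)"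
    using * d by (intro mult_left_mono powr_mono2) (auto simp: field_simps)
  also have "(1 / cdist t) powr (1 / 4) = cdist t powr (- 1 / 4)"
    using d powr_minus_divide[of "cdist t" "1 / 4"] by (simp add: powr_divide)
  also have "real (Suc n) powr (3 / 4) * cdist t powr (- 1 / 4) \<le> 6 * (real (Suc n) powr (3 / 4) * cdist t powr (- 1 / 4))"
    by simp
  finally show "norm (\<Sum>k\<le>n. cis (- (real k * t))) \<le> 6 * (real (Suc n) powr (3 / 4) * cdist t powr (- 1 / 4))" .
qed simp

lemma norm_integral_kern_le:
  fixes g W :: "real \<Rightarrow> complex"
  assumes [measurable]: "g \<in> borel_measurable borel" "W \<in> borel_measurable borel"
    and K: "0 < K" and W: "\<And>t. 0 < t \<Longrightarrow> t < 2 * pi \<Longrightarrow> norm (W t) \<le> K * kern m (cdist t)"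
  shows "ennreal (norm (\<integral>t. g t * W t \<partial>circ) / K) \<le> (\<integral>\<^sup>+t. ennreal (norm (g t) * kern m (cdist t)) \<partial>circ)"
proof -
  \<comment> \<open>If the product is not integrable, its integral is 0 by convention and the bound
    is trivial.\<close>
  have "ennreal (norm (\<integral>t. g t * W t \<partial>circ)) \<le> (\<integral>\<^sup>+t. ennreal (norm (g t * W t)) \<partial>circ)"
    by (cases "integrable circ (\<lambda>t. g t * W t)")
       (auto intro: integral_norm_bound_ennreal simp: not_integrable_integral_eq)
  also have "\<dots> \<le> (\<integral>\<^sup>+t. ennreal K * ennreal (norm (g t) * kern m (cdist t)) \<partial>circ)"
    using AE_circ
  proof (intro nn_integral_mono_AE, eventually_elim)
    fix t assume t: "0 < t \<and> t < 2 * pi"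
    have "norm (g t) * norm (W t) \<le> norm (g t) * (K * kern m (cdist t))"
      using t by (intro mult_left_mono W) auto
    moreover have "0 \<le> kern m (cdist t)" using t by (intro kern_nonneg) (auto simp: cdist_def)
    ultimately show "ennreal (norm (g t * W t)) \<le> ennreal K * ennreal (norm (g t) * kern m (cdist t))"
      using K by (simp add: norm_mult ennreal_mult[symmetric] mult_ac ennreal_leI)
  qed
  also have "\<dots> = ennreal K * (\<integral>\<^sup>+t. ennreal (norm (g t) * kern m (cdist t)) \<partial>circ)"
    by (rule nn_integral_cmult) measurable
  finally have "ennreal (norm (\<integral>t. g t * W t \<partial>circ)) * ennreal (1 / K)
     \<le> ennreal K * (\<integral>\<^sup>+t. ennreal (norm (g t) * kern m (cdist t)) \<partial>circ) * ennreal (1 / K)"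
    by (rule mult_right_mono) simp
  also have "\<dots> = ennreal K * ennreal (1 / K) * (\<integral>\<^sup>+t. ennreal (norm (g t) * kern m (cdist t)) \<partial>circ)"
    by (simp only: mult_ac)
  also have "ennreal K * ennreal (1 / K) = 1"
    using K by (simp add: ennreal_mult[symmetric])
  finally show ?thesis using K by (simp add: ennreal_mult[symmetric])
qed

lemma norm_fourier_series_le:
  assumes "summable (\<lambda>n. norm (c n))"
  shows "norm (\<Sum>n. c n * cis (real n * t)) \<le> (\<Sum>n. norm (c n))"
proof -
  have "norm (\<Sum>n. c n * cis (real n * t)) \<le> (\<Sum>n. norm (c n * cis (real n * t)))"
    by (rule summable_norm) (use assms in \<open>simp add: norm_mult\<close>)
  then show ?thesis by (simp add: norm_mult)
qed

lemma measurable_fourier_series [measurable]: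
  "(\<lambda>t. \<Sum>n. c n * cis (real n * t)) \<in> borel_measurable borel"
  by measurable

lemma partial_sums_inequality:
  assumes p: "2 \<le> p"
  shows "\<exists>C>0. \<forall>c N. summable (\<lambda>n. norm (c n)) \<longrightarrow>
    (\<Sum>n<N. norm (\<Sum>k\<le>n. c k) powr p / (real (Suc n))\<^sup>2)
      \<le> C * (\<integral>t. norm (\<Sum>n. c n * cis (real n * t)) powr p \<partial>circ)"
proof -
  obtain C where C: "C > 0" and schur:
    "\<forall>g B u N. g \<in> borel_measurable borel \<longrightarrow> (\<forall>t. 0 \<le> g t \<and> g t \<le> B) \<longrightarrow>
    (\<forall>n. 0 \<le> u n \<and> ennreal (u n) \<le> (\<integral>\<^sup>+t. ennreal (g t * kern (Suc n) (cdist t)) \<partial>circ)) \<longrightarrow>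
    (\<Sum>n<N. u n powr p / (real (Suc n))\<^sup>2) \<le> C * (\<integral>t. g t powr p \<partial>circ)"
    using schur_kern[OF p] by blast
  show ?thesis
  proof (intro exI[of _ "6 powr p * C"] conjI allI impI)
    show "0 < 6 powr p * C" using C by simp
    fix c :: "nat \<Rightarrow> complex" and N
    assume c: "summable (\<lambda>n. norm (c n))"
    define f where "f t = (\<Sum>n. c n * cis (real n * t))" for t
    have [measurable]: "f \<in> borel_measurable borel" unfolding f_def by measurable
    have fB: "norm (f t) \<le> (\<Sum>n. norm (c n))" for t
      unfolding f_def by (rule norm_fourier_series_le[OF c])
    define W where "W n t = (\<Sum>k\<le>n. cis (- (real k * t)))" for n t
    have [measurable]: "W n \<in> borel_measurable borel" for n unfolding W_def by measurable
    have S: "(\<Sum>k\<le>n. c k) = (\<integral>t. f t * W n t \<partial>circ)" for n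
    proof -
      have "(\<Sum>k\<le>n. c k) = (\<Sum>k\<le>n. fourier f k)"
        unfolding f_def by (simp add: fourier_series[OF c])
      also have "\<dots> = (\<integral>t. (\<Sum>k\<le>n. f t * cis (- (real k * t))) \<partial>circ)"
        unfolding fourier_def
        by (rule Bochner_Integration.integral_sum[symmetric])
           (auto intro!: integrable_circ_bounded[of _ "\<Sum>n. norm (c n)"] simp: norm_mult fB)
      finally show ?thesis by (simp add: W_def sum_distrib_left)
    qed
    \<comment> \<open>Division by the constant of \<open>norm_dirichlet_le_kern\<close> brings the
      partial sums into the normalisation of \<open>schur_kern\<close>.\<close>
    define u where "u n = norm (\<Sum>k\<le>n. c k) / 6" for n
    have "ennreal (u n) \<le> (\<integral>\<^sup>+t. ennreal (norm (f t) * kern (Suc n) (cdist t)) \<partial>circ)" for n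
      unfolding u_def S
      by (rule norm_integral_kern_le) (auto simp: W_def intro!: norm_dirichlet_le_kern)
    then have "(\<Sum>n<N. u n powr p / (real (Suc n))\<^sup>2) \<le> C * (\<integral>t. norm (f t) powr p \<partial>circ)"
      using fB by (intro schur[rule_format, of "\<lambda>t. norm (f t)"]) (auto simp: u_def)
    moreover have "norm (\<Sum>k\<le>n. c k) powr p = 6 powr p * u n powr p" for n
      by (simp add: u_def powr_divide)
    ultimately show "(\<Sum>n<N. norm (\<Sum>k\<le>n. c k) powr p / (real (Suc n))\<^sup>2)
      \<le> 6 powr p * C * (\<integral>t. norm (\<Sum>n. c n * cis (real n * t)) powr p \<partial>circ)"
      unfolding f_def[symmetric] by (simp add: sum_distrib_left[symmetric] mult.assoc flip: times_divide_eq_right)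
  qed
qed

text \<open>Carries bounds for polynomials, uniform in the degree, over to power series on a circle;
  the constant \<open>(\<Sum>n. norm (c n)) powr p\<close> dominates.\<close>

lemma integral_powr_series_limit:
  assumes c: "summable (\<lambda>n. norm (c n))" and p: "0 < p"
  shows "(\<lambda>N. \<integral>t. norm (\<Sum>n<N. c n * cis (real n * t)) powr p \<partial>circ)
      \<longlonglongrightarrow> (\<integral>t. norm (\<Sum>n. c n * cis (real n * t)) powr p \<partial>circ)"
proof (rule integral_dominated_convergence[where w = "\<lambda>_. (\<Sum>n. norm (c n)) powr p"])
  show "AE t in circ. (\<lambda>N. norm (\<Sum>n<N. c n * cis (real n * t)) powr p)
      \<longlonglongrightarrow> norm (\<Sum>n. c n * cis (real n * t)) powr p"
  proof (rule AE_I2)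
    fix t
    have "summable (\<lambda>n. c n * cis (real n * t))"
      by (rule summable_norm_cancel) (simp add: norm_mult c)
    from summable_LIMSEQ[OF this]
    show "(\<lambda>N. norm (\<Sum>n<N. c n * cis (real n * t)) powr p)
      \<longlonglongrightarrow> norm (\<Sum>n. c n * cis (real n * t)) powr p"
      using p by (intro tendsto_powr' tendsto_norm tendsto_const) auto
  qed
  fix N
  have "norm (\<Sum>n<N. c n * cis (real n * t)) \<le> (\<Sum>n. norm (c n))" for t
    by (rule order_trans[OF norm_sum]) (simp add: norm_mult sum_le_suminf[OF c])
  then show "AE t in circ. norm (norm (\<Sum>n<N. c n * cis (real n * t)) powr p) \<le> (\<Sum>n. norm (c n)) powr p"
    using p by (intro AE_I2) (auto intro!: powr_mono2)
qed auto

section \<open>Hardy spaces and Rhaly operators\<close>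

abbreviation taylor :: "(complex \<Rightarrow> complex) \<Rightarrow> nat \<Rightarrow> complex" where
  "taylor f \<equiv> fps_nth (fps_expansion f 0)"

lemma taylor_sums:
  assumes "f holomorphic_on ball 0 1" "z \<in> ball 0 1"
  shows "(\<lambda>n. taylor f n * z ^ n) sums f z"
  using holomorphic_power_series[OF assms] by (simp add: fps_expansion_def)

lemma summable_norm_powser_disc:
  fixes a :: "nat \<Rightarrow> complex"
  assumes "\<And>z. z \<in> ball 0 1 \<Longrightarrow> summable (\<lambda>n. a n * z ^ n)" "0 \<le> r" "r < 1"
  shows "summable (\<lambda>n. norm (a n * of_real r ^ n))"
proof (rule powser_insidea)
  show "summable (\<lambda>n. a n * complex_of_real ((1 + r) / 2) ^ n)"
    using assms(2,3) by (intro assms(1)) (auto simp: dist_norm norm_divide simp flip: of_real_add)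
  have "norm (complex_of_real ((1 + r) / 2)) = (1 + r) / 2" using assms by (simp only: norm_of_real) simp
  then show "norm (complex_of_real r) < norm (complex_of_real ((1 + r) / 2))"
    using assms by simp
qed

lemma taylor_summable:
  assumes "f holomorphic_on ball 0 1" "0 \<le> r" "r < 1"
  shows "summable (\<lambda>n. norm (taylor f n * of_real r ^ n))"
  by (rule summable_norm_powser_disc) (use assms taylor_sums sums_summable in blast)+

lemma taylor_circle:
  assumes "f holomorphic_on ball 0 1" "0 \<le> r" "r < 1"
  shows "f (of_real r * cis t) = (\<Sum>n. taylor f n * of_real r ^ n * cis (real n * t))"
proof -
  have "(\<lambda>n. taylor f n * (of_real r * cis t) ^ n) sums f (of_real r * cis t)"
    by (rule taylor_sums) (use assms in \<open>auto simp: norm_mult\<close>)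
  then show ?thesis
    by (simp add: sums_iff power_mult_distrib Complex.DeMoivre mult.assoc)
qed

text \<open>As \<open>s ^ n \<le> s ^ k\<close> for \<open>k \<le> n\<close>, the product is
  dominated by the absolutely convergent Taylor series at radius \<open>s\<close>. Summing
  coefficients thus does not shrink the disc of convergence.\<close>

lemma partial_sum_bound:
  assumes "f holomorphic_on ball 0 1" "0 < s" "s < 1"
  shows "\<exists>A\<ge>0. \<forall>n. norm (\<Sum>k\<le>n. taylor f k) * s ^ n \<le> A"
proof -
  let ?A = "\<Sum>k. norm (taylor f k * of_real s ^ k)"
  have sm: "summable (\<lambda>k. norm (taylor f k * of_real s ^ k))"
    by (rule taylor_summable) (use assms in auto)
  have "norm (\<Sum>k\<le>n. taylor f k) * s ^ n \<le> ?A" for n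
  proof -
    have "norm (\<Sum>k\<le>n. taylor f k) * s ^ n \<le> (\<Sum>k\<le>n. norm (taylor f k)) * s ^ n"
      using assms by (intro mult_right_mono norm_sum) auto
    also have "\<dots> \<le> (\<Sum>k\<le>n. norm (taylor f k * of_real s ^ k))"
      unfolding sum_distrib_right norm_mult norm_power norm_of_real
      using assms by (intro sum_mono mult_left_mono) (auto intro!: power_decreasing)
    also have "\<dots> \<le> ?A"
      by (rule sum_le_suminf[OF sm]) auto
    finally show ?thesis .
  qed
  moreover have "?A \<ge> 0" by (rule suminf_nonneg[OF sm]) auto
  ultimately show ?thesis by blast
qed

lemma rhaly_coeff_summable:
  assumes f: "f holomorphic_on ball 0 1" and K: "\<And>n. norm (\<eta> n) \<le> K" and r: "0 \<le> r" "r < 1"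
  shows "summable (\<lambda>n. norm (rhaly_coeff \<eta> f n * of_real r ^ n))"
proof -
  \<comment> \<open>A radius strictly between \<open>r\<close> and 1: growth of order
    \<open>s ^ (- n)\<close> against \<open>r ^ n\<close> leaves a convergent geometric
    series.\<close>
  define s where "s = (1 + r) / 2"
  have s: "0 < s" "s < 1" "r < s" using r by (auto simp: s_def)
  obtain A where A: "A \<ge> 0" "\<And>n. norm (\<Sum>k\<le>n. taylor f k) * s ^ n \<le> A"
    using partial_sum_bound[OF f s(1,2)] by blast
  have K0: "K \<ge> 0" using K[of 0] norm_ge_zero order_trans by blast
  have le: "norm (rhaly_coeff \<eta> f n * of_real r ^ n) \<le> K * A * (r / s) ^ n" for n
  proof -
    have "norm (\<Sum>k\<le>n. taylor f k) \<le> A / s ^ n"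
      using A(2)[of n] s by (simp add: pos_le_divide_eq)
    then have "norm (\<eta> n) * norm (\<Sum>k\<le>n. taylor f k) * r ^ n \<le> K * (A / s ^ n) * r ^ n"
      using r K0 by (intro mult_right_mono mult_mono K) auto
    then show ?thesis using r by (simp add: rhaly_coeff_def norm_mult norm_power power_divide)
  qed
  have "summable (\<lambda>n. K * A * (r / s) ^ n)"
    using r s by (intro summable_mult summable_geometric) auto
  then show ?thesis
    by (rule summable_comparison_test'[where N = 0]) (simp add: le)
qed

lemma rhaly_sums:
  assumes "f holomorphic_on ball 0 1" and "\<And>n. norm (\<eta> n) \<le> K" and z: "z \<in> ball 0 1"
  shows "(\<lambda>n. rhaly_coeff \<eta> f n * z ^ n) sums rhaly \<eta> f z"
proof -
  have "summable (\<lambda>n. norm (rhaly_coeff \<eta> f n * of_real (norm z) ^ n))"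
    by (rule rhaly_coeff_summable) (use assms in auto)
  then have "summable (\<lambda>n. norm (rhaly_coeff \<eta> f n * z ^ n))"
    by (simp add: norm_mult norm_power)
  then show ?thesis unfolding rhaly_def by (rule summable_sums[OF summable_norm_cancel])
qed

lemma rhaly_holomorphic:
  assumes "f holomorphic_on ball 0 1" and "\<And>n. norm (\<eta> n) \<le> K"
  shows "rhaly \<eta> f holomorphic_on ball 0 1"
  by (rule power_series_holomorphic[where a = "rhaly_coeff \<eta> f"])
     (use rhaly_sums[OF assms] in simp)

lemma rhaly_circle:
  assumes "rhaly_defined \<eta> f" and "0 \<le> r" "r < 1"
  shows "summable (\<lambda>n. norm (rhaly_coeff \<eta> f n * of_real r ^ n))"
    and "rhaly \<eta> f (of_real r * cis t) = (\<Sum>n. rhaly_coeff \<eta> f n * of_real r ^ n * cis (real n * t))"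
proof -
  show "summable (\<lambda>n. norm (rhaly_coeff \<eta> f n * of_real r ^ n))"
    by (rule summable_norm_powser_disc) (use assms in \<open>auto simp: rhaly_defined_def\<close>)
  show "rhaly \<eta> f (of_real r * cis t) = (\<Sum>n. rhaly_coeff \<eta> f n * of_real r ^ n * cis (real n * t))"
    by (simp add: rhaly_def power_mult_distrib Complex.DeMoivre mult.assoc)
qed

lemma rhaly_defined_bounded:
  assumes "f holomorphic_on ball 0 1" and "\<And>n. norm (\<eta> n) \<le> K"
  shows "rhaly_defined \<eta> f"
  unfolding rhaly_defined_def by (intro ballI sums_summable[OF rhaly_sums[OF assms]])

section \<open>Integral means and Hardy norms\<close>

lemma hardy_mean_eq:
  assumes "f holomorphic_on ball 0 1" "0 \<le> r" "r < 1" "0 < p"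
  shows "hardy_mean p f r = (\<integral>t. norm (f (of_real r * cis t)) powr p \<partial>circ) powr (1 / p)"
proof -
  have "continuous_on UNIV (\<lambda>t. f (of_real r * cis t))"
    by (rule continuous_on_compose2[OF holomorphic_on_imp_continuous_on[OF assms(1)]])
       (use assms in \<open>auto intro!: continuous_intros simp: norm_mult\<close>)
  then have "continuous_on UNIV (\<lambda>t. norm (f (of_real r * cis t)) powr p)"
    using assms by (intro continuous_on_powr' continuous_intros) auto
  then show ?thesis unfolding hardy_mean_def by (simp add: integral_circ)
qed

lemma hardy_mean_powr:
  assumes "f holomorphic_on ball 0 1" "0 \<le> r" "r < 1" "0 < p"
  shows "hardy_mean p f r powr p = (\<integral>t. norm (f (of_real r * cis t)) powr p \<partial>circ)"
  using assms by (simp add: hardy_mean_eq powr_powr integral_nonneg_AE)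

lemma hardy_mean_nonneg: "0 \<le> hardy_mean p f r"
  by (simp add: hardy_mean_def)

lemma hardy_spaceD: "f \<in> hardy_space p \<Longrightarrow> f holomorphic_on ball 0 1"
  by (simp add: hardy_space_def)

lemma hardy_mean_le_norm:
  assumes "f \<in> hardy_space p" "0 < r" "r < 1"
  shows "hardy_mean p f r \<le> hardy_norm p f"
  unfolding hardy_norm_def using assms by (intro cSUP_upper) (auto simp: hardy_space_def)

lemma hardy_norm_nonneg:
  assumes "f \<in> hardy_space p"
  shows "0 \<le> hardy_norm p f"
  using hardy_mean_le_norm[OF assms, of "1 / 2"] hardy_mean_nonneg[of p f "1 / 2"] by simp

lemma integral_circle_le_hardy_norm:
  assumes f: "f \<in> hardy_space p" and "0 < r" "r < 1" "0 < p"
  shows "(\<integral>t. norm (f (of_real r * cis t)) powr p \<partial>circ) \<le> hardy_norm p f powr p"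
  using assms hardy_mean_le_norm[OF f] hardy_mean_nonneg
  by (subst hardy_mean_powr[symmetric]) (auto intro!: powr_mono2 dest: hardy_spaceD)

lemma hardy_spaceI:
  assumes "f holomorphic_on ball 0 1" "0 < p" "0 \<le> M"
    and "\<And>r. 0 < r \<Longrightarrow> r < 1 \<Longrightarrow> (\<integral>t. norm (f (of_real r * cis t)) powr p \<partial>circ) \<le> M powr p"
  shows "f \<in> hardy_space p" and "hardy_norm p f \<le> M"
proof -
  have *: "hardy_mean p f r \<le> M" if "r \<in> {0<..<1}" for r
  proof -
    have "hardy_mean p f r \<le> (M powr p) powr (1 / p)"
      using assms that by (subst hardy_mean_eq) (auto intro!: powr_mono2 integral_nonneg_AE)
    also have "\<dots> = M" using assms by (simp add: powr_powr)
    finally show ?thesis .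
  qed
  then show "f \<in> hardy_space p"
    unfolding hardy_space_def using assms by (auto intro!: bdd_aboveI2[where M = M])
  show "hardy_norm p f \<le> M"
    unfolding hardy_norm_def using * by (intro cSUP_least) auto
qed

section \<open>Linearity, and reduction of boundedness to one inequality\<close>

lemma rhaly_coeff_add:
  assumes "f holomorphic_on ball 0 1" "g holomorphic_on ball 0 1"
  shows "rhaly_coeff \<eta> (\<lambda>w. f w + g w) n = rhaly_coeff \<eta> f n + rhaly_coeff \<eta> g n"
  using higher_deriv_add[OF assms, of 0]
  by (simp add: rhaly_coeff_def fps_expansion_def add_divide_distrib sum.distrib distrib_left)

lemma rhaly_coeff_cmult:
  assumes "f holomorphic_on ball 0 1"
  shows "rhaly_coeff \<eta> (\<lambda>w. c * f w) n = c * rhaly_coeff \<eta> f n"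
proof -
  have "taylor (\<lambda>w. c * f w) k = c * taylor f k" for k
    using higher_deriv_cmult[OF assms, of 0] by (simp add: fps_expansion_def)
  then show ?thesis by (simp add: rhaly_coeff_def sum_distrib_left[symmetric] mult_ac)
qed

text \<open>For bounded \<open>\<eta>\<close>, well-definedness, analyticity and linearity follow
  from the power series, so only an estimate of \<open>p\<close>-th powers on each circle remains.
  The operator constant is then \<open>C powr (1 / p)\<close>.\<close>

lemma rhaly_boundedI:
  assumes p: "0 < p" and K: "\<And>n. norm (\<eta> n) \<le> K" and C: "0 \<le> C"
    and bound: "\<And>f r. f \<in> hardy_space p \<Longrightarrow> 0 < r \<Longrightarrow> r < 1 \<Longrightarrow>
      (\<integral>t. norm (rhaly \<eta> f (of_real r * cis t)) powr p \<partial>circ) \<le> C * hardy_norm p f powr p"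
  shows "rhaly_bounded p \<eta>"
proof -
  have sums: "(\<lambda>n. rhaly_coeff \<eta> f n * z ^ n) sums rhaly \<eta> f z"
    if "f \<in> hardy_space p" "z \<in> ball 0 1" for f z
    using rhaly_sums[OF hardy_spaceD[OF that(1)] K that(2)] .
  have M: "rhaly \<eta> f \<in> hardy_space p" "hardy_norm p (rhaly \<eta> f) \<le> C powr (1 / p) * hardy_norm p f"
    if f: "f \<in> hardy_space p" for f
  proof -
    have hol: "rhaly \<eta> f holomorphic_on ball 0 1"
      by (rule rhaly_holomorphic[OF hardy_spaceD[OF f] K])
    have M0: "0 \<le> C powr (1 / p) * hardy_norm p f"
      using hardy_norm_nonneg[OF f] by simp
    have "(C powr (1 / p) * hardy_norm p f) powr p = C * hardy_norm p f powr p"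
      using p C by (simp add: powr_mult powr_powr)
    then have le: "(\<integral>t. norm (rhaly \<eta> f (of_real r * cis t)) powr p \<partial>circ)
        \<le> (C powr (1 / p) * hardy_norm p f) powr p" if "0 < r" "r < 1" for r
      using bound[OF f that] by simp
    show "rhaly \<eta> f \<in> hardy_space p" "hardy_norm p (rhaly \<eta> f) \<le> C powr (1 / p) * hardy_norm p f"
      using hardy_spaceI[OF hol p M0 le] by auto
  qed
  have add: "rhaly \<eta> (\<lambda>w. f w + g w) z = rhaly \<eta> f z + rhaly \<eta> g z"
    if fg: "f \<in> hardy_space p" "g \<in> hardy_space p" and z: "z \<in> ball 0 1" for f g z
  proof -
    have "(\<lambda>n. rhaly_coeff \<eta> (\<lambda>w. f w + g w) n * z ^ n) sums (rhaly \<eta> f z + rhaly \<eta> g z)"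
      using sums_add[OF sums[OF fg(1) z] sums[OF fg(2) z]]
      by (simp add: rhaly_coeff_add[OF fg[THEN hardy_spaceD]] distrib_right)
    then show ?thesis by (simp add: rhaly_def sums_iff)
  qed
  have cmult: "rhaly \<eta> (\<lambda>w. c * f w) z = c * rhaly \<eta> f z"
    if f: "f \<in> hardy_space p" and z: "z \<in> ball 0 1" for c f z
  proof -
    have "(\<lambda>n. rhaly_coeff \<eta> (\<lambda>w. c * f w) n * z ^ n) sums (c * rhaly \<eta> f z)"
      using sums_mult[OF sums[OF f z], of c] by (simp add: rhaly_coeff_cmult[OF hardy_spaceD[OF f]] mult.assoc)
    then show ?thesis by (simp add: rhaly_def sums_iff)
  qed
  show ?thesis
    unfolding rhaly_bounded_def hardy_bounded_linear_def rhaly_defined_def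
    using sums[THEN sums_summable] M add cmult by blast
qed

text \<open>Replaces an eventual bound by one valid at every index; the shift to
  \<open>Suc n\<close> is needed since \<open>1 / of_nat 0\<close> is 0.\<close>

lemma bigo_inverse_nat_iff:
  fixes \<eta> :: "nat \<Rightarrow> 'a :: real_normed_field"
  shows "\<eta> \<in> O(\<lambda>n. 1 / of_nat n) \<longleftrightarrow> (\<exists>K>0. \<forall>n. norm (\<eta> n) \<le> K / real (Suc n))"
proof
  assume "\<eta> \<in> O(\<lambda>n. 1 / of_nat n)"
  then obtain c where c: "c > 0" and "eventually (\<lambda>n. norm (\<eta> n) \<le> c * norm (1 / of_nat n :: 'a)) at_top"
    by (auto elim!: landau_o.bigE)
  then obtain n0 where n0: "\<And>n. n \<ge> n0 \<Longrightarrow> norm (\<eta> n) \<le> c / real n"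
    by (auto simp: eventually_at_top_linorder norm_divide)
  \<comment> \<open>The sum takes care of the finitely many exceptional indices, and the factor 2 of
    the shift, as \<open>n + 1 \<le> 2 * n\<close> for \<open>n \<ge> 1\<close>.\<close>
  define K where "K = 2 * c + (\<Sum>k\<le>n0. norm (\<eta> k) * real (Suc k))"
  have K: "K > 0" using c by (auto simp: K_def intro!: add_pos_nonneg sum_nonneg)
  have "norm (\<eta> n) \<le> K / real (Suc n)" for n
  proof (cases "n \<le> n0")
    case True
    have "norm (\<eta> n) * real (Suc n) \<le> (\<Sum>k\<le>n0. norm (\<eta> k) * real (Suc k))"
      using True by (intro member_le_sum) auto
    also have "\<dots> \<le> K" using c by (simp add: K_def)
    finally show ?thesis by (simp add: pos_le_divide_eq)
  next
    case False
    have "norm (\<eta> n) \<le> c / real n" using n0 False by simp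
    also have "\<dots> \<le> 2 * c / real (Suc n)"
      using False c by (simp add: field_simps)
    also have "\<dots> \<le> K / real (Suc n)"
      by (intro divide_right_mono) (auto simp: K_def intro!: sum_nonneg)
    finally show ?thesis .
  qed
  with K show "\<exists>K>0. \<forall>n. norm (\<eta> n) \<le> K / real (Suc n)" by blast
next
  assume "\<exists>K>0. \<forall>n. norm (\<eta> n) \<le> K / real (Suc n)"
  then obtain K where K: "K > 0" "\<And>n. norm (\<eta> n) \<le> K / real (Suc n)" by blast
  show "\<eta> \<in> O(\<lambda>n. 1 / of_nat n)"
  proof (rule landau_o.bigI[OF K(1)])
    show "\<forall>\<^sub>F n in at_top. norm (\<eta> n) \<le> K * norm (1 / of_nat n :: 'a)"
      using eventually_gt_at_top[of 0]
    proof eventually_elim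
      case (elim n)
      have "K / real (Suc n) \<le> K / real n" using elim K(1) by (intro divide_left_mono) auto
      then show ?case using K(2)[of n] by (simp add: norm_divide)
    qed
  qed
qed

lemma rhaly_bounded_ge_2:
  assumes p: "2 \<le> p" and \<eta>: "\<eta> \<in> O(\<lambda>n. 1 / of_nat n)"
  shows "rhaly_bounded p \<eta>"
proof -
  obtain K where K: "K > 0" "\<And>n. norm (\<eta> n) \<le> K / real (Suc n)"
    using \<eta> unfolding bigo_inverse_nat_iff by blast
  have KB: "norm (\<eta> n) \<le> K" for n
  proof -
    have "K / real (Suc n) \<le> K" using K(1) by (simp add: field_simps)
    then show ?thesis using K(2)[of n] by simp
  qed
  have p0: "0 < p" using p by simp
  obtain C1 where C1: "C1 > 0" and hl:
    "\<forall>c N. (\<integral>t. norm (\<Sum>n<N. c n * cis (real n * t)) powr p \<partial>circ)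
       \<le> C1 * (\<Sum>n<N. real (Suc n) powr (p - 2) * norm (c n) powr p)"
    using hardy_littlewood_polynomial[OF p] by blast
  obtain C2 where C2: "C2 > 0" and ps:
    "\<forall>c N. summable (\<lambda>n. norm (c n)) \<longrightarrow>
    (\<Sum>n<N. norm (\<Sum>k\<le>n. c k) powr p / (real (Suc n))\<^sup>2)
      \<le> C2 * (\<integral>t. norm (\<Sum>n. c n * cis (real n * t)) powr p \<partial>circ)"
    using partial_sums_inequality[OF p] by blast
  show ?thesis
  proof (rule rhaly_boundedI[OF p0 KB])
    show "0 \<le> C1 * K powr p * C2" using C1 C2 by simp
    fix f r assume f: "f \<in> hardy_space p" and r: "0 < r" "r < (1::real)"
    note hol = hardy_spaceD[OF f]
    \<comment> \<open>The Taylor coefficients need not be absolutely summable, so the inequality is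
      applied at radius \<open>\<rho> < 1\<close>. Only finitely many coefficients occur on the
      left, and \<open>\<rho>\<close> may tend to 1 termwise.\<close>
    have S: "(\<Sum>n<N. norm (\<Sum>k\<le>n. taylor f k) powr p / (real (Suc n))\<^sup>2) \<le> C2 * hardy_norm p f powr p" for N
    proof (rule tendsto_upperbound)
      show "((\<lambda>\<rho>. \<Sum>n<N. norm (\<Sum>k\<le>n. taylor f k * of_real \<rho> ^ k) powr p / (real (Suc n))\<^sup>2)
        \<longlongrightarrow> (\<Sum>n<N. norm (\<Sum>k\<le>n. taylor f k) powr p / (real (Suc n))\<^sup>2)) (at_left 1)"
      proof (intro tendsto_sum tendsto_divide tendsto_powr' tendsto_norm tendsto_const)
        fix k
        have "((\<lambda>\<rho>. taylor f k * of_real \<rho> ^ k) \<longlongrightarrow> taylor f k * of_real 1 ^ k) (at_left (1::real))"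
          by (intro tendsto_intros)
        then show "((\<lambda>\<rho>. taylor f k * of_real \<rho> ^ k) \<longlongrightarrow> taylor f k) (at_left (1::real))"
          by simp
      qed (use p in auto)
      show "\<forall>\<^sub>F \<rho> in at_left 1. (\<Sum>n<N. norm (\<Sum>k\<le>n. taylor f k * of_real \<rho> ^ k) powr p / (real (Suc n))\<^sup>2)
          \<le> C2 * hardy_norm p f powr p"
        using eventually_at_left_real[of 0 1, simplified]
      proof eventually_elim
        case (elim \<rho>)
        have "(\<Sum>n<N. norm (\<Sum>k\<le>n. taylor f k * of_real \<rho> ^ k) powr p / (real (Suc n))\<^sup>2)
          \<le> C2 * (\<integral>t. norm (f (of_real \<rho> * cis t)) powr p \<partial>circ)"
          using ps[rule_format, of "\<lambda>n. taylor f n * of_real \<rho> ^ n" N] taylor_summable[OF hol, of \<rho>] elim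
          by (simp add: taylor_circle[OF hol])
        also have "\<dots> \<le> C2 * hardy_norm p f powr p"
          using C2 elim p0 by (intro mult_left_mono integral_circle_le_hardy_norm f) auto
        finally show ?case .
      qed
    qed simp
    define c where "c n = rhaly_coeff \<eta> f n * of_real r ^ n" for n
    have c: "summable (\<lambda>n. norm (c n))"
      unfolding c_def by (rule rhaly_circle(1)[OF rhaly_defined_bounded[OF hol KB]]) (use r in auto)
    have "(\<integral>t. norm (\<Sum>n<N. c n * cis (real n * t)) powr p \<partial>circ) \<le> C1 * K powr p * C2 * hardy_norm p f powr p" for N
    proof -
      have "real (Suc n) powr (p - 2) * norm (c n) powr p
        \<le> K powr p * (norm (\<Sum>k\<le>n. taylor f k) powr p / (real (Suc n))\<^sup>2)" for n
      proof -
        have "norm (c n) = norm (\<eta> n) * norm (\<Sum>k\<le>n. taylor f k) * r ^ n"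
          using r by (simp add: c_def rhaly_coeff_def norm_mult norm_power)
        also have "\<dots> \<le> norm (\<eta> n) * norm (\<Sum>k\<le>n. taylor f k) * 1"
          using r by (intro mult_left_mono power_le_one) auto
        also have "\<dots> \<le> K / real (Suc n) * norm (\<Sum>k\<le>n. taylor f k)"
          unfolding mult_1_right by (rule mult_right_mono[OF K(2)]) simp
        finally have "norm (c n) powr p \<le> (K / real (Suc n) * norm (\<Sum>k\<le>n. taylor f k)) powr p"
          using p by (intro powr_mono2) auto
        also have "\<dots> = K powr p * norm (\<Sum>k\<le>n. taylor f k) powr p / real (Suc n) powr p"
          using K(1) by (simp add: powr_mult powr_divide del: of_nat_Suc)
        finally have "real (Suc n) powr (p - 2) * norm (c n) powr p
           \<le> real (Suc n) powr (p - 2) * (K powr p * norm (\<Sum>k\<le>n. taylor f k) powr p / real (Suc n) powr p)"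
          by (intro mult_left_mono) auto
        also have "\<dots> = K powr p * (norm (\<Sum>k\<le>n. taylor f k) powr p / (real (Suc n))\<^sup>2)"
          by (simp add: powr_diff powr_numeral del: of_nat_Suc)
        finally show ?thesis .
      qed
      then have "(\<Sum>n<N. real (Suc n) powr (p - 2) * norm (c n) powr p)
          \<le> K powr p * (\<Sum>n<N. norm (\<Sum>k\<le>n. taylor f k) powr p / (real (Suc n))\<^sup>2)"
        unfolding sum_distrib_left by (rule sum_mono)
      also have "\<dots> \<le> K powr p * (C2 * hardy_norm p f powr p)"
        by (intro mult_left_mono S) auto
      finally have "C1 * (\<Sum>n<N. real (Suc n) powr (p - 2) * norm (c n) powr p)
          \<le> C1 * (K powr p * (C2 * hardy_norm p f powr p))"
        using C1 by (intro mult_left_mono) auto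
      then show ?thesis using hl[rule_format, of c N] by (simp add: mult.assoc)
    qed
    then have "(\<integral>t. norm (\<Sum>n. c n * cis (real n * t)) powr p \<partial>circ) \<le> C1 * K powr p * C2 * hardy_norm p f powr p"
      by (intro LIMSEQ_le_const2[OF integral_powr_series_limit[OF c p0]]) auto
    then show "(\<integral>t. norm (rhaly \<eta> f (of_real r * cis t)) powr p \<partial>circ) \<le> C1 * K powr p * C2 * hardy_norm p f powr p"
      using r by (simp add: rhaly_circle(2)[OF rhaly_defined_bounded[OF hol KB]] c_def)
  qed
qed

section \<open>The test functions\<close>

text \<open>Both series represent \<open>f\<close> on one circle of positive radius, and
  \<open>fourier\<close> reads the coefficients off there.\<close>

lemma taylor_unique:
  assumes f: "f holomorphic_on ball 0 1"
    and a: "\<And>z. z \<in> ball 0 1 \<Longrightarrow> (\<lambda>n. a n * z ^ n) sums f z"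
  shows "taylor f n = a n"
proof -
  obtain r :: real where r: "0 < r" "r < 1"
    using dense[of 0 "1 :: real"] by auto
  have sa: "summable (\<lambda>n. norm (a n * of_real r ^ n))"
    by (rule summable_norm_powser_disc[OF sums_summable[OF a]]) (use r in auto)
  have "(\<Sum>n. taylor f n * of_real r ^ n * cis (real n * t)) = (\<Sum>n. a n * of_real r ^ n * cis (real n * t))" for t
  proof -
    have "(\<lambda>n. a n * (of_real r * cis t) ^ n) sums f (of_real r * cis t)"
      by (rule a) (use r in \<open>simp add: norm_mult\<close>)
    then have "(\<Sum>n. a n * of_real r ^ n * cis (real n * t)) = f (of_real r * cis t)"
      by (simp add: sums_iff power_mult_distrib Complex.DeMoivre mult.assoc)
    then show ?thesis using taylor_circle[OF f, of r t] r by simp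
  qed
  then have "fourier (\<lambda>t. \<Sum>n. taylor f n * of_real r ^ n * cis (real n * t)) n
      = fourier (\<lambda>t. \<Sum>n. a n * of_real r ^ n * cis (real n * t)) n"
    by simp
  then have "taylor f n * of_real r ^ n = a n * of_real r ^ n"
    using fourier_series[OF sa, of n] fourier_series[OF taylor_summable[OF f, of r], of n] r by simp
  then show ?thesis using r by simp
qed

text \<open>The square of the Cauchy kernel, with coefficients \<open>(n + 1) * r ^ n\<close>.
  Squaring makes its \<open>p\<close>-th mean a pure power of \<open>1 - r\<close> for all
  \<open>p \<ge> 1\<close>; at \<open>p = 1\<close> the Cauchy kernel itself would bring in a
  logarithm.\<close>

definition sqkern :: "real \<Rightarrow> complex \<Rightarrow> complex" where
  "sqkern r z = 1 / (1 - of_real r * z)\<^sup>2"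

lemma norm_one_minus_ge:
  fixes z :: complex
  assumes "0 \<le> r" "norm z \<le> 1"
  shows "1 - r \<le> norm (1 - of_real r * z)"
proof -
  have "norm (of_real r * z) \<le> r * 1"
    unfolding norm_mult using assms by (intro mult_mono) auto
  then show ?thesis using norm_triangle_ineq2[of 1 "of_real r * z"] by simp
qed

lemma sqkern_sums:
  assumes "norm (of_real r * z) < 1"
  shows "(\<lambda>n. of_real (real (Suc n) * r ^ n) * z ^ n) sums sqkern r z"
  using geometric_deriv_sums[OF assms]
  by (simp add: sqkern_def power_mult_distrib mult.assoc)

lemma norm_of_real_mult_less_1:
  fixes z :: complex
  assumes "0 < r" "r < 1" "norm z \<le> 1"
  shows "norm (of_real r * z) < 1"
proof -
  have "norm (of_real r * z) \<le> r * 1"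
    unfolding norm_mult using assms by (intro mult_mono) auto
  then show ?thesis using assms by simp
qed

lemma sqkern_holomorphic:
  assumes "0 < r" "r < 1"
  shows "sqkern r holomorphic_on ball 0 1"
proof (rule power_series_holomorphic)
  fix z :: complex assume z: "z \<in> ball 0 1"
  have "norm (of_real r * z) < 1"
    using assms z by (intro norm_of_real_mult_less_1) auto
  then show "(\<lambda>n. of_real (real (Suc n) * r ^ n) * (z - 0) ^ n) sums sqkern r z"
    using sqkern_sums by simp
qed

lemma taylor_sqkern:
  assumes "0 < r" "r < 1"
  shows "taylor (sqkern r) n = of_real (real (Suc n) * r ^ n)"
proof (rule taylor_unique[OF sqkern_holomorphic[OF assms]])
  fix z :: complex assume "z \<in> ball 0 1"
  then show "(\<lambda>n. of_real (real (Suc n) * r ^ n) * z ^ n) sums sqkern r z"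
    by (intro sqkern_sums norm_of_real_mult_less_1 assms) auto
qed

text \<open>Parseval's formula for the geometric series.\<close>

lemma integral_cauchy_kernel_square:
  assumes s: "0 \<le> s" "s < 1"
  shows "(\<integral>t. 1 / (norm (1 - of_real s * cis t))\<^sup>2 \<partial>circ) = 1 / (1 - s\<^sup>2)"
proof -
  define c where "c n = complex_of_real s ^ n" for n
  have c: "summable (\<lambda>n. norm (c n))"
    using s by (simp add: c_def norm_power summable_geometric)
  define f where "f t = (\<Sum>n. c n * cis (real n * t))" for t
  have f_eq: "f t = 1 / (1 - of_real s * cis t)" for t
  proof -
    have "(\<lambda>n. (of_real s * cis t) ^ n) sums (1 / (1 - of_real s * cis t))"
      by (rule geometric_sums) (use s in \<open>simp add: norm_mult\<close>)
    then show ?thesis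
      by (simp add: sums_iff f_def c_def power_mult_distrib Complex.DeMoivre)
  qed
  have [measurable]: "f \<in> borel_measurable borel" unfolding f_def by measurable
  have "(\<lambda>n. c n * cnj (fourier f n)) sums (\<integral>t. f t * cnj (f t) \<partial>circ)"
    unfolding f_def using norm_fourier_series_le[OF c]
    by (intro fourier_pairing[OF c]) auto
  moreover have "c n * cnj (fourier f n) = of_real ((s\<^sup>2) ^ n)" for n
    unfolding f_def fourier_series[OF c]
    by (simp add: c_def power_mult_distrib[symmetric] power2_eq_square)
  moreover have "(\<integral>t. f t * cnj (f t) \<partial>circ) = of_real (\<integral>t. 1 / (norm (1 - of_real s * cis t))\<^sup>2 \<partial>circ)"
    unfolding integral_complex_of_real[symmetric] complex_norm_square[symmetric]
    by (simp add: f_eq norm_divide power_divide)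
  ultimately have "(\<lambda>n. complex_of_real ((s\<^sup>2) ^ n)) sums of_real (\<integral>t. 1 / (norm (1 - of_real s * cis t))\<^sup>2 \<partial>circ)"
    by simp
  then have "(\<lambda>n. (s\<^sup>2) ^ n) sums (\<integral>t. 1 / (norm (1 - of_real s * cis t))\<^sup>2 \<partial>circ)"
    by (simp only: sums_of_real_iff)
  moreover have "(\<lambda>n. (s\<^sup>2) ^ n) sums (1 / (1 - s\<^sup>2))"
    by (rule geometric_sums) (use s in \<open>simp add: power_less_one_iff abs_square_less_1\<close>)
  ultimately show ?thesis by (rule sums_unique2)
qed

text \<open>Of the \<open>2 * p\<close> factors \<open>1 / D t\<close>, two are integrated exactly
  and the others are bounded by \<open>1 / (1 - r)\<close>. Including \<open>\<rho> = 1\<close>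
  serves the pairing, where the kernel is used on the unit circle.\<close>

lemma integral_sqkern_le:
  assumes r: "0 < r" "r < 1" and \<rho>: "0 \<le> \<rho>" "\<rho> \<le> 1" and p: "1 \<le> p"
  shows "(\<integral>t. norm (sqkern r (of_real \<rho> * cis t)) powr p \<partial>circ) \<le> (1 - r) powr (1 - 2 * p)"
proof -
  define s where "s = r * \<rho>"
  have s: "0 \<le> s" "s \<le> r" using r \<rho> by (auto simp: s_def mult_left_le)
  define D where "D t = norm (1 - of_real s * cis t)" for t
  have D: "1 - r \<le> D t" for t
    using norm_one_minus_ge[of s "cis t"] s by (simp add: D_def)
  have D0: "0 < D t" for t using D[of t] r by linarith
  have [measurable]: "D \<in> borel_measurable borel" unfolding D_def by measurable
  have "norm (sqkern r (of_real \<rho> * cis t)) = 1 / (D t)\<^sup>2" for t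
    by (simp add: sqkern_def D_def s_def norm_divide norm_power mult.assoc)
  then have "(\<integral>t. norm (sqkern r (of_real \<rho> * cis t)) powr p \<partial>circ) = (\<integral>t. (1 / (D t)\<^sup>2) powr p \<partial>circ)"
    by simp
  also have "\<dots> \<le> (\<integral>t. (1 - r) powr (2 - 2 * p) * (1 / (D t)\<^sup>2) \<partial>circ)"
  proof (rule integral_mono)
    have b: "1 / (D t)\<^sup>2 \<le> 1 / (1 - r)\<^sup>2" for t
      using D[of t] r by (intro divide_left_mono power_mono) auto
    show "integrable circ (\<lambda>t. (1 / (D t)\<^sup>2) powr p)"
      by (rule integrable_circ_bounded[of _ "(1 / (1 - r)\<^sup>2) powr p"])
         (use b p in \<open>auto intro!: powr_mono2\<close>)
    show "integrable circ (\<lambda>t. (1 - r) powr (2 - 2 * p) * (1 / (D t)\<^sup>2))"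
      by (intro integrable_mult_right integrable_circ_bounded[of _ "1 / (1 - r)\<^sup>2"])
         (use b in auto)
    fix t
    have "(1 / (D t)\<^sup>2) powr p = D t powr (- 2 * p)"
      using D0[of t] by (simp add: powr_divide powr_minus_divide powr_powr flip: powr_numeral)
    also have "\<dots> = D t powr (2 - 2 * p) * (1 / (D t)\<^sup>2)"
      using D0[of t] powr_add[of "D t" "2 - 2 * p" "- 2"] by (simp add: powr_minus_divide powr_numeral)
    also have "\<dots> \<le> (1 - r) powr (2 - 2 * p) * (1 / (D t)\<^sup>2)"
      using D[of t] r p by (intro mult_right_mono powr_mono2') auto
    finally show "(1 / (D t)\<^sup>2) powr p \<le> (1 - r) powr (2 - 2 * p) * (1 / (D t)\<^sup>2)" .
  qed
  also have "\<dots> = (1 - r) powr (2 - 2 * p) * (1 / (1 - s\<^sup>2))"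
    unfolding D_def using integral_cauchy_kernel_square[of s] s r
    by (simp only: integral_mult_right_zero)
  also have "\<dots> \<le> (1 - r) powr (2 - 2 * p) * (1 / (1 - r))"
  proof (intro mult_left_mono divide_left_mono mult_pos_pos)
    have "s\<^sup>2 \<le> r\<^sup>2" using s by (intro power_mono) auto
    also have "r\<^sup>2 \<le> r" using r by (simp add: power2_eq_square mult_left_le)
    finally have "s\<^sup>2 \<le> r" .
    then show "1 - r \<le> 1 - s\<^sup>2" "0 < 1 - s\<^sup>2" using r by auto
  qed (use r in auto)
  also have "\<dots> = (1 - r) powr (1 - 2 * p)"
    using r powr_add[of "1 - r" "2 - 2 * p" "- 1"] by (simp add: powr_minus_divide)
  finally show ?thesis .
qed

lemma sqkern_hardy:
  assumes r: "0 < r" "r < 1" and p: "1 \<le> p"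
  shows "sqkern r \<in> hardy_space p" and "hardy_norm p (sqkern r) powr p \<le> (1 - r) powr (1 - 2 * p)"
proof -
  let ?M = "(1 - r) powr ((1 - 2 * p) / p)"
  have M: "?M powr p = (1 - r) powr (1 - 2 * p)" using p by (simp add: powr_powr)
  have *: "sqkern r \<in> hardy_space p" "hardy_norm p (sqkern r) \<le> ?M"
    using hardy_spaceI[OF sqkern_holomorphic[OF r], of p ?M] integral_sqkern_le[OF r _ _ p] p
    unfolding M by auto
  then show "sqkern r \<in> hardy_space p" by simp
  show "hardy_norm p (sqkern r) powr p \<le> (1 - r) powr (1 - 2 * p)"
    unfolding M[symmetric] using * p by (intro powr_mono2 hardy_norm_nonneg) auto
qed

lemma rhaly_bounded_sqkern:
  assumes "rhaly_bounded p \<eta>" and p: "1 \<le> p"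
  shows "\<exists>C>0. \<forall>r \<rho>. 0 < r \<longrightarrow> r < 1 \<longrightarrow> 0 < \<rho> \<longrightarrow> \<rho> < 1 \<longrightarrow>
    (\<integral>t. norm (rhaly \<eta> (sqkern r) (of_real \<rho> * cis t)) powr p \<partial>circ) \<le> C * (1 - r) powr (1 - 2 * p)"
proof -
  obtain C0 where C0: "\<And>f. f \<in> hardy_space p \<Longrightarrow> hardy_norm p (rhaly \<eta> f) \<le> C0 * hardy_norm p f"
    and T: "\<And>f. f \<in> hardy_space p \<Longrightarrow> rhaly \<eta> f \<in> hardy_space p"
    using assms(1) unfolding rhaly_bounded_def hardy_bounded_linear_def by blast
  \<comment> \<open>The constant in \<open>hardy_bounded_linear\<close> may be zero or negative; a
    positive one is needed for its powers.\<close>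
  define C where "C = max C0 1"
  have C: "C \<ge> 1" "C0 \<le> C" by (auto simp: C_def)
  show ?thesis
  proof (intro exI[of _ "C powr p"] conjI allI impI)
    show "0 < C powr p" using C by simp
    fix r \<rho> :: real assume r: "0 < r" "r < 1" and \<rho>: "0 < \<rho>" "\<rho> < 1"
    let ?f = "sqkern r"
    have f: "?f \<in> hardy_space p" by (rule sqkern_hardy[OF r p])
    have "(\<integral>t. norm (rhaly \<eta> ?f (of_real \<rho> * cis t)) powr p \<partial>circ) \<le> hardy_norm p (rhaly \<eta> ?f) powr p"
      by (rule integral_circle_le_hardy_norm[OF T[OF f]]) (use \<rho> p in auto)
    also have "\<dots> \<le> (C * hardy_norm p ?f) powr p"
    proof (intro powr_mono2)
      have "C0 * hardy_norm p ?f \<le> C * hardy_norm p ?f"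
        using C hardy_norm_nonneg[OF f] by (intro mult_right_mono) auto
      then show "hardy_norm p (rhaly \<eta> ?f) \<le> C * hardy_norm p ?f" using C0[OF f] by simp
    qed (use p hardy_norm_nonneg[OF T[OF f]] in auto)
    also have "\<dots> = C powr p * hardy_norm p ?f powr p"
      using C hardy_norm_nonneg[OF f] by (simp add: powr_mult)
    also have "\<dots> \<le> C powr p * (1 - r) powr (1 - 2 * p)"
      by (intro mult_left_mono sqkern_hardy r p) auto
    finally show "(\<integral>t. norm (rhaly \<eta> ?f (of_real \<rho> * cis t)) powr p \<partial>circ) \<le> C powr p * (1 - r) powr (1 - 2 * p)" .
  qed
qed

definition sqsum :: "real \<Rightarrow> nat \<Rightarrow> real" where
  "sqsum r n = (\<Sum>k\<le>n. real (Suc k) * r ^ k)"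

lemma rhaly_coeff_sqkern:
  assumes "0 < r" "r < 1"
  shows "rhaly_coeff \<eta> (sqkern r) n = \<eta> n * of_real (sqsum r n)"
  unfolding rhaly_coeff_def sqsum_def by (simp add: taylor_sqkern[OF assms])

text \<open>By Bernoulli's inequality \<open>r ^ m \<ge> 1 / 2\<close> for this \<open>r\<close>, so
  below \<open>m\<close> all powers of \<open>r\<close> cost at most a factor 2 and
  \<open>sqsum\<close> grows as if \<open>r\<close> were 1.\<close>

lemma sqsum_ge:
  assumes m: "n < m" and r: "r = 1 - 1 / (2 * real m)"
  shows "1 / 2 \<le> r ^ n" and "(real (Suc n))\<^sup>2 / 4 \<le> sqsum r n"
proof -
  have m0: "real m > 0" using m by simp
  have r01: "0 \<le> r" "r \<le> 1" using m0 m by (auto simp: r field_simps)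
  have half: "1 / 2 \<le> r ^ k" if "k < m" for k
  proof -
    have "1 + real m * (- (1 / (2 * real m))) \<le> (1 + - (1 / (2 * real m))) ^ m"
      by (rule Bernoulli_inequality) (use m0 m in \<open>simp add: field_simps\<close>)
    then have "1 / 2 \<le> r ^ m" using m0 by (simp add: r)
    also have "\<dots> \<le> r ^ k" using that r01 by (intro power_decreasing) auto
    finally show ?thesis .
  qed
  show "1 / 2 \<le> r ^ n" by (rule half[OF m])
  have "(\<Sum>k\<le>n. real (Suc k)) = real (Suc n) * real (Suc (Suc n)) / 2"
    by (induction n) (auto simp: field_simps)
  then have "(real (Suc n))\<^sup>2 / 4 \<le> (\<Sum>k\<le>n. real (Suc k)) / 2"
    by (simp add: power2_eq_square field_simps)
  also have "\<dots> = (\<Sum>k\<le>n. real (Suc k) * (1 / 2))"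
    by (simp add: sum_divide_distrib)
  also have "\<dots> \<le> sqsum r n"
    unfolding sqsum_def using m by (intro sum_mono mult_left_mono half) auto
  finally show "(real (Suc n))\<^sup>2 / 4 \<le> sqsum r n" .
qed

lemma sqsum_nonneg: "0 \<le> r \<Longrightarrow> 0 \<le> sqsum r n"
  unfolding sqsum_def by (intro sum_nonneg) auto

section \<open>Pairings with the image of the test function, and necessity for decreasing
  weights\<close>

lemma rhaly_sqkern_pairing:
  assumes "rhaly_defined \<eta> (sqkern r)" and r: "0 < r" "r < 1" and \<rho>: "0 < \<rho>" "\<rho> < 1"
    and g: "g \<in> borel_measurable borel" "\<And>t. norm (g t) \<le> B"
  shows "(\<lambda>n. \<eta> n * of_real (sqsum r n * \<rho> ^ n) * cnj (fourier g n)) sums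
    (\<integral>t. rhaly \<eta> (sqkern r) (of_real \<rho> * cis t) * cnj (g t) \<partial>circ)"
proof -
  have "summable (\<lambda>n. norm (rhaly_coeff \<eta> (sqkern r) n * of_real \<rho> ^ n))"
    by (rule rhaly_circle(1)[OF assms(1)]) (use \<rho> in auto)
  from fourier_pairing[OF this g]
  show ?thesis
    using rhaly_circle(2)[OF assms(1), of \<rho>] \<rho> by (simp add: rhaly_coeff_sqkern[OF r] mult.assoc)
qed

lemma measurable_rhaly_circle:
  assumes "rhaly_defined \<eta> f" "0 < \<rho>" "\<rho> < 1"
  shows "(\<lambda>t. rhaly \<eta> f (of_real \<rho> * cis t)) \<in> borel_measurable borel"
    and "\<exists>B. \<forall>t. norm (rhaly \<eta> f (of_real \<rho> * cis t)) \<le> B"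
proof -
  have eq: "rhaly \<eta> f (of_real \<rho> * cis t) = (\<Sum>n. rhaly_coeff \<eta> f n * of_real \<rho> ^ n * cis (real n * t))" for t
    by (rule rhaly_circle(2)) (use assms in auto)
  show "(\<lambda>t. rhaly \<eta> f (of_real \<rho> * cis t)) \<in> borel_measurable borel"
    unfolding eq by (rule measurable_fourier_series)
  show "\<exists>B. \<forall>t. norm (rhaly \<eta> f (of_real \<rho> * cis t)) \<le> B"
    unfolding eq using norm_fourier_series_le[OF rhaly_circle(1)[OF assms(1)], of \<rho>] assms by auto
qed

lemma decseq_rhaly_bounded_imp_bigo:
  fixes \<eta> :: "nat \<Rightarrow> real"
  assumes p: "1 < p" and dec: "decseq \<eta>" and nn: "\<And>n. 0 \<le> \<eta> n"
    and bdd: "rhaly_bounded p (\<lambda>n. complex_of_real (\<eta> n))"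
  shows "\<eta> \<in> O(\<lambda>n. 1 / of_nat n)"
proof -
  let ?\<eta> = "\<lambda>n. complex_of_real (\<eta> n)"
  define q where "q = p / (p - 1)"
  have q: "1 < q" "1 / p + 1 / q = 1" using p by (auto simp: q_def field_simps)
  have q': "q / p = q - 1" using p by (simp add: q_def field_simps)
  have p1: "1 \<le> p" using p by simp
  obtain C where C: "C > 0" and CX: "\<forall>r \<rho>. 0 < r \<longrightarrow> r < 1 \<longrightarrow> 0 < \<rho> \<longrightarrow> \<rho> < 1 \<longrightarrow>
    (\<integral>t. norm (rhaly ?\<eta> (sqkern r) (of_real \<rho> * cis t)) powr p \<partial>circ) \<le> C * (1 - r) powr (1 - 2 * p)"
    using rhaly_bounded_sqkern[OF bdd p1] by blast
  \<comment> \<open>Here 256 is \<open>8 * 4 * 8\<close>: the lower bound of each term loses 8, the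
    sum of cubes loses 4, and \<open>d powr (- 3)\<close> equals
    \<open>8 * real m ^ 3\<close>.\<close>
  have "\<eta> N \<le> 256 * (C + 1) / real (Suc N)" for N
  proof -
    define m where "m = Suc N"
    define r where "r = 1 - 1 / (2 * real m)"
    have m: "real m \<ge> 1" by (simp add: m_def)
    have r: "0 < r" "r < 1" using m by (auto simp: r_def field_simps)
    define d where "d = 1 - r"
    have d: "0 < d" "d = 1 / (2 * real m)" using r by (auto simp: d_def r_def)
    have def: "rhaly_defined ?\<eta> (sqkern r)"
      using bdd sqkern_hardy(1)[OF r p1] by (simp add: rhaly_bounded_def)
    define g where "g t = sqkern r (cis t)" for t
    define b where "b n = complex_of_real (real (Suc n) * r ^ n)" for n
    have g_eq: "g t = (\<Sum>n. b n * cis (real n * t))" for t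
    proof -
      have "(\<lambda>n. b n * cis t ^ n) sums g t"
        unfolding g_def b_def by (rule sqkern_sums[OF norm_of_real_mult_less_1]) (use r in auto)
      then show ?thesis by (simp add: sums_iff Complex.DeMoivre)
    qed
    \<comment> \<open>At the point 1 the terms are nonnegative reals, so convergence there already
      is absolute convergence.\<close>
    have b: "summable (\<lambda>n. norm (b n))"
    proof -
      have "(\<lambda>n. of_real (real (Suc n) * r ^ n) * (1 :: complex) ^ n) sums sqkern r 1"
        by (rule sqkern_sums) (use r in simp)
      then have "(\<lambda>n. complex_of_real (real (Suc n) * r ^ n)) sums of_real (Re (sqkern r 1))"
        using sums_Re[of "\<lambda>n. of_real (real (Suc n) * r ^ n) * (1 :: complex) ^ n"] 
        by (simp add: sums_of_real_iff flip: of_real_mult of_real_power del: of_nat_Suc)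
      then have "summable (\<lambda>n. real (Suc n) * r ^ n)"
        by (simp only: sums_of_real_iff sums_summable)
      then show ?thesis using r by (simp add: b_def norm_mult norm_power del: of_nat_Suc)
    qed
    have fg: "fourier g n = b n" for n
      unfolding g_eq by (rule fourier_series[OF b])
    have gm [measurable]: "g \<in> borel_measurable borel" unfolding g_eq by measurable
    have gB: "norm (g t) \<le> (\<Sum>n. norm (b n))" for t
      unfolding g_eq by (rule norm_fourier_series_le[OF b])
    have sum_le: "(\<Sum>n<m. \<eta> n * (sqsum r n * \<rho> ^ n) * (real (Suc n) * r ^ n)) \<le> (C + 1) * d powr (- 3)"
      if \<rho>: "0 < \<rho>" "\<rho> < 1" for \<rho>
    proof -
      define F where "F t = rhaly ?\<eta> (sqkern r) (of_real \<rho> * cis t)" for t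
      have [measurable]: "F \<in> borel_measurable borel"
        unfolding F_def by (rule measurable_rhaly_circle(1)[OF def \<rho>])
      obtain B where B: "\<And>t. norm (F t) \<le> B"
        unfolding F_def using measurable_rhaly_circle(2)[OF def \<rho>] by blast
      define a where "a n = \<eta> n * (sqsum r n * \<rho> ^ n) * (real (Suc n) * r ^ n)" for n
      have a0: "0 \<le> a n" for n
        unfolding a_def using nn r \<rho> by (intro mult_nonneg_nonneg sqsum_nonneg) auto
      define I where "I = (\<integral>t. F t * cnj (g t) \<partial>circ)"
      have "(\<lambda>n. complex_of_real (a n)) sums I"
        using rhaly_sqkern_pairing[OF def r \<rho> gm gB] by (simp add: I_def F_def fg b_def a_def mult.assoc)
      from sums_Re[OF this] have a: "a sums Re I" by simp
      have iF: "integrable circ (\<lambda>t. norm (F t) powr p)"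
        by (rule integrable_circ_bounded[of _ "B powr p"]) (use B p in \<open>auto intro!: powr_mono2\<close>)
      have ig: "integrable circ (\<lambda>t. norm (g t) powr q)"
        by (rule integrable_circ_bounded[of _ "(\<Sum>n. norm (b n)) powr q"]) (use gB q in \<open>auto intro!: powr_mono2\<close>)
      \<comment> \<open>Balances the two Young terms: both \<open>p\<close>-th and
        \<open>q\<close>-th means, scaled by \<open>L\<close>, become multiples of
        \<open>d powr (- 3)\<close>.\<close>
      define L where "L = d powr (2 - 4 / p)"
      have L: "L > 0" using d by (simp add: L_def)
      have "(2 - 4 / p) * p = 2 * p - 4" using p by (simp add: field_simps)
      then have Lp: "L powr p * d powr (1 - 2 * p) = d powr (- 3)"
        unfolding L_def powr_powr by (simp flip: powr_add)
      have "(2 - 4 / p) * (- q) = 2 * q - 4" using q' p by (simp add: field_simps)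
      then have Lq: "L powr (- q) * d powr (1 - 2 * q) = d powr (- 3)"
        unfolding L_def powr_powr by (simp flip: powr_add)
      \<comment> \<open>The terms of the pairing are nonnegative, so everything beyond
        \<open>m\<close> may be dropped.\<close>
      have "(\<Sum>n<m. a n) \<le> Re I"
        using a a0 by (metis sum_le_suminf finite_lessThan sums_summable sums_unique)
      also have "Re I \<le> norm I" by (rule complex_Re_le_cmod)
      also have "\<dots> \<le> (\<integral>t. norm (F t) * norm (g t) \<partial>circ)"
        unfolding I_def by (rule order_trans[OF integral_norm_bound]) (simp add: norm_mult)
      also have "\<dots> \<le> (\<integral>t. L powr p * norm (F t) powr p / p + L powr (- q) * norm (g t) powr q / q \<partial>circ)"
      proof (rule integral_mono)
        show "integrable circ (\<lambda>t. norm (F t) * norm (g t))"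
        proof (rule integrable_circ_bounded)
          have "0 \<le> B" using B[of 0] norm_ge_zero order_trans by blast
          then show "norm (norm (F t) * norm (g t)) \<le> B * (\<Sum>n. norm (b n))" for t
            by (auto intro!: mult_mono B gB)
        qed measurable
      qed (use iF ig young_scaled[OF p q] L in auto)
      also have "\<dots> = L powr p * (\<integral>t. norm (F t) powr p \<partial>circ) / p + L powr (- q) * (\<integral>t. norm (g t) powr q \<partial>circ) / q"
        using iF ig by simp
      also have "\<dots> \<le> L powr p * (C * d powr (1 - 2 * p)) / p + L powr (- q) * d powr (1 - 2 * q) / q"
      proof (intro add_mono divide_right_mono mult_left_mono)
        show "(\<integral>t. norm (F t) powr p \<partial>circ) \<le> C * d powr (1 - 2 * p)"
          unfolding F_def d_def using CX r \<rho> by blast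
        show "(\<integral>t. norm (g t) powr q \<partial>circ) \<le> d powr (1 - 2 * q)"
          unfolding g_def d_def using integral_sqkern_le[OF r, of 1 q] q by simp
      qed (use p q in auto)
      also have "\<dots> = C * d powr (- 3) / p + d powr (- 3) / q"
        using Lp Lq by (metis mult.left_commute)
      also have "\<dots> \<le> C * d powr (- 3) + d powr (- 3)"
      proof -
        have "x / y \<le> x" if "0 \<le> x" "1 < y" for x y :: real
          using that by (simp add: divide_le_eq mult_le_cancel_left1)
        then show ?thesis using C p q by (intro add_mono) auto
      qed
      also have "\<dots> = (C + 1) * d powr (- 3)" by (simp add: distrib_right)
      finally show ?thesis unfolding a_def .
    qed
    have "(\<Sum>n<m. \<eta> n * (sqsum r n * 1 ^ n) * (real (Suc n) * r ^ n)) \<le> (C + 1) * d powr (- 3)"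
    proof (rule tendsto_upperbound)
      show "((\<lambda>\<rho>. \<Sum>n<m. \<eta> n * (sqsum r n * \<rho> ^ n) * (real (Suc n) * r ^ n))
        \<longlongrightarrow> (\<Sum>n<m. \<eta> n * (sqsum r n * 1 ^ n) * (real (Suc n) * r ^ n))) (at_left (1::real))"
        by (intro tendsto_intros)
      show "\<forall>\<^sub>F \<rho> in at_left 1. (\<Sum>n<m. \<eta> n * (sqsum r n * \<rho> ^ n) * (real (Suc n) * r ^ n)) \<le> (C + 1) * d powr (- 3)"
        using eventually_at_left_real[of 0 1, simplified] by eventually_elim (use sum_le in simp)
    qed simp
    \<comment> \<open>Monotonicity enters here: \<open>n < m = Suc N\<close> gives
      \<open>\<eta> N \<le> \<eta> n\<close>, so one weight bounds the whole block from
      below.\<close>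
    moreover have "(\<Sum>n<m. \<eta> N * (real (Suc n)) ^ 3 / 8) \<le> (\<Sum>n<m. \<eta> n * (sqsum r n * 1 ^ n) * (real (Suc n) * r ^ n))"
    proof (rule sum_mono)
      fix n assume "n \<in> {..<m}"
      then have n: "n < m" by simp
      note ge = sqsum_ge[OF n r_def]
      have "\<eta> N * ((real (Suc n))\<^sup>2 / 4) * (real (Suc n) * (1 / 2)) \<le> \<eta> n * sqsum r n * (real (Suc n) * r ^ n)"
        using n nn ge r by (intro mult_mono mult_left_mono mult_nonneg_nonneg sqsum_nonneg decseqD[OF dec])
          (auto simp: m_def)
      then show "\<eta> N * (real (Suc n)) ^ 3 / 8 \<le> \<eta> n * (sqsum r n * 1 ^ n) * (real (Suc n) * r ^ n)"
        by (simp add: power_numeral_reduce del: of_nat_Suc)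
    qed
    moreover have "real m ^ 4 / 4 \<le> (\<Sum>n<m. (real (Suc n)) ^ 3)"
    proof (induction m)
      case (Suc k)
      have "real (Suc k) ^ 4 / 4 \<le> real k ^ 4 / 4 + real (Suc k) ^ 3"
        by (simp add: power_numeral_reduce algebra_simps)
      then show ?case using Suc by simp
    qed simp
    then have "\<eta> N / 8 * (real m ^ 4 / 4) \<le> \<eta> N / 8 * (\<Sum>n<m. (real (Suc n)) ^ 3)"
      using nn by (intro mult_left_mono) auto
    ultimately have "\<eta> N / 8 * (real m ^ 4 / 4) \<le> (C + 1) * d powr (- 3)"
      by (simp add: sum_distrib_left sum_divide_distrib)
    also have "d powr (- 3) = 8 * real m ^ 3"
    proof -
      have "d powr (- 3) = 1 / d ^ 3" using d(1) by (simp add: powr_minus_divide powr_numeral)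
      then show ?thesis by (simp add: d(2) power_divide power_mult_distrib)
    qed
    finally have "\<eta> N * (real m * real m ^ 3) \<le> 256 * (C + 1) * real m ^ 3"
      by (simp add: power_numeral_reduce algebra_simps)
    then have "\<eta> N * real m \<le> 256 * (C + 1)"
      using m by (simp flip: mult.assoc)
    then show ?thesis using m by (simp add: pos_le_divide_eq m_def)
  qed
  then show ?thesis
    unfolding bigo_inverse_nat_iff using C nn by (intro exI[of _ "256 * (C + 1)"]) auto
qed

section \<open>The Rudin--Shapiro weights\<close>

text \<open>The sign is \<open>- 1\<close> to the number of adjacent pairs 11 in the binary
  expansion: for odd \<open>n\<close>, the parity of \<open>n div 2\<close> tells whether the last
  two digits are such a pair.\<close>

fun rudin_shapiro :: "nat \<Rightarrow> real" where
  "rudin_shapiro n = (if n = 0 then 1 else if even n then rudin_shapiro (n div 2)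
     else (- 1) ^ (n div 2) * rudin_shapiro (n div 2))"

declare rudin_shapiro.simps [simp del]

lemma rudin_shapiro_double: "rudin_shapiro (2 * n) = rudin_shapiro n"
  by (cases "n = 0") (simp_all add: rudin_shapiro.simps[of "2 * n"])

lemma rudin_shapiro_Suc_double: "rudin_shapiro (Suc (2 * n)) = (- 1) ^ n * rudin_shapiro n"
  by (simp add: rudin_shapiro.simps[of "Suc (2 * n)"])

lemma abs_rudin_shapiro: "\<bar>rudin_shapiro n\<bar> = 1"
proof (induction n rule: less_induct)
  case (less n)
  then show ?case by (subst rudin_shapiro.simps) (auto simp: abs_mult power_abs)
qed

definition rudin_shapiro_poly :: "nat \<Rightarrow> complex \<Rightarrow> complex" where
  "rudin_shapiro_poly k z = (\<Sum>n<2 ^ k. of_real (rudin_shapiro n) * z ^ n)"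

lemma sum_lessThan_double:
  fixes f :: "nat \<Rightarrow> 'a :: comm_monoid_add"
  shows "(\<Sum>n<2 * m. f n) = (\<Sum>n<m. f (2 * n)) + (\<Sum>n<m. f (Suc (2 * n)))"
  by (induction m) (simp_all add: add_ac)

lemma rudin_shapiro_poly_Suc: "rudin_shapiro_poly (Suc k) z = rudin_shapiro_poly k (z\<^sup>2) + z * rudin_shapiro_poly k (- (z\<^sup>2))"
proof -
  have "rudin_shapiro_poly (Suc k) z = (\<Sum>n<2 ^ k. of_real (rudin_shapiro (2 * n)) * z ^ (2 * n))
      + (\<Sum>n<2 ^ k. of_real (rudin_shapiro (Suc (2 * n))) * z ^ Suc (2 * n))"
    unfolding rudin_shapiro_poly_def power_Suc[of "2 :: nat"] by (rule sum_lessThan_double)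
  also have "(\<Sum>n<2 ^ k. of_real (rudin_shapiro (Suc (2 * n))) * z ^ Suc (2 * n)) = z * rudin_shapiro_poly k (- (z\<^sup>2))"
    unfolding rudin_shapiro_poly_def sum_distrib_left
    by (intro sum.cong) (auto simp: rudin_shapiro_Suc_double power_minus[of "z\<^sup>2"] power_mult)
  also have "(\<Sum>n<2 ^ k. of_real (rudin_shapiro (2 * n)) * z ^ (2 * n)) = rudin_shapiro_poly k (z\<^sup>2)"
    unfolding rudin_shapiro_poly_def by (simp add: rudin_shapiro_double power_mult)
  finally show ?thesis .
qed

text \<open>\<open>z\<close> and \<open>- z\<close> have the same square, so the recursion gives the
  values \<open>u + z * v\<close> and \<open>u - z * v\<close>, and the parallelogram law doubles
  the sum at each step. The value at \<open>- z\<close> plays the role of Shapiro's companion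
  polynomial.\<close>

lemma rudin_shapiro_poly_square_sum:
  assumes "norm z = 1"
  shows "(norm (rudin_shapiro_poly k z))\<^sup>2 + (norm (rudin_shapiro_poly k (- z)))\<^sup>2 = 2 * 2 ^ k"
  using assms
proof (induction k arbitrary: z)
  case 0
  then show ?case by (simp add: rudin_shapiro_poly_def rudin_shapiro.simps[of 0])
next
  case (Suc k)
  define u where "u = rudin_shapiro_poly k (z\<^sup>2)"
  define v where "v = rudin_shapiro_poly k (- (z\<^sup>2))"
  have par: "(norm (u + z * v))\<^sup>2 + (norm (u - z * v))\<^sup>2 = 2 * ((norm u)\<^sup>2 + (norm (z * v))\<^sup>2)"
    unfolding cmod_power2 by (simp add: power2_eq_square algebra_simps)
  have "(norm u)\<^sup>2 + (norm v)\<^sup>2 = 2 * 2 ^ k"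
    unfolding u_def v_def by (rule Suc.IH) (simp add: norm_power Suc.prems)
  with par have "(norm (u + z * v))\<^sup>2 + (norm (u - z * v))\<^sup>2 = 2 * 2 ^ Suc k"
    by (simp add: norm_mult Suc.prems)
  then show ?case by (simp add: rudin_shapiro_poly_Suc u_def v_def)
qed

lemma norm_rudin_shapiro_poly_le:
  assumes "norm z = 1"
  shows "norm (rudin_shapiro_poly k z) \<le> (2 * 2 ^ k) powr (1 / 2)"
proof -
  have "(norm (rudin_shapiro_poly k z))\<^sup>2 \<le> 2 * 2 ^ k"
    using rudin_shapiro_poly_square_sum[OF assms, of k] zero_le_power2[of "norm (rudin_shapiro_poly k (- z))"] by linarith
  then have "norm (rudin_shapiro_poly k z) \<le> sqrt (2 * 2 ^ k)" by (rule real_le_rsqrt)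
  then show ?thesis by (simp add: powr_half_sqrt)
qed

section \<open>Failure of boundedness below exponent 2\<close>

definition rudin_shapiro_weight :: "nat \<Rightarrow> complex" where
  "rudin_shapiro_weight n = of_real (rudin_shapiro n / real (Suc n))"

lemma rudin_shapiro_weight_bigo: "rudin_shapiro_weight \<in> O(\<lambda>n. 1 / of_nat n)"
  unfolding bigo_inverse_nat_iff
  by (intro exI[of _ 1]) (simp add: rudin_shapiro_weight_def norm_divide abs_rudin_shapiro del: of_nat_Suc)

text \<open>Above the level \<open>L\<close>, the factor \<open>(x / L) powr (p - 1)\<close> is at
  least 1. This bounds a first mean by a \<open>p\<close>-th mean down to \<open>p = 1\<close>,
  where \<open>young_scaled\<close> has no conjugate exponent.\<close>

lemma real_le_powr_split:
  fixes x L p :: real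
  assumes "0 \<le> x" "0 < L" "1 \<le> p"
  shows "x \<le> L + L powr (1 - p) * x powr p"
proof (cases "x \<le> L")
  case True
  moreover have "0 \<le> L powr (1 - p) * x powr p" by simp
  ultimately show ?thesis by linarith
next
  case False
  then have x: "L < x" by simp
  have "x = x * (L powr (1 - p) * L powr (p - 1))"
    using assms by (simp flip: powr_add)
  also have "\<dots> \<le> x * (L powr (1 - p) * x powr (p - 1))"
    using assms x by (intro mult_left_mono powr_mono2) auto
  also have "\<dots> = L powr (1 - p) * x powr p"
    using assms x powr_add[of x 1 "p - 1"] by simp
  finally show ?thesis using assms by simp
qed

lemma rudin_shapiro_weight_not_bounded:
  assumes p: "1 \<le> p" "p < 2"
  shows "\<not> rhaly_bounded p rudin_shapiro_weight"
proof
  assume bdd: "rhaly_bounded p rudin_shapiro_weight"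
  obtain C where C: "C > 0" and CX: "\<forall>r \<rho>. 0 < r \<longrightarrow> r < 1 \<longrightarrow> 0 < \<rho> \<longrightarrow> \<rho> < 1 \<longrightarrow>
    (\<integral>t. norm (rhaly rudin_shapiro_weight (sqkern r) (of_real \<rho> * cis t)) powr p \<partial>circ) \<le> C * (1 - r) powr (1 - 2 * p)"
    using rhaly_bounded_sqkern[OF bdd p(1)] by blast
  have main: "(2 * 2 ^ k) powr (1 / p - 1 / 2) \<le> 32 * (1 + C)" for k :: nat
  proof -
    define m :: nat where "m = 2 ^ k"
    have m: "real m \<ge> 1" by (simp add: m_def)
    define r where "r = 1 - 1 / (2 * real m)"
    have r: "0 < r" "r < 1" using m by (auto simp: r_def field_simps)
    define d where "d = 1 - r"
    have d: "0 < d" "d = 1 / (2 * real m)" using r by (auto simp: d_def r_def)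
    have def: "rhaly_defined rudin_shapiro_weight (sqkern r)"
      using bdd sqkern_hardy(1)[OF r p(1)] by (simp add: rhaly_bounded_def)
    define g where "g t = (\<Sum>n<m. of_real (rudin_shapiro n) * cis (real n * t))" for t
    have g_eq: "g t = rudin_shapiro_poly k (cis t)" for t
      by (simp add: g_def rudin_shapiro_poly_def m_def Complex.DeMoivre)
    define B where "B = (2 * real m) powr (1 / 2)"
    have gm [measurable]: "g \<in> borel_measurable borel" unfolding g_def by measurable
    have gB: "norm (g t) \<le> B" for t
      unfolding g_eq B_def using norm_rudin_shapiro_poly_le[of "cis t" k] by (simp add: m_def)
    \<comment> \<open>The bound for the \<open>p\<close>-norm of the test function. Taken as the
      splitting level, it bounds the first mean of the image by \<open>(1 + C) * L\<close>.\<close>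
    define L where "L = d powr ((1 - 2 * p) / p)"
    have L: "L > 0" using d by (simp add: L_def)
    have sum_le: "(\<Sum>n<m. sqsum r n * \<rho> ^ n / real (Suc n)) \<le> B * ((1 + C) * L)"
      if \<rho>: "0 < \<rho>" "\<rho> < 1" for \<rho>
    proof -
      define F where "F t = rhaly rudin_shapiro_weight (sqkern r) (of_real \<rho> * cis t)" for t
      have Fm [measurable]: "F \<in> borel_measurable borel"
        unfolding F_def by (rule measurable_rhaly_circle(1)[OF def \<rho>])
      obtain B' where B': "\<And>t. norm (F t) \<le> B'"
        unfolding F_def using measurable_rhaly_circle(2)[OF def \<rho>] by blast
      have iF: "integrable circ (\<lambda>t. norm (F t) powr p)"
        by (rule integrable_circ_bounded[of _ "B' powr p"]) (use B' p in \<open>auto intro!: powr_mono2\<close>)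
      have iF1: "integrable circ (\<lambda>t. norm (F t))"
        by (rule integrable_circ_bounded[of _ B']) (use B' in auto)
      define I where "I = (\<integral>t. F t * cnj (g t) \<partial>circ)"
      have fg: "fourier g n = (if n < m then of_real (rudin_shapiro n) else 0)" for n
        unfolding g_def by (rule fourier_polynomial)
      have "(\<lambda>n. rudin_shapiro_weight n * of_real (sqsum r n * \<rho> ^ n) * cnj (fourier g n)) sums I"
        unfolding I_def F_def by (rule rhaly_sqkern_pairing[OF def r \<rho> gm gB])
      moreover have "rudin_shapiro_weight n * of_real (sqsum r n * \<rho> ^ n) * cnj (fourier g n)
         = (if n < m then complex_of_real (sqsum r n * \<rho> ^ n / real (Suc n)) else 0)" for n
      proof -
        \<comment> \<open>The sign in the weight meets the same sign in \<open>g\<close>, so the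
          pairing has no cancellation.\<close>
        have "rudin_shapiro n * rudin_shapiro n = 1"
          using abs_rudin_shapiro[of n] by (metis abs_mult_self_eq mult_1)
        then have "rudin_shapiro n / real (Suc n) * (sqsum r n * \<rho> ^ n) * rudin_shapiro n = sqsum r n * \<rho> ^ n / real (Suc n)"
          by (simp add: field_simps del: of_nat_Suc)
        then have e2: "complex_of_real (rudin_shapiro n / real (Suc n) * (sqsum r n * \<rho> ^ n) * rudin_shapiro n) = complex_of_real (sqsum r n * \<rho> ^ n / real (Suc n))"
          by (rule arg_cong)
        have e1: "rudin_shapiro_weight n * of_real (sqsum r n * \<rho> ^ n) * cnj (fourier g n)
          = complex_of_real (rudin_shapiro n / real (Suc n) * (sqsum r n * \<rho> ^ n) * rudin_shapiro n)" if "n < m"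
          unfolding rudin_shapiro_weight_def fg if_P[OF that] complex_cnj_complex_of_real of_real_mult ..
        show ?thesis
        proof (cases "n < m")
          case True
          then show ?thesis by (simp only: e1 e2 if_True)
        qed (simp add: fg)
      qed
      ultimately have "(\<lambda>n. if n < m then complex_of_real (sqsum r n * \<rho> ^ n / real (Suc n)) else 0) sums I"
        by simp
      moreover have "(\<lambda>n. if n < m then complex_of_real (sqsum r n * \<rho> ^ n / real (Suc n)) else 0) sums
          (\<Sum>n<m. complex_of_real (sqsum r n * \<rho> ^ n / real (Suc n)))"
        using sums_If_finite_set[of "{..<m}" "\<lambda>n. complex_of_real (sqsum r n * \<rho> ^ n / real (Suc n))"] by simp
      ultimately have "complex_of_real (\<Sum>n<m. sqsum r n * \<rho> ^ n / real (Suc n)) = I"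
        using sums_unique2 by (simp only: of_real_sum) blast
      then have "(\<Sum>n<m. sqsum r n * \<rho> ^ n / real (Suc n)) \<le> norm I"
        by (metis norm_of_real abs_ge_self)
      also have "\<dots> \<le> (\<integral>t. norm (F t) * norm (g t) \<partial>circ)"
        unfolding I_def by (rule order_trans[OF integral_norm_bound]) (simp add: norm_mult)
      also have "\<dots> \<le> (\<integral>t. norm (F t) * B \<partial>circ)"
      proof (rule integral_mono)
        show "integrable circ (\<lambda>t. norm (F t) * norm (g t))"
        proof (rule integrable_circ_bounded)
          have "0 \<le> B'" using B'[of 0] norm_ge_zero order_trans by blast
          then show "norm (norm (F t) * norm (g t)) \<le> B' * B" for t
            by (auto intro!: mult_mono B' gB)
        qed measurable
      qed (use iF1 gB in \<open>auto intro!: mult_left_mono\<close>)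
      also have "\<dots> = B * (\<integral>t. norm (F t) \<partial>circ)" by simp
      also have "\<dots> \<le> B * ((1 + C) * L)"
      proof (rule mult_left_mono)
        have "(\<integral>t. norm (F t) \<partial>circ) \<le> (\<integral>t. L + L powr (1 - p) * norm (F t) powr p \<partial>circ)"
          using iF iF1 L p by (intro integral_mono real_le_powr_split) auto
        also have "\<dots> = L + L powr (1 - p) * (\<integral>t. norm (F t) powr p \<partial>circ)"
          using iF by simp
        also have "\<dots> \<le> L + L powr (1 - p) * (C * d powr (1 - 2 * p))"
          unfolding F_def d_def using CX r \<rho> by (intro add_left_mono mult_left_mono) auto
        also have "d powr (1 - 2 * p) = L powr p"
          using p by (simp add: L_def powr_powr)
        also have "L + L powr (1 - p) * (C * L powr p) = (1 + C) * L"
          using L powr_add[of L "1 - p" p] by (simp add: algebra_simps)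
        finally show "(\<integral>t. norm (F t) \<partial>circ) \<le> (1 + C) * L" .
      qed (simp add: B_def)
      finally show ?thesis .
    qed
    have "(\<Sum>n<m. sqsum r n * 1 ^ n / real (Suc n)) \<le> B * ((1 + C) * L)"
    proof (rule tendsto_upperbound)
      show "((\<lambda>\<rho>. \<Sum>n<m. sqsum r n * \<rho> ^ n / real (Suc n))
        \<longlongrightarrow> (\<Sum>n<m. sqsum r n * 1 ^ n / real (Suc n))) (at_left (1::real))"
        by (intro tendsto_intros) (simp del: of_nat_Suc)
      show "\<forall>\<^sub>F \<rho> in at_left 1. (\<Sum>n<m. sqsum r n * \<rho> ^ n / real (Suc n)) \<le> B * ((1 + C) * L)"
        using eventually_at_left_real[of 0 1, simplified] by eventually_elim (use sum_le in simp)
    qed simp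
    moreover have "(\<Sum>n<m. real (Suc n) / 4) \<le> (\<Sum>n<m. sqsum r n * 1 ^ n / real (Suc n))"
    proof (rule sum_mono)
      fix n assume "n \<in> {..<m}"
      then have "(real (Suc n))\<^sup>2 / 4 \<le> sqsum r n" by (intro sqsum_ge(2)[OF _ r_def]) simp
      then have "(real (Suc n))\<^sup>2 / 4 / real (Suc n) \<le> sqsum r n / real (Suc n)"
        by (rule divide_right_mono) simp
      then show "real (Suc n) / 4 \<le> sqsum r n * 1 ^ n / real (Suc n)"
        by (simp add: power2_eq_square del: of_nat_Suc)
    qed
    moreover have "(real m)\<^sup>2 / 8 \<le> (\<Sum>n<m. real (Suc n) / 4)"
      by (induction m) (simp_all add: power2_eq_square field_simps)
    ultimately have "(real m)\<^sup>2 / 8 \<le> B * ((1 + C) * L)" by linarith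
    \<comment> \<open>As \<open>M = 1 / d\<close>, all quantities become powers of \<open>M\<close>,
      and 32 comes from \<open>m ^ 2 / 8 = M ^ 2 / 32\<close>. The factor
      \<open>M powr (1 / p - 5 / 2)\<close> then cancels all powers on the right.\<close>
    moreover define M where "M = 2 * real m"
    have M: "M > 0" using m by (simp add: M_def)
    have LM: "L = M powr (2 - 1 / p)"
    proof -
      have "(1 - 2 * p) / p = - (2 - 1 / p)" using p by (simp add: field_simps)
      then have "L = 1 / (M powr (- (2 - 1 / p)))"
        unfolding L_def d(2) M_def using m by (simp only: powr_divide powr_one_eq_one)
      then show ?thesis unfolding powr_minus_divide by simp
    qed
    ultimately have "M powr 2 \<le> 32 * (1 + C) * (M powr (1 / 2) * M powr (2 - 1 / p))"
      by (simp add: M_def B_def powr_numeral power_mult_distrib algebra_simps)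
    then have "M powr 2 * M powr (1 / p - 5 / 2) \<le> 32 * (1 + C) * (M powr (1 / 2) * M powr (2 - 1 / p)) * M powr (1 / p - 5 / 2)"
      by (rule mult_right_mono) simp
    also have "\<dots> = 32 * (1 + C) * M powr (1 / 2 + (2 - 1 / p) + (1 / p - 5 / 2))"
      by (simp only: powr_add mult.assoc)
    also have "\<dots> = 32 * (1 + C)" using M by simp
    also have "M powr 2 * M powr (1 / p - 5 / 2) = M powr (1 / p - 1 / 2)"
      by (simp flip: powr_add)
    finally show ?thesis by (simp add: M_def m_def)
  qed
  \<comment> \<open>Positive because \<open>p < 2\<close>, so the left-hand side of
    \<open>main\<close> is unbounded in \<open>k\<close>.\<close>
  define e where "e = 1 / p - 1 / 2"
  have e: "e > 0" using p by (simp add: e_def field_simps)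
  then have "1 < 2 powr e" by simp
  then obtain k where "32 * (1 + C) < (2 powr e) ^ k"
    using real_arch_pow by blast
  also have "(2 powr e) ^ k = (2 ^ k) powr e"
    by (simp add: powr_power powr_powr mult.commute flip: powr_realpow)
  also have "\<dots> \<le> (2 * 2 ^ k) powr e"
    using e by (intro powr_mono2) auto
  also have "\<dots> \<le> 32 * (1 + C)" unfolding e_def by (rule main)
  finally show False by simp
qed

section \<open>Decreasing weights\<close>

text \<open>Summation by parts: \<open>T b\<close> equals \<open>v a * z ^ a\<close> minus the
  increments \<open>(v n - v (Suc n)) * z ^ Suc n\<close>, whose moduli telescope. The bound
  \<open>2 * v a - v b\<close> leaves room for the boundary term of size \<open>v b\<close>.\<close>

lemma abel_sum_bound:
  fixes v :: "nat \<Rightarrow> real" and z :: complex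
  assumes dec: "decseq v" and nn: "\<And>n. 0 \<le> v n" and z: "norm z = 1" and ab: "a \<le> b"
  shows "norm (\<Sum>n\<in>{a..<b}. of_real (v n) * z ^ n) * norm (1 - z) \<le> 2 * v a"
proof -
  define T where "T b = (1 - z) * (\<Sum>n\<in>{a..<b}. of_real (v n) * z ^ n) + of_real (v b) * z ^ b" for b
  have "norm (T b) \<le> 2 * v a - v b"
    using ab
  proof (induction b rule: dec_induct)
    case base
    then show ?case using nn z by (simp add: T_def norm_mult norm_power)
  next
    case (step n)
    have "T (Suc n) = T n - of_real (v n - v (Suc n)) * z ^ Suc n"
      using step by (simp add: T_def algebra_simps)
    also have "norm \<dots> \<le> norm (T n) + (v n - v (Suc n))"
      by (rule order_trans[OF norm_triangle_ineq4])
         (use decseq_SucD[OF dec, of n] z in \<open>simp add: norm_mult norm_power del: of_real_diff power_Suc\<close>)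
    finally show ?case using step.IH by simp
  qed
  moreover have "norm ((1 - z) * (\<Sum>n\<in>{a..<b}. of_real (v n) * z ^ n)) \<le> norm (T b) + norm (of_real (v b) * z ^ b)"
    using norm_triangle_ineq4[of "T b" "of_real (v b) * z ^ b"] by (simp add: T_def)
  moreover have "norm (of_real (v b) * z ^ b) = v b"
    using nn z by (simp add: norm_mult norm_power)
  ultimately show ?thesis by (simp add: norm_mult mult.commute)
qed

text \<open>Near 0 the sum is cut where \<open>n\<close> reaches \<open>1 / cdist t\<close>: moduli
  are added before the cut and summation by parts is used after it, with constants 4 and 6. Adding
  moduli produces a logarithm of \<open>1 / ((k + 1) * cdist t)\<close>, which a quarter power
  majorises.\<close>

lemma norm_monotone_sum_le_kern:
  assumes dec: "decseq v" and nn: "\<And>n. 0 \<le> v n" and K: "0 < K" "\<And>n. v n \<le> K / real (Suc n)"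
    and t: "0 < t" "t < 2 * pi"
  shows "norm (of_nat (Suc k) * (\<Sum>n\<in>{k..<N}. of_real (v n) * cis (- (real n * t))))
           \<le> (10 * K) * kern (Suc k) (cdist t)"
proof (rule norm_le_kern[OF t, where L = K])
  define d where "d = cdist t"
  have d: "0 < d" using t by (simp add: d_def cdist_def)
  define z where "z = cis (- t)"
  have z: "norm z = 1" by (simp add: z_def)
  have z1: "d / 3 \<le> norm (1 - z)" unfolding d_def z_def by (rule norm_one_minus_cis_ge[OF t])
  have cz: "cis (- (real n * t)) = z ^ n" for n by (simp only: z_def Complex.DeMoivre mult_minus_right)
  define W where "W a b = (\<Sum>n\<in>{a..<b}. of_real (v n) * cis (- (real n * t)))" for a b
  have abel: "norm (W a b) * norm (1 - z) \<le> 2 * v a" for a b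
  proof (cases "a \<le> b")
    case True
    then show ?thesis unfolding W_def cz by (rule abel_sum_bound[OF dec nn z])
  qed (use nn in \<open>simp add: W_def\<close>)
  have "norm (of_nat (Suc k) * W k N) * norm (1 - z) = real (Suc k) * (norm (W k N) * norm (1 - z))"
    by (simp add: norm_mult del: of_nat_Suc)
  also have "\<dots> \<le> real (Suc k) * (2 * v k)"
    by (intro mult_left_mono abel) auto
  also have "\<dots> \<le> 2 * K" using K(2)[of k] by (simp add: field_simps)
  finally show "norm (of_nat (Suc k) * (\<Sum>n\<in>{k..<N}. of_real (v n) * cis (- (real n * t)))) * norm (1 - cis (- t)) \<le> 2 * K"
    by (simp add: W_def z_def)
  assume "real (Suc k) * cdist t < 1"
  then have kd: "real (Suc k) * d < 1" by (simp add: d_def)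
  define J where "J = (LEAST j. 1 \<le> real (Suc j) * d)"
  have "\<exists>j. 1 \<le> real (Suc j) * d"
  proof -
    obtain j :: nat where "1 / d < real j" using reals_Archimedean2 by blast
    then have "1 \<le> real (Suc j) * d" using d by (simp add: field_simps)
    then show ?thesis by blast
  qed
  then have J1: "1 \<le> real (Suc J) * d" unfolding J_def by (rule LeastI_ex)
  have J2: "real (Suc n) * d < 1" if "n < J" for n
    using not_less_Least[of n "\<lambda>j. 1 \<le> real (Suc j) * d"] that by (simp add: J_def)
  have kJ: "k < J"
  proof (rule ccontr)
    assume "\<not> k < J"
    then have "real (Suc J) * d \<le> real (Suc k) * d" using d by (intro mult_right_mono) auto
    then show False using kd J1 by simp
  qed
  \<comment> \<open>The power standing in for the logarithm; \<open>w \<ge> 1\<close> lets it absorb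
    the bounded tail as well.\<close>
  define w where "w = real (Suc k) powr (- 1 / 4) * d powr (- 1 / 4)"
  have w1: "1 \<le> w"
  proof -
    have "w = (real (Suc k) * d) powr (- 1 / 4)" using d by (simp add: w_def powr_mult)
    moreover have "1 \<le> (real (Suc k) * d) powr (- 1 / 4)"
      using kd d powr_mono2'[of "- 1 / 4" "real (Suc k) * d" 1] by simp
    ultimately show ?thesis by simp
  qed
  have tail: "norm (W a N) \<le> 6 * K * w" if "J \<le> a" for a
  proof -
    have "norm (W a N) * (d / 3) \<le> norm (W a N) * norm (1 - z)"
      by (intro mult_left_mono z1) auto
    also have "\<dots> \<le> 2 * v a" by (rule abel)
    also have "\<dots> \<le> 2 * v J" using decseqD[OF dec that] by simp
    also have "\<dots> \<le> 2 * (K / real (Suc J))" using K(2)[of J] by simp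
    also have "\<dots> \<le> 2 * (K * d)"
      using J1 K(1) mult_left_mono[OF J1, of K] by (simp add: field_simps)
    finally have "norm (W a N) \<le> 6 * K" using d by (simp add: field_simps)
    also have "\<dots> \<le> 6 * K * w" using w1 K(1) by simp
    finally show ?thesis .
  qed
  have head: "norm (W k b) \<le> 4 * K * w" if "b \<le> J" for b
  proof -
    have "norm (W k b) \<le> (\<Sum>n\<in>{k..<b}. norm (of_real (v n) * cis (- (real n * t))))"
      unfolding W_def by (rule norm_sum)
    also have "\<dots> = (\<Sum>n\<in>{k..<b}. v n)" using nn by (simp add: norm_mult)
    also have "\<dots> \<le> (\<Sum>n\<in>{k..<b}. K * real (Suc k) powr (- 1 / 4) * real (Suc n) powr (- 3 / 4))"
    proof (rule sum_mono)
      fix n assume n: "n \<in> {k..<b}"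
      \<comment> \<open>Freezing a quarter power at \<open>k\<close> leaves
        \<open>(n + 1) powr (- 3 / 4)\<close>, whose sum up to \<open>1 / d\<close> is of order
        \<open>d powr (- 1 / 4)\<close>.\<close>
      have "1 / real (Suc n) = real (Suc n) powr (- 1 / 4) * real (Suc n) powr (- 3 / 4)"
        by (simp add: powr_minus_divide flip: powr_add)
      also have "\<dots> \<le> real (Suc k) powr (- 1 / 4) * real (Suc n) powr (- 3 / 4)"
        using n by (intro mult_right_mono powr_mono2') auto
      finally have "K * (1 / real (Suc n)) \<le> K * (real (Suc k) powr (- 1 / 4) * real (Suc n) powr (- 3 / 4))"
        using K(1) by (intro mult_left_mono) auto
      then show "v n \<le> K * real (Suc k) powr (- 1 / 4) * real (Suc n) powr (- 3 / 4)"
        using K(2)[of n] by (simp add: mult.assoc del: of_nat_Suc)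
    qed
    also have "\<dots> = K * real (Suc k) powr (- 1 / 4) * (\<Sum>n\<in>{k..<b}. real (Suc n) powr (- 3 / 4))"
      by (simp only: sum_distrib_left)
    also have "(\<Sum>n\<in>{k..<b}. real (Suc n) powr (- 3 / 4)) = (\<Sum>n\<in>{k..<b}. if real (Suc n) * d < 1 then real (Suc n) powr (- 3 / 4) else 0)"
      using that by (intro sum.cong refl) (simp add: J2 del: of_nat_Suc)
    also have "\<dots> \<le> (\<Sum>n<b. if real (Suc n) * d < 1 then real (Suc n) powr (- 3 / 4) else 0)"
      by (intro sum_mono2) auto
    also have "\<dots> \<le> 4 * d powr (- 1 / 4)"
      by (rule sum_powr_quarter_below_le[OF d])
    finally show ?thesis using K(1) by (simp add: w_def mult_left_mono mult_ac)
  qed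
  have "norm (W k N) \<le> 10 * K * w"
  proof (cases "N \<le> J")
    case True
    have "4 * K * w \<le> 10 * K * w" using K(1) w1 by (intro mult_right_mono) auto
    then show ?thesis using head[OF True] by simp
  next
    case False
    then have "W k N = W k J + W J N"
      unfolding W_def using kJ by (intro sum.atLeastLessThan_concat[symmetric]) auto
    then have "norm (W k N) \<le> norm (W k J) + norm (W J N)" by (simp add: norm_triangle_ineq)
    then show ?thesis using head[of J] tail[of J] by simp
  qed
  then have "real (Suc k) * norm (W k N) \<le> real (Suc k) * (10 * K * w)"
    by (intro mult_left_mono) auto
  also have "\<dots> = 10 * K * (real (Suc k) powr (3 / 4) * d powr (- 1 / 4))"
    using powr_add[of "real (Suc k)" 1 "- 1 / 4"] by (simp add: w_def del: of_nat_Suc)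
  finally show "norm (of_nat (Suc k) * (\<Sum>n\<in>{k..<N}. of_real (v n) * cis (- (real n * t))))
      \<le> 10 * K * (real (Suc k) powr (3 / 4) * cdist t powr (- 1 / 4))"
    by (simp add: W_def d_def norm_mult del: of_nat_Suc)
qed (use K in simp)

text \<open>The polynomial on the left is the adjoint of the (truncated) Rhaly operator applied to \<open>g\<close>;
  its coefficients are integrals of \<open>g\<close> against tails of a monotone trigonometric series.\<close>

lemma adjoint_polynomial_bound:
  assumes q: "2 \<le> q" and K: "0 < K"
  shows "\<exists>C>0. \<forall>g B N v. g \<in> borel_measurable borel \<longrightarrow> (\<forall>t. norm (g t) \<le> B) \<longrightarrow>
    (\<forall>k. decseq (v k) \<and> (\<forall>n. 0 \<le> v k n \<and> v k n \<le> K / real (Suc n))) \<longrightarrow>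
    (\<integral>t. norm (\<Sum>k<N. (\<Sum>n\<in>{k..<N}. of_real (v k n) * fourier g n) * cis (real k * t)) powr q \<partial>circ)
      \<le> C * (\<integral>t. norm (g t) powr q \<partial>circ)"
proof -
  obtain C1 where C1: "C1 > 0" and hl:
    "\<forall>c N. (\<integral>t. norm (\<Sum>n<N. c n * cis (real n * t)) powr q \<partial>circ)
       \<le> C1 * (\<Sum>n<N. real (Suc n) powr (q - 2) * norm (c n) powr q)"
    using hardy_littlewood_polynomial[OF q] by blast
  obtain C2 where C2: "C2 > 0" and schur:
    "\<forall>g B u N. g \<in> borel_measurable borel \<longrightarrow> (\<forall>t. 0 \<le> g t \<and> g t \<le> B) \<longrightarrow>
    (\<forall>n. 0 \<le> u n \<and> ennreal (u n) \<le> (\<integral>\<^sup>+t. ennreal (g t * kern (Suc n) (cdist t)) \<partial>circ)) \<longrightarrow>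
    (\<Sum>n<N. u n powr q / (real (Suc n))\<^sup>2) \<le> C2 * (\<integral>t. g t powr q \<partial>circ)"
    using schur_kern[OF q] by blast
  define K' where "K' = 10 * K"
  have K': "K' > 0" using K by (simp add: K'_def)
  show ?thesis
  proof (intro exI[of _ "C1 * (K' powr q * C2)"] conjI allI impI)
    show "0 < C1 * (K' powr q * C2)" using C1 C2 K' by simp
    fix g :: "real \<Rightarrow> complex" and B :: real and N :: nat and v :: "nat \<Rightarrow> nat \<Rightarrow> real"
    assume g [measurable]: "g \<in> borel_measurable borel" and "\<forall>t. norm (g t) \<le> B"
      and v: "\<forall>k. decseq (v k) \<and> (\<forall>n. 0 \<le> v k n \<and> v k n \<le> K / real (Suc n))"
    then have B: "norm (g t) \<le> B" for t by simp
    define E where "E k = (\<Sum>n\<in>{k..<N}. of_real (v k n) * fourier g n)" for k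
    \<comment> \<open>With the factor \<open>k + 1\<close> the tail has the size of
      \<open>kern (Suc k)\<close>. The same factor turns the weight
      \<open>(k + 1) powr (q - 2)\<close> of the coefficient inequality into the
      \<open>1 / (k + 1)\<^sup>2\<close> of Schur's test.\<close>
    define W where "W k t = of_nat (Suc k) * (\<Sum>n\<in>{k..<N}. of_real (v k n) * cis (- (real n * t)))" for k t
    have [measurable]: "W k \<in> borel_measurable borel" for k unfolding W_def by measurable
    have EW: "of_nat (Suc k) * E k = (\<integral>t. g t * W k t \<partial>circ)" for k
    proof -
      have i: "integrable circ (\<lambda>t. g t * cis (- (real n * t)))" for n
        by (rule integrable_circ_bounded[of _ B]) (auto simp: norm_mult B)
      have "E k = (\<Sum>n\<in>{k..<N}. \<integral>t. of_real (v k n) * (g t * cis (- (real n * t))) \<partial>circ)"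
        by (simp add: E_def fourier_def)
      also have "\<dots> = (\<integral>t. (\<Sum>n\<in>{k..<N}. of_real (v k n) * (g t * cis (- (real n * t)))) \<partial>circ)"
        by (rule Bochner_Integration.integral_sum[symmetric]) (intro integrable_mult_right i)
      finally have "of_nat (Suc k) * E k = (\<integral>t. of_nat (Suc k) * (\<Sum>n\<in>{k..<N}. of_real (v k n) * (g t * cis (- (real n * t)))) \<partial>circ)"
        by (simp del: of_nat_Suc)
      then show ?thesis by (simp add: W_def sum_distrib_left mult_ac del: of_nat_Suc)
    qed
    define u where "u k = norm (of_nat (Suc k) * E k) / K'" for k
    have "ennreal (u k) \<le> (\<integral>\<^sup>+t. ennreal (norm (g t) * kern (Suc k) (cdist t)) \<partial>circ)" for k
      unfolding u_def EW
    proof (rule norm_integral_kern_le)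
      show "norm (W k t) \<le> K' * kern (Suc k) (cdist t)" if "0 < t" "t < 2 * pi" for t
        unfolding W_def K'_def by (rule norm_monotone_sum_le_kern) (use v K that in auto)
    qed (use K' in auto)
    then have le: "(\<Sum>k<N. u k powr q / (real (Suc k))\<^sup>2) \<le> C2 * (\<integral>t. norm (g t) powr q \<partial>circ)"
      using B K' by (intro schur[rule_format, of "\<lambda>t. norm (g t)"]) (auto simp: u_def)
    have "real (Suc k) powr (q - 2) * norm (E k) powr q = K' powr q * (u k powr q / (real (Suc k))\<^sup>2)" for k
    proof -
      have "u k powr q = real (Suc k) powr q * norm (E k) powr q / K' powr q"
        using K' by (simp add: u_def norm_mult powr_mult powr_divide del: of_nat_Suc)
      then show ?thesis using K' by (simp add: powr_diff powr_numeral del: of_nat_Suc)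
    qed
    then have "C1 * (\<Sum>k<N. real (Suc k) powr (q - 2) * norm (E k) powr q) = C1 * (K' powr q * (\<Sum>k<N. u k powr q / (real (Suc k))\<^sup>2))"
      by (simp only: sum_distrib_left)
    also have "\<dots> \<le> C1 * (K' powr q * (C2 * (\<integral>t. norm (g t) powr q \<partial>circ)))"
      using C1 by (intro mult_left_mono le) auto
    finally show "(\<integral>t. norm (\<Sum>k<N. (\<Sum>n\<in>{k..<N}. of_real (v k n) * fourier g n) * cis (real k * t)) powr q \<partial>circ)
      \<le> C1 * (K' powr q * C2) * (\<integral>t. norm (g t) powr q \<partial>circ)"
      using hl[rule_format, of E N] by (simp add: E_def mult.assoc)
  qed
qed

lemma decseq_rhaly_bounded:
  fixes \<eta> :: "nat \<Rightarrow> real"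
  assumes p: "1 < p" "p < 2" and dec: "decseq \<eta>" and nn: "\<And>n. 0 \<le> \<eta> n"
    and \<eta>: "\<eta> \<in> O(\<lambda>n. 1 / of_nat n)"
  shows "rhaly_bounded p (\<lambda>n. complex_of_real (\<eta> n))"
proof -
  let ?\<eta> = "\<lambda>n. complex_of_real (\<eta> n)"
  obtain K where K: "K > 0" "\<And>n. \<eta> n \<le> K / real (Suc n)"
    using \<eta> nn unfolding bigo_inverse_nat_iff by auto
  have KB: "norm (?\<eta> n) \<le> K" for n
  proof -
    have "K / real (Suc n) \<le> K" using K(1) by (simp add: field_simps)
    then show ?thesis using K(2)[of n] nn by simp
  qed
  define q where "q = p / (p - 1)"
  have q: "2 \<le> q" "1 < q" and pq: "1 / p + 1 / q = 1" using p by (auto simp: q_def field_simps)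
  note ce = conjugate_exponent[OF p(1) q(2) pq]
  obtain C where C: "C > 0" and adj: "\<forall>g B N v. g \<in> borel_measurable borel \<longrightarrow> (\<forall>t. norm (g t) \<le> B) \<longrightarrow>
    (\<forall>k. decseq (v k) \<and> (\<forall>n. 0 \<le> v k n \<and> v k n \<le> K / real (Suc n))) \<longrightarrow>
    (\<integral>t. norm (\<Sum>k<N. (\<Sum>n\<in>{k..<N}. of_real (v k n) * fourier g n) * cis (real k * t)) powr q \<partial>circ)
      \<le> C * (\<integral>t. norm (g t) powr q \<partial>circ)"
    using adjoint_polynomial_bound[OF q(1) K(1)] by blast
  \<comment> \<open>Makes \<open>L powr (- q) * C = 1\<close>, so that the constant of the adjoint
    bound disappears and the term \<open>X / q\<close> can be absorbed into
    \<open>X\<close>.\<close>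
  define L where "L = C powr (1 / q)"
  have L: "L > 0" using C by (simp add: L_def)
  have Lq: "L powr (- q) = 1 / C" using C q by (simp add: L_def powr_powr powr_minus_divide)
  have p0: "0 < p" using p by simp
  show ?thesis
  proof (rule rhaly_boundedI[OF p0 KB])
    show "0 \<le> L powr p" by simp
    fix f r assume f: "f \<in> hardy_space p" and r: "0 < r" "r < (1::real)"
    note hol = hardy_spaceD[OF f]
    note def = rhaly_defined_bounded[OF hol KB]
    define c where "c n = rhaly_coeff ?\<eta> f n * of_real r ^ n" for n
    have c: "summable (\<lambda>n. norm (c n))"
      unfolding c_def by (rule rhaly_circle(1)[OF def]) (use r in auto)
    define F where "F t = (\<Sum>n. c n * cis (real n * t))" for t
    have F_eq: "rhaly ?\<eta> f (of_real r * cis t) = F t" for t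
      unfolding F_def c_def by (rule rhaly_circle(2)[OF def]) (use r in auto)
    have [measurable]: "F \<in> borel_measurable borel" unfolding F_def by measurable
    define B where "B = (\<Sum>n. norm (c n))"
    have FB: "norm (F t) \<le> B" for t
      unfolding F_def B_def by (rule norm_fourier_series_le[OF c])
    \<comment> \<open>As \<open>p < 2\<close>, this relies on \<open>0 powr (p - 2) = 0\<close>.\<close>
    define g where "g t = of_real (norm (F t) powr (p - 2)) * F t" for t
    have gm [measurable]: "g \<in> borel_measurable borel" unfolding g_def by measurable
    have normg: "norm (g t) = norm (F t) powr (p - 1)" for t
      using powr_add[of "norm (F t)" "p - 2" 1] by (simp add: g_def norm_mult)
    have gB: "norm (g t) \<le> B powr (p - 1)" for t
      unfolding normg using p by (intro powr_mono2 FB) auto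
    have Fg: "F t * cnj (g t) = of_real (norm (F t) powr p)" for t
    proof -
      have "F t * cnj (g t) = of_real (norm (F t) powr (p - 2) * (norm (F t))\<^sup>2)"
        by (simp add: g_def complex_norm_square mult_ac del: of_real_power)
      also have "norm (F t) powr (p - 2) * (norm (F t))\<^sup>2 = norm (F t) powr p"
        using powr_add[of "norm (F t)" "p - 2" 2] by (cases "F t = 0") (auto simp: powr_numeral)
      finally show ?thesis .
    qed
    define X where "X = (\<integral>t. norm (F t) powr p \<partial>circ)"
    have Xg: "(\<integral>t. norm (g t) powr q \<partial>circ) = X"
      unfolding X_def normg using ce by (simp add: powr_powr)
    have "(\<lambda>n. c n * cnj (fourier g n)) sums (\<integral>t. F t * cnj (g t) \<partial>circ)"
      unfolding F_def by (rule fourier_pairing[OF c gm gB])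
    then have lim: "(\<lambda>N. \<Sum>n<N. c n * cnj (fourier g n)) \<longlonglongrightarrow> complex_of_real X"
      unfolding Fg X_def by (simp add: sums_def)
    define a where "a n = taylor f n * of_real r ^ n" for n
    have a: "summable (\<lambda>n. norm (a n))"
      unfolding a_def by (rule taylor_summable[OF hol]) (use r in auto)
    define A where "A = (\<Sum>n. norm (a n))"
    define h where "h t = (\<Sum>n. a n * cis (real n * t))" for t
    have h_eq: "f (of_real r * cis t) = h t" for t
      unfolding h_def a_def by (rule taylor_circle[OF hol]) (use r in auto)
    have [measurable]: "h \<in> borel_measurable borel" unfolding h_def by measurable
    have hA: "norm (h t) \<le> A" for t
      unfolding h_def A_def by (rule norm_fourier_series_le[OF a])
    have bound: "norm (\<Sum>n<N. c n * cnj (fourier g n)) \<le> L powr p * hardy_norm p f powr p / p + X / q" for N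
    proof -
      \<comment> \<open>For \<open>k \<le> n\<close>, \<open>a k\<close> carries
        \<open>r ^ k\<close> and \<open>v k n\<close> the rest of \<open>r ^ n\<close>. The exponent
        is 0 for \<open>n < k\<close>, so \<open>v k\<close> is decreasing from index 0 on.\<close>
      define v where "v k n = \<eta> n * r ^ (n - k)" for k n
      have v: "decseq (v k) \<and> (\<forall>n. 0 \<le> v k n \<and> v k n \<le> K / real (Suc n))" for k
      proof (intro conjI allI)
        show "decseq (v k)"
          unfolding v_def decseq_def using nn r
          by (intro allI impI mult_mono decseqD[OF dec] power_decreasing) auto
        fix n
        show "0 \<le> v k n" using nn r by (simp add: v_def)
        have "\<eta> n * r ^ (n - k) \<le> \<eta> n * 1"
          using nn r by (intro mult_left_mono power_le_one) auto
        then show "v k n \<le> K / real (Suc n)" using K(2)[of n] by (simp add: v_def)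
      qed
      define E where "E k = (\<Sum>n\<in>{k..<N}. of_real (v k n) * fourier g n)" for k
      define G where "G t = (\<Sum>k<N. E k * cis (real k * t))" for t
      have [measurable]: "G \<in> borel_measurable borel" unfolding G_def by measurable
      define D where "D = (\<Sum>k<N. norm (E k))"
      have GD: "norm (G t) \<le> D" for t
        unfolding G_def D_def by (rule order_trans[OF norm_sum]) (simp add: norm_mult)
      have Gq: "(\<integral>t. norm (G t) powr q \<partial>circ) \<le> C * X"
        unfolding G_def E_def Xg[symmetric] using adj gm gB v by blast
      have "(\<Sum>n<N. c n * cnj (fourier g n)) = (\<Sum>n<N. \<Sum>k\<le>n. a k * (of_real (v k n) * cnj (fourier g n)))"
      proof (intro sum.cong refl)
        fix n
        have "a k * of_real (v k n) = ?\<eta> n * taylor f k * of_real r ^ n" if "k \<le> n" for k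
          using that by (simp add: a_def v_def power_add[symmetric] mult_ac)
        then have "(\<Sum>k\<le>n. a k * of_real (v k n) * cnj (fourier g n)) = (\<Sum>k\<le>n. ?\<eta> n * taylor f k * of_real r ^ n * cnj (fourier g n))"
          by (intro sum.cong refl) simp
        also have "\<dots> = c n * cnj (fourier g n)"
          by (simp add: c_def rhaly_coeff_def sum_distrib_left sum_distrib_right)
        finally show "c n * cnj (fourier g n) = (\<Sum>k\<le>n. a k * (of_real (v k n) * cnj (fourier g n)))"
          by (simp add: mult.assoc)
      qed
      \<comment> \<open>Summing over the triangle \<open>k \<le> n < N\<close> by columns moves the
        operator from \<open>f\<close> to \<open>g\<close>: partial sums of \<open>f\<close> become
        tails for \<open>g\<close>.\<close>
      also have "\<dots> = (\<Sum>k<N. \<Sum>n\<in>{k..<N}. a k * (of_real (v k n) * cnj (fourier g n)))"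
        by (simp add: sum.Sigma) (rule sum.reindex_bij_witness[where i = "\<lambda>(k, n). (n, k)" and j = "\<lambda>(n, k). (k, n)"], auto)
      also have "\<dots> = (\<Sum>k<N. a k * cnj (E k))"
        by (simp add: E_def sum_distrib_left)
      also have "\<dots> = (\<integral>t. h t * cnj (G t) \<partial>circ)"
      proof -
        have "(\<lambda>n. a n * cnj (fourier G n)) sums (\<integral>t. h t * cnj (G t) \<partial>circ)"
          unfolding h_def by (rule fourier_pairing[OF a _ GD]) measurable
        moreover have "fourier G n = (if n < N then E n else 0)" for n
          unfolding G_def by (rule fourier_polynomial)
        then have "a n * cnj (fourier G n) = (if n \<in> {..<N} then a n * cnj (E n) else 0)" for n by simp
        ultimately have "(\<lambda>n. if n \<in> {..<N} then a n * cnj (E n) else 0) sums (\<integral>t. h t * cnj (G t) \<partial>circ)"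
          by simp
        moreover have "(\<lambda>n. if n \<in> {..<N} then a n * cnj (E n) else 0) sums (\<Sum>n<N. a n * cnj (E n))"
          by (rule sums_If_finite_set) simp
        ultimately show ?thesis using sums_unique2 by blast
      qed
      finally have "norm (\<Sum>n<N. c n * cnj (fourier g n)) \<le> (\<integral>t. norm (h t) * norm (G t) \<partial>circ)"
        by (simp add: order_trans[OF integral_norm_bound] norm_mult)
      also have "\<dots> \<le> (\<integral>t. L powr p * norm (h t) powr p / p + L powr (- q) * norm (G t) powr q / q \<partial>circ)"
      proof (rule integral_mono)
        have "0 \<le> A" using hA[of 0] norm_ge_zero order_trans by blast
        then show "integrable circ (\<lambda>t. norm (h t) * norm (G t))"
          by (intro integrable_circ_bounded[of _ "A * D"]) (auto intro!: mult_mono hA GD)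
        show "integrable circ (\<lambda>t. L powr p * norm (h t) powr p / p + L powr (- q) * norm (G t) powr q / q)"
          by (intro integrable_circ_bounded[of _ "L powr p * A powr p / p + L powr (- q) * D powr q / q"])
             (use p q in \<open>auto intro!: add_mono divide_right_mono mult_left_mono powr_mono2 hA GD\<close>)
      qed (use young_scaled[OF p(1) q(2) pq] L in auto)
      also have "\<dots> = L powr p * (\<integral>t. norm (h t) powr p \<partial>circ) / p + L powr (- q) * (\<integral>t. norm (G t) powr q \<partial>circ) / q"
      proof -
        have "integrable circ (\<lambda>t. norm (h t) powr p)"
          by (rule integrable_circ_bounded[of _ "A powr p"]) (use p hA in \<open>auto intro!: powr_mono2\<close>)
        moreover have "integrable circ (\<lambda>t. norm (G t) powr q)"
          by (rule integrable_circ_bounded[of _ "D powr q"]) (use q GD in \<open>auto intro!: powr_mono2\<close>)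
        ultimately show ?thesis by simp
      qed
      also have "\<dots> \<le> L powr p * hardy_norm p f powr p / p + L powr (- q) * (C * X) / q"
      proof (intro add_mono divide_right_mono mult_left_mono Gq)
        show "(\<integral>t. norm (h t) powr p \<partial>circ) \<le> hardy_norm p f powr p"
          using integral_circle_le_hardy_norm[OF f r p0] by (simp add: h_eq)
      qed (use p q in auto)
      also have "L powr (- q) * (C * X) / q = X / q" using C Lq by simp
      finally show ?thesis .
    qed
    \<comment> \<open>The bound on the truncated pairings does not depend on \<open>N\<close>, so it
      survives the limit; \<open>X / q\<close> is then subtracted from
      \<open>X = X / p + X / q\<close>.\<close>
    have "norm (complex_of_real X) \<le> L powr p * hardy_norm p f powr p / p + X / q"
      by (rule LIMSEQ_le_const2[OF tendsto_norm[OF lim]]) (use bound in auto)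
    moreover have "X \<le> norm (complex_of_real X)" by simp
    moreover have "X = X / p + X / q" using arg_cong[OF pq, of "(*) X"] by (simp add: distrib_left)
    ultimately have "X / p \<le> L powr p * hardy_norm p f powr p / p" by linarith
    then have "X \<le> L powr p * hardy_norm p f powr p" using p by (simp add: divide_le_cancel)
    then show "(\<integral>t. norm (rhaly ?\<eta> f (of_real r * cis t)) powr p \<partial>circ) \<le> L powr p * hardy_norm p f powr p"
      by (simp add: F_eq X_def)
  qed
qed

lemma bigo_of_real_inverse_nat:
  "(\<lambda>n. complex_of_real (\<eta> n)) \<in> O(\<lambda>n. 1 / of_nat n) \<longleftrightarrow> \<eta> \<in> O(\<lambda>n. 1 / of_nat n)"
  unfolding bigo_inverse_nat_iff by simp

theorem theorem5:
  "(\<forall>(p::real) \<eta> :: nat \<Rightarrow> complex.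
      2 \<le> p \<longrightarrow> \<eta> \<in> O(\<lambda>n. 1 / of_nat n) \<longrightarrow> rhaly_bounded p \<eta>) \<and>
   (\<exists>\<eta> :: nat \<Rightarrow> complex. \<eta> \<in> O(\<lambda>n. 1 / of_nat n) \<and>
      (\<forall>p::real. 1 \<le> p \<longrightarrow> p < 2 \<longrightarrow> \<not> rhaly_bounded p \<eta>)) \<and>
   (\<forall>(p::real) \<eta> :: nat \<Rightarrow> real.
      1 < p \<longrightarrow> decseq \<eta> \<longrightarrow> (\<forall>n. 0 \<le> \<eta> n) \<longrightarrow>
      (rhaly_bounded p (\<lambda>n. complex_of_real (\<eta> n)) \<longleftrightarrow> \<eta> \<in> O(\<lambda>n. 1 / of_nat n)))"
proof (intro conjI allI impI)
  show "rhaly_bounded p \<eta>" if "2 \<le> p" "\<eta> \<in> O(\<lambda>n. 1 / of_nat n)" for p \<eta>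
    using that by (rule rhaly_bounded_ge_2)
  show "\<exists>\<eta> :: nat \<Rightarrow> complex. \<eta> \<in> O(\<lambda>n. 1 / of_nat n) \<and>
      (\<forall>p::real. 1 \<le> p \<longrightarrow> p < 2 \<longrightarrow> \<not> rhaly_bounded p \<eta>)"
    using rudin_shapiro_weight_bigo rudin_shapiro_weight_not_bounded by blast
  fix p :: real and \<eta> :: "nat \<Rightarrow> real"
  assume p: "1 < p" and \<eta>: "decseq \<eta>" "\<forall>n. 0 \<le> \<eta> n"
  show "rhaly_bounded p (\<lambda>n. complex_of_real (\<eta> n)) \<longleftrightarrow> \<eta> \<in> O(\<lambda>n. 1 / of_nat n)"
  proof
    assume "rhaly_bounded p (\<lambda>n. complex_of_real (\<eta> n))"
    with p \<eta> show "\<eta> \<in> O(\<lambda>n. 1 / of_nat n)"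
      by (intro decseq_rhaly_bounded_imp_bigo) auto
  next
    assume big: "\<eta> \<in> O(\<lambda>n. 1 / of_nat n)"
    show "rhaly_bounded p (\<lambda>n. complex_of_real (\<eta> n))"
    proof (cases "p < 2")
      case True
      with p \<eta> big show ?thesis by (intro decseq_rhaly_bounded) auto
    next
      case False
      with big show ?thesis by (intro rhaly_bounded_ge_2) (auto simp: bigo_of_real_inverse_nat)
    qed
  qed
qed

end
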